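(* The three classes of distributions $\mathrm{GP}_R(\boldsymbol\sigma,\boldsymbol\gamma,F_{\mathbf R})$, $\mathrm{GP}_U(\boldsymbol\sigma,\boldsymbol\gamma,F_{\mathbf U})$ and $\mathrm{GP}_S(\boldsymbol\sigma,\boldsymbol\gamma,F_{\mathbf S})$ (with $\boldsymbol\sigma>\mathbf 0$, $\boldsymbol\gamma\in\mathbb R^d$, and $\mathbf R,\mathbf U,\mathbf S$ ranging over the admissible random vectors) are all equal to the class of all $d$-variate generalized Pareto distributions with $\boldsymbol\sigma>\mathbf 0$. For each class, the conditional marginal distributions are given, for $j=1,\dots,d$, by $$H_j^+(x)=1-\left(1+\gamma_j\tfrac{x}{\sigma_j}\right)^{-1/\gamma_j}\quad\text{for }x\ge0\text{ such that }\sigma_j+\gamma_jx>0,$$ where $H_j^+$ is the $j$-th marginal distribution conditioned to be positive.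
   Context: Notation. Operations and relations on $d$-vectors are componentwise; $\wedge$ is minimum; $\mathbf x\nleq\mathbf y$ means not $\mathbf x\le\mathbf y$; $\bar F=1-F$; for a random vector $\mathbf Y$, $F_{\mathbf Y}(\mathbf x)=\Pr[\mathbf Y\le\mathbf x]$; $\log t$ added to a vector is added to every component. For $\gamma=0$, $(1+\gamma x)^{1/\gamma}$ is read as $e^x$. Generalized Pareto (GP) distributions. A $d$-variate GEV cdf $G$ is a max-stable cdf with non-degenerate margins (for each $t>0$ there are $\mathbf a_t\in(0,\infty)^d,\mathbf b_t\in\mathbb R^d$ with $G(\mathbf a_t\mathbf x+\mathbf b_t)^t=G(\mathbf x)$); its margins are $G_j(x)=\exp\{-(1+\gamma_j\frac{x-\mu_j}{\alpha_j})^{-1/\gamma_j}\}$ for $\alpha_j+\gamma_j(x-\mu_j)>0$, with $\gamma_j,\mu_j\in\mathbb R$, $\alpha_j>0$. Put $\sigma_j=\alpha_j-\gamma_j\mu_j$ and let $\eta_j$ be the lower endpoint of $G_j$. If $0<G(\mathbf 0)<1$, the GP distribution associated to $G$ is the distribution on $[-\infty,\infty)^d$ with cdf $H(\mathbf x)=\frac1{\log G(\mathbf 0)}\log\big(\frac{G(\mathbf x\wedge\mathbf 0)}{G(\mathbf x)}\big)$ for $\mathbf x>\boldsymbol\eta$, $H(\mathbf x)=0$ if $x_j<\eta_j$ for some $j$, and extended by right-continuity; its parameters are $\boldsymbol\gamma$ and $\boldsymbol\sigma$. (R) representation. $\mathbf R$ is admissible (for given $\boldsymbol\gamma,\boldsymbol\sigma>\mathbf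 0$) if $R_j\in[0,\infty)$ when $\gamma_j>0$, $R_j\in[-\infty,\infty)$ when $\gamma_j=0$, $R_j\in[-\infty,0)$ when $\gamma_j<0$, and $0<\mathrm E[|R_j|^{1/\gamma_j}]<\infty$ if $\gamma_j\neq0$, $0<\mathrm E[\exp(R_j/\sigma_j)]<\infty$ if $\gamma_j=0$, for all $j$. $\mathrm{GP}_R(\boldsymbol\sigma,\boldsymbol\gamma,F_{\mathbf R})$ is the distribution with cdf $$H_R(\mathbf x)=\frac{\int_0^\infty\{F_{\mathbf R}(t^{\boldsymbol\gamma}(\mathbf x+\frac{\boldsymbol\sigma}{\boldsymbol\gamma}))-F_{\mathbf R}(t^{\boldsymbol\gamma}(\mathbf x\wedge\mathbf 0+\frac{\boldsymbol\sigma}{\boldsymbol\gamma}))\}\,dt}{\int_0^\infty\bar F_{\mathbf R}(t^{\boldsymbol\gamma}\frac{\boldsymbol\sigma}{\boldsymbol\gamma})\,dt},$$ where, if $\gamma_j=0$, $t^{\gamma_j}(x_j+\frac{\sigma_j}{\gamma_j})$ is interpreted as $x_j+\sigma_j\log t$. (U) representation. $\mathbf U$ is admissible if it takes values in $[-\infty,\infty)^d$ and $0<\mathrm E(e^{U_j})<\infty$ for all $j$. $\mathrm{GP}_U(\boldsymbol\sigma,\boldsymbol\gamma,F_{\mathbf U})$ is the distribution with cdf, for $\mathbf x$ with $\boldsymbol\gamma\mathbf x+\boldsymbol\sigma>\mathbf 0$, $$H_U(\mathbf x)=\frac{\int_0^\infty\{F_{\mathbf U}(\frac1{\boldsymbol\gamma}\log(\frac{\boldsymbol\gamma}{\boldsymbol\sigma}\mathbf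 x+1)+\log t)-F_{\mathbf U}(\frac1{\boldsymbol\gamma}\log(\frac{\boldsymbol\gamma}{\boldsymbol\sigma}(\mathbf x\wedge\mathbf 0)+1)+\log t)\}\,dt}{\int_0^\infty\bar F_{\mathbf U}(\log t)\,dt},$$ where $\frac1{\gamma_j}\log(\frac{\gamma_j}{\sigma_j}x_j+1)$ is read as $x_j/\sigma_j$ if $\gamma_j=0$. (It corresponds to (R) through $\mathbf R=\frac{\boldsymbol\sigma}{\boldsymbol\gamma}e^{\boldsymbol\gamma\mathbf U}$, with $R_j=\sigma_jU_j$ if $\gamma_j=0$.) (S) representation. This is the case $\mathbf U=\mathbf S$ where $\mathbf S$ is admissible for (U) and satisfies $\bigvee_{j=1}^dS_j=0$. $\mathrm{GP}_S(\boldsymbol\sigma,\boldsymbol\gamma,F_{\mathbf S})$ is the distribution with cdf $$H_S(\mathbf x)=\int_0^1F_{\mathbf S}\big(\tfrac1{\boldsymbol\gamma}\log(\tfrac{\boldsymbol\gamma}{\boldsymbol\sigma}\mathbf x+1)+\log t\big)\,dt=\int_0^\infty F_{\mathbf S}\big(\tfrac1{\boldsymbol\gamma}\log(\tfrac{\boldsymbol\gamma}{\boldsymbol\sigma}\mathbf x+1)-v\big)e^{-v}\,dv$$ for $\boldsymbol\gamma\mathbf x+\boldsymbol\sigma>\mathbf 0$, with the same convention when $\gamma_j=0$. *)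

theory Defs
  imports "HOL-Probability.Probability"
begin

text \<open>
  A finite index type \<open>'n\<close> stands for the index set \<open>{1,...,d}\<close>. A random vector with values in
  \<open>[-\<infinity>,\<infinity>)\<^sup>d\<close> enters every construction below only through its law, so random vectors are
  represented by their laws: probability measures on the product \<open>\<sigma>\<close>-algebra of \<open>'n \<Rightarrow> ereal\<close>
  that do not charge the value \<open>+\<infinity>\<close>. Such a law is determined by its cdf at real arguments.
\<close>

definition is_law :: "('n::finite \<Rightarrow> ereal) measure \<Rightarrow> bool" where
  "is_law \<rho> \<longleftrightarrow> prob_space \<rho> \<and> sets \<rho> = sets (Pi\<^sub>M UNIV (\<lambda>_. borel)) \<and>
     (AE y in \<rho>. \<forall>j. y j < \<infinity>)"

definition joint_cdf :: "('n::finite \<Rightarrow> ereal) measure \<Rightarrow> ('n \<Rightarrow> real) \<Rightarrow> real" where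
  "joint_cdf \<rho> x = measure \<rho> {y \<in> space \<rho>. \<forall>j. y j \<le> ereal (x j)}"

definition min0 :: "('n \<Rightarrow> real) \<Rightarrow> 'n \<Rightarrow> real" where
  "min0 x = (\<lambda>j. min (x j) 0)"

text \<open>\<open>(1 + \<gamma> x) ^ (-1/\<gamma>)\<close>, read as \<open>exp (-x)\<close> for \<open>\<gamma> = 0\<close>; only used for \<open>1 + \<gamma> x > 0\<close>.\<close>

definition gp_tail :: "real \<Rightarrow> real \<Rightarrow> real" where
  "gp_tail \<gamma> x = (if \<gamma> = 0 then exp (- x) else (1 + \<gamma> * x) powr (- 1 / \<gamma>))"


section \<open>GEV distributions and the associated GP distributions\<close>

definition real_cdf :: "('n::finite \<Rightarrow> real) measure \<Rightarrow> ('n \<Rightarrow> real) \<Rightarrow> real" where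
  "real_cdf P x = measure P {y \<in> space P. \<forall>j. y j \<le> x j}"

definition margin_cdf :: "('n::finite \<Rightarrow> real) measure \<Rightarrow> 'n \<Rightarrow> real \<Rightarrow> real" where
  "margin_cdf P j = cdf (distr P borel (\<lambda>y. y j))"

definition max_stable :: "('n::finite \<Rightarrow> real) measure \<Rightarrow> bool" where
  "max_stable P \<longleftrightarrow> (\<forall>t>0. \<exists>a b. (\<forall>j. 0 < a j) \<and>
     (\<forall>x. real_cdf P (\<lambda>j. a j * x j + b j) powr t = real_cdf P x))"

definition is_gev :: "('n::finite \<Rightarrow> real) measure \<Rightarrow> bool" where
  "is_gev P \<longleftrightarrow> prob_space P \<and> sets P = sets (Pi\<^sub>M UNIV (\<lambda>_. borel)) \<and> max_stable P \<and>
     (\<forall>j. \<not> (\<exists>c. AE y in P. y j = c))"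

definition gev_margins ::
  "('n::finite \<Rightarrow> real) measure \<Rightarrow> ('n \<Rightarrow> real) \<Rightarrow> ('n \<Rightarrow> real) \<Rightarrow> ('n \<Rightarrow> real) \<Rightarrow> bool" where
  "gev_margins P \<gamma> m \<alpha> \<longleftrightarrow> (\<forall>j. 0 < \<alpha> j) \<and>
     (\<forall>j x. 0 < \<alpha> j + \<gamma> j * (x - m j) \<longrightarrow>
        margin_cdf P j x = exp (- gp_tail (\<gamma> j) ((x - m j) / \<alpha> j)))"

definition lower_endpoint :: "('n::finite \<Rightarrow> real) measure \<Rightarrow> 'n \<Rightarrow> ereal" where
  "lower_endpoint P j = (INF x\<in>{x. 0 < margin_cdf P j x}. ereal x)"

text \<open>
  The values on the boundary, where some \<open>x j\<close> equals the lower endpoint, are fixed by the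
  right-continuity of \<open>joint_cdf\<close>.
\<close>

definition gp_of :: "('n::finite \<Rightarrow> real) measure \<Rightarrow> ('n \<Rightarrow> ereal) measure" where
  "gp_of P = (THE \<mu>. is_law \<mu> \<and>
     (\<forall>x. (\<forall>j. lower_endpoint P j < ereal (x j)) \<longrightarrow>
        joint_cdf \<mu> x =
          1 / ln (real_cdf P (\<lambda>_. 0)) * ln (real_cdf P (min0 x) / real_cdf P x)) \<and>
     (\<forall>x. (\<exists>j. ereal (x j) < lower_endpoint P j) \<longrightarrow> joint_cdf \<mu> x = 0))"

definition GP_class ::
  "('n::finite \<Rightarrow> real) \<Rightarrow> ('n \<Rightarrow> real) \<Rightarrow> ('n \<Rightarrow> ereal) measure set" where
  "GP_class \<sigma> \<gamma> = {gp_of P | P. is_gev P \<and>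
     (\<exists>m \<alpha>. gev_margins P \<gamma> m \<alpha> \<and> (\<forall>j. \<sigma> j = \<alpha> j - \<gamma> j * m j)) \<and>
     0 < real_cdf P (\<lambda>_. 0) \<and> real_cdf P (\<lambda>_. 0) < 1}"


section \<open>The (R) representation\<close>

text \<open>
  The integrand whose expectation is constrained: \<open>|r| ^ (1/\<gamma>)\<close> or \<open>exp (r/\<sigma>)\<close>. Its value at
  \<open>r = -\<infinity>\<close>, which is possible only for \<open>\<gamma> \<le> 0\<close>, is \<open>\<infinity> ^ (1/\<gamma>) = 0\<close> respectively
  \<open>exp (-\<infinity>) = 0\<close>.
\<close>

definition R_moment :: "real \<Rightarrow> real \<Rightarrow> ereal \<Rightarrow> real" where
  "R_moment \<sigma> \<gamma> r = (if r = -\<infinity> then 0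
     else if \<gamma> = 0 then exp (real_of_ereal r / \<sigma>)
     else \<bar>real_of_ereal r\<bar> powr (1 / \<gamma>))"

definition R_admissible ::
  "('n::finite \<Rightarrow> real) \<Rightarrow> ('n \<Rightarrow> real) \<Rightarrow> ('n \<Rightarrow> ereal) measure \<Rightarrow> bool" where
  "R_admissible \<sigma> \<gamma> \<rho> \<longleftrightarrow> is_law \<rho> \<and>
     (\<forall>j. (0 < \<gamma> j \<longrightarrow> (AE r in \<rho>. 0 \<le> r j)) \<and>
          (\<gamma> j < 0 \<longrightarrow> (AE r in \<rho>. r j < 0)) \<and>
          0 < (\<integral>\<^sup>+r. ennreal (R_moment (\<sigma> j) (\<gamma> j) (r j)) \<partial>\<rho>) \<and>
          (\<integral>\<^sup>+r. ennreal (R_moment (\<sigma> j) (\<gamma> j) (r j)) \<partial>\<rho>) < \<infinity>)"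

text \<open>\<open>t ^ \<gamma> (x + \<sigma>/\<gamma>)\<close> componentwise, read as \<open>x + \<sigma> log t\<close> where \<open>\<gamma> = 0\<close>.\<close>

definition R_arg :: "('n \<Rightarrow> real) \<Rightarrow> ('n \<Rightarrow> real) \<Rightarrow> ('n \<Rightarrow> real) \<Rightarrow> real \<Rightarrow> 'n \<Rightarrow> real" where
  "R_arg \<sigma> \<gamma> x t = (\<lambda>j. if \<gamma> j = 0 then x j + \<sigma> j * ln t
     else t powr (\<gamma> j) * (x j + \<sigma> j / \<gamma> j))"

definition H_R ::
  "('n::finite \<Rightarrow> real) \<Rightarrow> ('n \<Rightarrow> real) \<Rightarrow> ('n \<Rightarrow> ereal) measure \<Rightarrow> ('n \<Rightarrow> real) \<Rightarrow> real" where
  "H_R \<sigma> \<gamma> \<rho> x =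
     (LINT t:{0<..}|lborel.
        joint_cdf \<rho> (R_arg \<sigma> \<gamma> x t) - joint_cdf \<rho> (R_arg \<sigma> \<gamma> (min0 x) t)) /
     (LINT t:{0<..}|lborel. 1 - joint_cdf \<rho> (R_arg \<sigma> \<gamma> (\<lambda>_. 0) t))"

definition GP_R ::
  "('n::finite \<Rightarrow> real) \<Rightarrow> ('n \<Rightarrow> real) \<Rightarrow> ('n \<Rightarrow> ereal) measure \<Rightarrow> ('n \<Rightarrow> ereal) measure" where
  "GP_R \<sigma> \<gamma> \<rho> = (THE \<mu>. is_law \<mu> \<and> (\<forall>x. joint_cdf \<mu> x = H_R \<sigma> \<gamma> \<rho> x))"

definition GP_R_class ::
  "('n::finite \<Rightarrow> real) \<Rightarrow> ('n \<Rightarrow> real) \<Rightarrow> ('n \<Rightarrow> ereal) measure set" where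
  "GP_R_class \<sigma> \<gamma> = {GP_R \<sigma> \<gamma> \<rho> | \<rho>. R_admissible \<sigma> \<gamma> \<rho>}"


section \<open>The (U) representation\<close>

definition exp_ereal :: "ereal \<Rightarrow> real" where
  "exp_ereal u = (if u = -\<infinity> then 0 else exp (real_of_ereal u))"

definition U_admissible :: "('n::finite \<Rightarrow> ereal) measure \<Rightarrow> bool" where
  "U_admissible \<rho> \<longleftrightarrow> is_law \<rho> \<and>
     (\<forall>j. 0 < (\<integral>\<^sup>+u. ennreal (exp_ereal (u j)) \<partial>\<rho>) \<and>
          (\<integral>\<^sup>+u. ennreal (exp_ereal (u j)) \<partial>\<rho>) < \<infinity>)"

text \<open>\<open>(1/\<gamma>) log ((\<gamma>/\<sigma>) x + 1) + log t\<close> componentwise, read as \<open>x/\<sigma> + log t\<close> where \<open>\<gamma> = 0\<close>.\<close>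

definition U_arg :: "('n \<Rightarrow> real) \<Rightarrow> ('n \<Rightarrow> real) \<Rightarrow> ('n \<Rightarrow> real) \<Rightarrow> real \<Rightarrow> 'n \<Rightarrow> real" where
  "U_arg \<sigma> \<gamma> x t = (\<lambda>j. (if \<gamma> j = 0 then x j / \<sigma> j
     else 1 / \<gamma> j * ln (\<gamma> j / \<sigma> j * x j + 1)) + ln t)"

definition H_U ::
  "('n::finite \<Rightarrow> real) \<Rightarrow> ('n \<Rightarrow> real) \<Rightarrow> ('n \<Rightarrow> ereal) measure \<Rightarrow> ('n \<Rightarrow> real) \<Rightarrow> real" where
  "H_U \<sigma> \<gamma> \<rho> x =
     (LINT t:{0<..}|lborel.
        joint_cdf \<rho> (U_arg \<sigma> \<gamma> x t) - joint_cdf \<rho> (U_arg \<sigma> \<gamma> (min0 x) t)) /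
     (LINT t:{0<..}|lborel. 1 - joint_cdf \<rho> (\<lambda>_. ln t))"

text \<open>
  The formulas for the (U) and (S) cdfs are stated only where \<open>\<gamma> x + \<sigma> > 0\<close>. If \<open>\<gamma> j > 0\<close> they
  leave open how the mass of \<open>{X j \<le> -\<sigma> j/\<gamma> j}\<close> (the contribution of \<open>U j = -\<infinity>\<close>) is spread;
  as for GP distributions in general, nothing lies strictly below the lower endpoint
  \<open>-\<sigma> j/\<gamma> j\<close>. Where \<open>\<gamma> j \<le> 0\<close> the lower endpoint is \<open>-\<infinity>\<close>. All other values
  follow from right-continuity and total mass 1.
\<close>

definition cdf_spec ::
  "('n::finite \<Rightarrow> real) \<Rightarrow> ('n \<Rightarrow> real) \<Rightarrow> (('n \<Rightarrow> real) \<Rightarrow> real) \<Rightarrow> ('n \<Rightarrow> ereal) measure \<Rightarrow> bool"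
  where
  "cdf_spec \<sigma> \<gamma> H \<mu> \<longleftrightarrow> is_law \<mu> \<and>
     (\<forall>x. (\<forall>j. 0 < \<gamma> j * x j + \<sigma> j) \<longrightarrow> joint_cdf \<mu> x = H x) \<and>
     (\<forall>x. (\<exists>j. 0 < \<gamma> j \<and> x j < - \<sigma> j / \<gamma> j) \<longrightarrow> joint_cdf \<mu> x = 0)"

definition GP_U ::
  "('n::finite \<Rightarrow> real) \<Rightarrow> ('n \<Rightarrow> real) \<Rightarrow> ('n \<Rightarrow> ereal) measure \<Rightarrow> ('n \<Rightarrow> ereal) measure" where
  "GP_U \<sigma> \<gamma> \<rho> = (THE \<mu>. cdf_spec \<sigma> \<gamma> (H_U \<sigma> \<gamma> \<rho>) \<mu>)"

definition GP_U_class ::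
  "('n::finite \<Rightarrow> real) \<Rightarrow> ('n \<Rightarrow> real) \<Rightarrow> ('n \<Rightarrow> ereal) measure set" where
  "GP_U_class \<sigma> \<gamma> = {GP_U \<sigma> \<gamma> \<rho> | \<rho>. U_admissible \<rho>}"


section \<open>The (S) representation\<close>

definition S_admissible :: "('n::finite \<Rightarrow> ereal) measure \<Rightarrow> bool" where
  "S_admissible \<rho> \<longleftrightarrow> U_admissible \<rho> \<and> (AE s in \<rho>. Max (range s) = 0)"

text \<open>The form with integrand \<open>F (... - v) exp (-v)\<close> over \<open>v > 0\<close> is the substitution \<open>v = -log t\<close>.\<close>

definition H_S ::
  "('n::finite \<Rightarrow> real) \<Rightarrow> ('n \<Rightarrow> real) \<Rightarrow> ('n \<Rightarrow> ereal) measure \<Rightarrow> ('n \<Rightarrow> real) \<Rightarrow> real" where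
  "H_S \<sigma> \<gamma> \<rho> x = (LINT t:{0<..<1}|lborel. joint_cdf \<rho> (U_arg \<sigma> \<gamma> x t))"

definition GP_S ::
  "('n::finite \<Rightarrow> real) \<Rightarrow> ('n \<Rightarrow> real) \<Rightarrow> ('n \<Rightarrow> ereal) measure \<Rightarrow> ('n \<Rightarrow> ereal) measure" where
  "GP_S \<sigma> \<gamma> \<rho> = (THE \<mu>. cdf_spec \<sigma> \<gamma> (H_S \<sigma> \<gamma> \<rho>) \<mu>)"

definition GP_S_class ::
  "('n::finite \<Rightarrow> real) \<Rightarrow> ('n \<Rightarrow> real) \<Rightarrow> ('n \<Rightarrow> ereal) measure set" where
  "GP_S_class \<sigma> \<gamma> = {GP_S \<sigma> \<gamma> \<rho> | \<rho>. S_admissible \<rho>}"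

end

theory Submission
  imports Defs
begin

text \<open>
  All four classes are shown to coincide with the laws generated by random vectors \<open>Z \<ge> 0\<close>
  with \<open>0 < E Z\<^sub>j < \<infinity>\<close>. Let \<open>\<tau>\<^sub>j(x)\<close> be \<open>1 + \<gamma>\<^sub>j x / \<sigma>\<^sub>j\<close> to the power \<open>-1/\<gamma>\<^sub>j\<close>, read as \<open>0\<close>
  beyond an upper endpoint, and let \<open>D(u) = E max\<^sub>j (Z\<^sub>j u\<^sub>j)\<close>. Under \<open>Z = exp U\<close>, or the
  corresponding substitution for \<open>R\<close>, the events \<open>{U \<le> ...}\<close> and \<open>{R \<le> ...}\<close> in the integrals
  at time \<open>t\<close> both become, for \<open>x\<close> above the lower endpoints, \<open>{Z\<^sub>j \<tau>\<^sub>j(x\<^sub>j) \<le> t for all j}\<close>.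
  By Fubini the quotients of integrals are then the probabilities of \<open>{X \<le> x}\<close> for the vector
  \<open>X\<^sub>j = \<tau>\<^sub>j\<^sup>-\<^sup>1(s / Z\<^sub>j)\<close>, read as the lower endpoint if \<open>Z\<^sub>j = 0\<close>, where \<open>(Z, s)\<close> is
  uniformly distributed, with respect to the product of the law of \<open>Z\<close> and Lebesgue measure,
  on \<open>{0 < s < max\<^sub>j Z\<^sub>j}\<close>. This gives existence of the law (\<open>gp_law\<close>) at one stroke, with
  cdf \<open>(D(\<tau>(x \<and> 0)) - D(\<tau>(x))) / D(1)\<close>, and also its conditional margins, since \<open>X\<^sub>j > x\<close>
  means \<open>s < Z\<^sub>j \<tau>\<^sub>j(x)\<close> for \<open>x \<ge> 0\<close>. The (S) representation is the case \<open>max\<^sub>j Z\<^sub>j = 1\<close>. The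
  laws involved are unique by \<open>law_eqI\<close> and \<open>law_eqI_inside\<close>.

  The GP distribution associated to a GEV cdf \<open>G(x) = exp (- k D(\<tau>(x)))\<close>, with a constant
  \<open>k > 0\<close>, is the law generated by \<open>Z\<close> (\<open>gp_of_eq\<close>). It remains to see that these functions
  are GEV cdfs for \<open>k = 1\<close>, and that every GEV cdf in question has this form.

  Existence (\<open>gp_law_in_GP_class\<close>): the componentwise supremum of \<open>Z\<^sup>i / T\<^sup>i\<close> over the points
  of a Poisson process on the half-line with intensity 1 and independent marks \<open>Z\<^sup>i\<close> is
  bounded by \<open>1/u\<close> with probability \<open>exp (- D(u))\<close>. The process is put together from
  independent Poisson samples on the intervals \<open>[n, n + 1]\<close>.

  Spectral representation (\<open>spectral_representation\<close>): if \<open>G\<close> is max-stable with margins of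
  tail \<open>c\<^sub>j \<tau>\<^sub>j\<close>, the norming constants are determined by the margins and
  \<open>L(u) = - log G(\<tau>\<^sup>-\<^sup>1(u))\<close> is homogeneous. For \<open>Y = 1 / \<tau>(X)\<close> the maximum
  \<open>M\<^sub>u = max\<^sub>j Y\<^sub>j u\<^sub>j\<close> therefore has the cdf \<open>exp (- L(u) / s)\<close>, so that
  \<open>E M\<^sub>u\<^sup>p = (L(u) / L(1))\<^sup>p E M\<^sub>1\<^sup>p\<close> for \<open>0 < p < 1\<close>. Hence, under the measure with density
  proportional to \<open>M\<^sub>1\<^sup>p\<close>, the vector \<open>W = Y / M\<^sub>1\<close> in the unit cube satisfies
  \<open>E (max\<^sub>j W\<^sub>j u\<^sub>j)\<^sup>p = (L(u) / L(1))\<^sup>p\<close>, and a weak limit as \<open>p\<close> tends to 1 has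
  \<open>E max\<^sub>j (Z\<^sub>j u\<^sub>j) = L(u) / L(1)\<close> and \<open>max\<^sub>j Z\<^sub>j = 1\<close>. The limit exists by
  \<open>unit_cube_compactness\<close>, which reduces to the one-dimensional selection theorem along a
  continuous curve that fills the cube.
\<close>

section \<open>Tails of generalized Pareto margins\<close>

text \<open>The tail function \<open>(1 + \<gamma> x / \<sigma>) ^ (-1/\<gamma>)\<close>, continued by \<open>0\<close> beyond an upper endpoint
  (\<open>\<gamma> < 0\<close>). At and below a lower endpoint (\<open>\<gamma> > 0\<close>) its value should be \<open>\<infinity>\<close>; the formula gives a meaningless
  \<open>0\<close> there, so that case is always excluded by \<open>above_end\<close>.\<close>

definition etail :: "real \<Rightarrow> real \<Rightarrow> real \<Rightarrow> real" where
  "etail \<gamma> \<sigma> x = (if \<gamma> = 0 then exp (- x / \<sigma>) else max 0 (1 + \<gamma> * x / \<sigma>) powr (- 1 / \<gamma>))"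

text \<open>The inverse of \<open>etail\<close> on the positive reals.\<close>

definition etail_inv :: "real \<Rightarrow> real \<Rightarrow> real \<Rightarrow> real" where
  "etail_inv \<gamma> \<sigma> u = (if \<gamma> = 0 then - \<sigma> * ln u else \<sigma> / \<gamma> * (u powr (- \<gamma>) - 1))"

text \<open>The argument lies strictly above the lower endpoint \<open>-\<sigma>/\<gamma>\<close>, which is finite only for \<open>\<gamma> > 0\<close>.\<close>

definition above_end :: "real \<Rightarrow> real \<Rightarrow> real \<Rightarrow> bool" where
  "above_end \<gamma> \<sigma> x \<longleftrightarrow> (0 < \<gamma> \<longrightarrow> 0 < \<sigma> + \<gamma> * x)"

text \<open>The argument lies strictly between both endpoints.\<close>

definition inside :: "real \<Rightarrow> real \<Rightarrow> real \<Rightarrow> bool" where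
  "inside \<gamma> \<sigma> x \<longleftrightarrow> 0 < \<sigma> + \<gamma> * x"

lemma inside_imp_above_end: "inside \<gamma> \<sigma> x \<Longrightarrow> above_end \<gamma> \<sigma> x"
  by (simp add: inside_def above_end_def)

lemma etail_nonneg [simp]: "0 \<le> etail \<gamma> \<sigma> x"
  by (simp add: etail_def)

lemma etail_0 [simp]: "0 < \<sigma> \<Longrightarrow> etail \<gamma> \<sigma> 0 = 1"
  by (simp add: etail_def)

lemma inside_scaled: "0 < \<sigma> \<Longrightarrow> 0 < 1 + \<gamma> * x / \<sigma> \<longleftrightarrow> inside \<gamma> \<sigma> x"
  by (simp add: inside_def field_simps)

lemma etail_pos: "0 < \<sigma> \<Longrightarrow> inside \<gamma> \<sigma> x \<Longrightarrow> 0 < etail \<gamma> \<sigma> x"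
  using inside_scaled[of \<sigma> \<gamma> x] by (auto simp: etail_def)

lemma etail_eq_gp_tail: "0 < \<sigma> \<Longrightarrow> inside \<gamma> \<sigma> x \<Longrightarrow> etail \<gamma> \<sigma> x = gp_tail \<gamma> (x / \<sigma>)"
  using inside_scaled[of \<sigma> \<gamma> x] by (auto simp: etail_def gp_tail_def)

lemma etail_beyond: "0 < \<sigma> \<Longrightarrow> \<not> inside \<gamma> \<sigma> x \<Longrightarrow> etail \<gamma> \<sigma> x = 0"
  using inside_scaled[of \<sigma> \<gamma> x] by (auto simp: etail_def inside_def)

lemma inside_etail_inv: "0 < \<sigma> \<Longrightarrow> 0 < u \<Longrightarrow> inside \<gamma> \<sigma> (etail_inv \<gamma> \<sigma> u)"
  by (auto simp: inside_def etail_inv_def field_simps)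

lemma etail_etail_inv: 
  assumes "0 < \<sigma>" "0 < u" shows "etail \<gamma> \<sigma> (etail_inv \<gamma> \<sigma> u) = u"
proof (cases "\<gamma> = 0")
  case False
  have "1 + \<gamma> * etail_inv \<gamma> \<sigma> u / \<sigma> = u powr (- \<gamma>)"
    using False assms by (simp add: etail_inv_def field_simps)
  then show ?thesis using False assms by (simp add: etail_def powr_powr)
qed (use assms in \<open>simp add: etail_def etail_inv_def\<close>)

lemma etail_inv_etail: 
  assumes "0 < \<sigma>" "inside \<gamma> \<sigma> x" shows "etail_inv \<gamma> \<sigma> (etail \<gamma> \<sigma> x) = x"
proof (cases "\<gamma> = 0")
  case False
  have "0 < 1 + \<gamma> * x / \<sigma>" using inside_scaled assms by blast
  then show ?thesis using False assms by (simp add: etail_def etail_inv_def powr_powr field_simps)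
qed (use assms in \<open>simp add: etail_def etail_inv_def\<close>)

lemma powr_neg_le_iff:
  fixes u w a :: real
  assumes "0 < u" "0 < w" "a < 0"
  shows "u powr a \<le> w powr a \<longleftrightarrow> w \<le> u"
proof
  assume "w \<le> u"
  then show "u powr a \<le> w powr a" using assms by (intro powr_mono2') auto
next
  assume le: "u powr a \<le> w powr a"
  show "w \<le> u"
  proof (rule ccontr)
    assume "\<not> w \<le> u"
    then have "w powr a < u powr a" using assms by (intro powr_less_mono2_neg) auto
    then show False using le by simp
  qed
qed

text \<open>\<open>etail\<close> is decreasing, with the infinite values at and below the lower endpoint expressed by
  \<open>above_end\<close>.\<close>

lemma etail_inv_le_iff:
  assumes s: "0 < \<sigma>" and u: "0 < u"
  shows "etail_inv \<gamma> \<sigma> u \<le> x \<longleftrightarrow> above_end \<gamma> \<sigma> x \<and> etail \<gamma> \<sigma> x \<le> u"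
proof -
  consider "\<gamma> = 0" | "0 < \<gamma>" | "\<gamma> < 0" by linarith
  then show ?thesis
  proof cases
    case 1
    have "etail_inv \<gamma> \<sigma> u \<le> x \<longleftrightarrow> - x / \<sigma> \<le> ln u"
      using 1 s by (auto simp: etail_inv_def field_simps)
    also have "\<dots> \<longleftrightarrow> exp (- x / \<sigma>) \<le> u"
      using ln_ge_iff[OF u, of "- x / \<sigma>"] by simp
    finally show ?thesis using 1 by (simp add: above_end_def etail_def)
  next
    case 2
    define v where "v = 1 + \<gamma> * x / \<sigma>"
    have "etail_inv \<gamma> \<sigma> u \<le> x \<longleftrightarrow> u powr (- \<gamma>) \<le> v"
      using 2 s by (simp add: etail_inv_def v_def field_simps)
    also have "\<dots> \<longleftrightarrow> 0 < v \<and> v powr (- 1 / \<gamma>) \<le> u"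
    proof (cases "0 < v")
      case True
      have "v = (v powr (-1/\<gamma>)) powr (- \<gamma>)" using True 2 by (simp add: powr_powr)
      then have "u powr (- \<gamma>) \<le> v \<longleftrightarrow> u powr (- \<gamma>) \<le> (v powr (-1/\<gamma>)) powr (- \<gamma>)" by simp
      also have "\<dots> \<longleftrightarrow> v powr (-1/\<gamma>) \<le> u"
        using powr_neg_le_iff[of u "v powr (-1/\<gamma>)" "- \<gamma>"] u True 2 by simp
      finally show ?thesis using True by simp
    next
      case False
      then show ?thesis using powr_gt_zero[of u "-\<gamma>"] u by linarith
    qed
    also have "0 < v \<longleftrightarrow> above_end \<gamma> \<sigma> x" using 2 s by (simp add: v_def above_end_def field_simps)
    finally show ?thesis using 2 s by (auto simp: etail_def v_def above_end_def max_def field_simps)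
  next
    case 3
    define v where "v = 1 + \<gamma> * x / \<sigma>"
    have "etail_inv \<gamma> \<sigma> u \<le> x \<longleftrightarrow> v \<le> u powr (- \<gamma>)"
      using 3 s by (simp add: etail_inv_def v_def field_simps)
    also have "\<dots> \<longleftrightarrow> max 0 v powr (- 1 / \<gamma>) \<le> u"
    proof (cases "0 < v")
      case True
      have "v = (v powr (-1/\<gamma>)) powr (- \<gamma>)" using True 3 by (simp add: powr_powr)
      then have "v \<le> u powr (- \<gamma>) \<longleftrightarrow> (v powr (-1/\<gamma>)) powr (- \<gamma>) \<le> u powr (- \<gamma>)" by simp
      also have "\<dots> \<longleftrightarrow> v powr (-1/\<gamma>) \<le> u"
        using powr_mono2[of "- \<gamma>" "v powr (-1/\<gamma>)" u]
          powr_less_mono2[of "- \<gamma>" u "v powr (-1/\<gamma>)"] u True 3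
        by (meson less_imp_le linorder_not_le neg_0_less_iff_less powr_ge_zero)
      finally show ?thesis using True by simp
    next
      case False
      then have "max 0 v = 0" "v \<le> u powr (- \<gamma>)"
        using powr_ge_zero[of u "- \<gamma>"] by linarith+
      then show ?thesis using u by simp
    qed
    finally show ?thesis using 3 s by (auto simp: etail_def v_def above_end_def)
  qed
qed

lemma above_end_min0: "0 < \<sigma> \<Longrightarrow> above_end \<gamma> \<sigma> x \<Longrightarrow> above_end \<gamma> \<sigma> (min x 0)"
  by (auto simp: above_end_def min_def)

lemma inside_min0: "0 < \<sigma> \<Longrightarrow> inside \<gamma> \<sigma> x \<Longrightarrow> inside \<gamma> \<sigma> (min x 0)"
  by (auto simp: inside_def min_def)

lemma etail_antimono:
  assumes "0 < \<sigma>" "above_end \<gamma> \<sigma> x" "x \<le> y"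
  shows "etail \<gamma> \<sigma> y \<le> etail \<gamma> \<sigma> x"
proof (cases "inside \<gamma> \<sigma> x")
  case True
  then have "0 < etail \<gamma> \<sigma> x" using etail_pos assms by blast
  from etail_inv_le_iff[OF assms(1) this, of \<gamma> y] etail_inv_etail[OF assms(1) True] assms
  show ?thesis by simp
next
  case False
  then have g: "\<gamma> < 0" using assms by (cases "\<gamma> = 0") (auto simp: above_end_def inside_def)
  have "\<gamma> * y \<le> \<gamma> * x" using g assms(3) by (simp add: mult_left_mono_neg)
  then have "\<not> inside \<gamma> \<sigma> y" using False by (simp add: inside_def)
  then show ?thesis using etail_beyond[OF assms(1)] by simp
qed

lemma etail_min0:
  assumes "0 < \<sigma>" "above_end \<gamma> \<sigma> x"
  shows "etail \<gamma> \<sigma> (min x 0) = max (etail \<gamma> \<sigma> x) 1"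
  using etail_antimono[OF assms(1), of \<gamma> x 0] etail_antimono[OF assms(1), of \<gamma> 0 x] assms
  by (auto simp: min_def max_def above_end_def)

text \<open>The pair \<open>(z, s)\<close> stands for the point \<open>etail_inv (s / z)\<close>, which for \<open>z = 0\<close> is read as the
  lower endpoint; \<open>below\<close> says that this point is at most \<open>x\<close>.\<close>

definition below :: "real \<Rightarrow> real \<Rightarrow> real \<Rightarrow> real \<Rightarrow> real \<Rightarrow> bool" where
  "below \<gamma> \<sigma> z x s \<longleftrightarrow> (if z \<le> 0 then 0 < \<gamma> \<longrightarrow> 0 \<le> \<sigma> + \<gamma> * x
     else above_end \<gamma> \<sigma> x \<and> z * etail \<gamma> \<sigma> x \<le> s)"

text \<open>The point with tail value \<open>s / z\<close>, or the lower endpoint if \<open>z = 0\<close>.\<close>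

definition gp_point :: "real \<Rightarrow> real \<Rightarrow> real \<Rightarrow> real \<Rightarrow> ereal" where
  "gp_point \<gamma> \<sigma> z s = (if z \<le> 0 then (if 0 < \<gamma> then ereal (- \<sigma> / \<gamma>) else -\<infinity>)
     else ereal (etail_inv \<gamma> \<sigma> (s / z)))"

text \<open>The lower endpoint itself is an admissible value of \<open>x\<close> on the right only if \<open>z = 0\<close>: then the
  point may sit on the boundary.\<close>

lemma gp_point_le_iff:
  assumes "0 < \<sigma>" "0 < s"
  shows "gp_point \<gamma> \<sigma> z s \<le> ereal x \<longleftrightarrow> below \<gamma> \<sigma> z x s"
proof (cases "z \<le> 0")
  case True
  then show ?thesis using assms by (auto simp: gp_point_def below_def field_simps)
next
  case False
  then show ?thesis using assms etail_inv_le_iff[of \<sigma> "s / z" \<gamma> x]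
    by (auto simp: gp_point_def below_def field_simps)
qed

lemma below_0: "0 < \<sigma> \<Longrightarrow> 0 < s \<Longrightarrow> below \<gamma> \<sigma> z 0 s \<longleftrightarrow> z \<le> s"
  by (auto simp: below_def above_end_def)

lemma below_min0:
  assumes "0 < \<sigma>" "0 < s"
  shows "below \<gamma> \<sigma> z (min x 0) s \<longleftrightarrow> below \<gamma> \<sigma> z x s \<and> z \<le> s"
proof -
  have "below \<gamma> \<sigma> z (min x 0) s \<longleftrightarrow> gp_point \<gamma> \<sigma> z s \<le> min (ereal x) (ereal 0)"
    using gp_point_le_iff[OF assms, of \<gamma> z "min x 0"] by (simp only: ereal_min)
  also have "\<dots> \<longleftrightarrow> below \<gamma> \<sigma> z x s \<and> z \<le> s"
    using gp_point_le_iff[OF assms, of \<gamma> z x] gp_point_le_iff[OF assms, of \<gamma> z 0]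
      below_0[OF assms, of \<gamma> z] by (simp only: min.bounded_iff)
  finally show ?thesis .
qed

section \<open>Laws that do not charge plus infinity\<close>

text \<open>The product \<open>\<sigma>\<close>-algebra on which laws live.\<close>

abbreviation ereal_space :: "('n \<Rightarrow> ereal) measure" where
  "ereal_space \<equiv> Pi\<^sub>M UNIV (\<lambda>_. borel)"

lemma space_law: "is_law \<rho> \<Longrightarrow> space \<rho> = UNIV"
  unfolding is_law_def by (auto simp: space_PiM dest: sets_eq_imp_space_eq)

lemma law_component_measurable:
  "is_law \<rho> \<Longrightarrow> (\<lambda>y. y j) \<in> borel_measurable \<rho>"
  unfolding is_law_def by (simp cong: measurable_cong_sets)

lemma ereal_box_sets:
  fixes \<rho> :: "('n::finite \<Rightarrow> ereal) measure"
  assumes "is_law \<rho>"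
  shows "{y. \<forall>j. y j \<le> a j} \<in> sets \<rho>"
proof -
  note [measurable] = law_component_measurable[OF assms]
  have "{y \<in> space \<rho>. \<forall>j. y j \<le> a j} \<in> sets \<rho>" by measurable
  then show ?thesis using space_law[OF assms] by simp
qed

lemma joint_cdf_eq: "is_law \<rho> \<Longrightarrow> joint_cdf \<rho> x = measure \<rho> {y. \<forall>j. y j \<le> ereal (x j)}"
  by (simp add: joint_cdf_def space_law)

lemma ereal_boxes_decseq:
  fixes \<rho> :: "('n::finite \<Rightarrow> ereal) measure"
  assumes "is_law \<rho>" and dec: "\<And>j. decseq (\<lambda>n. X n j)" and lim: "\<And>j. (\<lambda>n. X n j) \<longlonglongrightarrow> x j"
  shows "(\<lambda>n. measure \<rho> {y. \<forall>j. y j \<le> X n j}) \<longlonglongrightarrow> measure \<rho> {y. \<forall>j. y j \<le> x j}"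
proof -
  interpret prob_space \<rho> using assms(1) by (simp add: is_law_def)
  have "(\<Inter>n. {y. \<forall>j. y j \<le> X n j}) = {y. \<forall>j. y j \<le> x j}"
  proof (intro antisym subsetI, clarify)
    fix y j assume "y \<in> (\<Inter>n. {y. \<forall>j. y j \<le> X n j})"
    then show "y j \<le> x j" by (intro LIMSEQ_le_const[OF lim]) auto
  next
    fix y assume "y \<in> {y. \<forall>j. y j \<le> x j}"
    then show "y \<in> (\<Inter>n. {y. \<forall>j. y j \<le> X n j})"
      using decseq_ge[OF dec lim] by (auto intro: order_trans)
  qed
  moreover have "(\<lambda>n. measure \<rho> {y. \<forall>j. y j \<le> X n j}) \<longlonglongrightarrow> measure \<rho> (\<Inter>n. {y. \<forall>j. y j \<le> X n j})"
    using ereal_box_sets[OF assms(1)] decseqD[OF dec]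
    by (intro finite_Lim_measure_decseq) (auto simp: decseq_def intro: order_trans)
  ultimately show ?thesis by simp
qed

lemma ereal_boxes_incseq:
  fixes \<rho> :: "('n::finite \<Rightarrow> ereal) measure"
  assumes "is_law \<rho>" and inc: "\<And>j. incseq (\<lambda>n. X n j)"
    and lim: "AE y in \<rho>. (\<forall>j. y j \<le> x j) \<longleftrightarrow> (\<exists>n. \<forall>j. y j \<le> X n j)"
  shows "(\<lambda>n. measure \<rho> {y. \<forall>j. y j \<le> X n j}) \<longlonglongrightarrow> measure \<rho> {y. \<forall>j. y j \<le> x j}"
proof -
  interpret prob_space \<rho> using assms(1) by (simp add: is_law_def)
  have "measure \<rho> (\<Union>n. {y. \<forall>j. y j \<le> X n j}) = measure \<rho> {y. \<forall>j. y j \<le> x j}"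
    using lim ereal_box_sets[OF assms(1)] by (intro finite_measure_eq_AE) auto
  moreover have "(\<lambda>n. measure \<rho> {y. \<forall>j. y j \<le> X n j}) \<longlonglongrightarrow> measure \<rho> (\<Union>n. {y. \<forall>j. y j \<le> X n j})"
    using ereal_box_sets[OF assms(1)] incseqD[OF inc]
    by (intro finite_Lim_measure_incseq) (auto simp: incseq_def intro: order_trans)
  ultimately show ?thesis by simp
qed

lemma sets_ereal_space_eq:
  "sets (ereal_space :: ('n::finite \<Rightarrow> ereal) measure) =
     sigma_sets UNIV (range (\<lambda>a. {y. \<forall>j. y j \<le> a j}))"
  (is "_ = sigma_sets UNIV ?E")
proof
  let ?S = "sigma UNIV ?E"
  have *: "(\<lambda>y. y j) \<in> borel_measurable ?S" for j :: 'n
    unfolding borel_measurable_iff_Iic_ereal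
  proof
    fix a :: ereal
    have "(\<lambda>y. y j) -` {..a} \<inter> space ?S = {y. \<forall>i. y i \<le> (if i = j then a else \<infinity>)}"
      by (auto simp: space_measure_of_conv)
    also have "\<dots> \<in> sets ?S" by (auto simp: sets_measure_of)
    finally show "(\<lambda>y. y j) -` {..a} \<inter> space ?S \<in> sets ?S" .
  qed
  have "sets ereal_space \<subseteq> sets ?S"
    using measurable_sets[OF *] by (intro sets_PiM_in_sets) (auto simp: vimage_def Int_def space_measure_of_conv)
  then show "sets ereal_space \<subseteq> sigma_sets UNIV ?E" by (simp add: sets_measure_of)
  have "{y \<in> space (ereal_space :: ('n \<Rightarrow> ereal) measure). \<forall>j. y j \<le> a j} \<in> sets ereal_space" for a
    by measurable
  then have "?E \<subseteq> sets ereal_space" by (auto simp: space_PiM)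
  then show "sigma_sets UNIV ?E \<subseteq> sets ereal_space"
    using sets.sigma_sets_subset[of ?E "ereal_space"] by (simp add: space_PiM)
qed

text \<open>A law is determined by its cdf at real arguments: infinite arguments are limits of
  real ones, because \<open>+\<infinity>\<close> is not charged.\<close>

lemma law_eqI:
  fixes \<mu> \<nu> :: "('n::finite \<Rightarrow> ereal) measure"
  assumes mu: "is_law \<mu>" and nu: "is_law \<nu>" and eq: "\<And>x. joint_cdf \<mu> x = joint_cdf \<nu> x"
  shows "\<mu> = \<nu>"
proof -
  interpret mu: prob_space \<mu> using mu by (simp add: is_law_def)
  interpret nu: prob_space \<nu> using nu by (simp add: is_law_def)
  have real: "measure \<mu> {y. \<forall>j. y j \<le> ereal (x j)} = measure \<nu> {y. \<forall>j. y j \<le> ereal (x j)}" for x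
    using eq[of x] by (simp add: joint_cdf_eq[OF mu] joint_cdf_eq[OF nu])
  have top: "(\<lambda>n. measure \<rho> {y. \<forall>j. y j \<le> ereal (if a j = \<infinity> then real n else real_of_ereal (a j))})
      \<longlonglongrightarrow> measure \<rho> {y. \<forall>j. y j \<le> a j}"
    if rho: "is_law \<rho>" and a: "\<And>j. a j \<noteq> -\<infinity>" for \<rho> and a :: "'n \<Rightarrow> ereal"
  proof (rule ereal_boxes_incseq[OF rho])
    have fin: "AE y in \<rho>. \<forall>j. y j < \<infinity>" using rho by (simp add: is_law_def)
    show "AE y in \<rho>. (\<forall>j. y j \<le> a j) \<longleftrightarrow>
        (\<exists>n. \<forall>j. y j \<le> ereal (if a j = \<infinity> then real n else real_of_ereal (a j)))"
      using fin
    proof (eventually_elim)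
      case (elim y)
      have "\<exists>n. y j \<le> ereal (real n)" for j
        using elim by (cases "y j") (auto intro: real_arch_simple)
      then obtain N where N: "\<And>j. y j \<le> ereal (real (N j))" by metis
      have "y j \<le> ereal (real (Max (range N)))" for j
        by (rule order_trans[OF N]) (auto intro!: Max_ge)
      moreover have "a j = ereal (real_of_ereal (a j))" if "a j \<noteq> \<infinity>" for j
        using that a[of j] by (cases "a j") auto
      ultimately have "(\<forall>j. y j \<le> a j) \<Longrightarrow> (\<forall>j. y j \<le> ereal (if a j = \<infinity> then real (Max (range N)) else real_of_ereal (a j)))"
        by auto
      moreover have "y j \<le> a j" if "y j \<le> ereal (if a j = \<infinity> then real n else real_of_ereal (a j))" for j n
        using that a[of j] by (cases "a j") auto
      ultimately show ?case by blast
    qed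
  qed (auto simp: incseq_def)
  have notbot: "measure \<mu> {y. \<forall>j. y j \<le> a j} = measure \<nu> {y. \<forall>j. y j \<le> a j}" if "\<And>j. a j \<noteq> -\<infinity>" for a
    using top[OF mu that] top[OF nu that] unfolding real by (rule LIMSEQ_unique)
  have down_set: "measure \<mu> {y. \<forall>j. y j \<le> a j} = measure \<nu> {y. \<forall>j. y j \<le> a j}" for a
  proof -
    have lim: "(\<lambda>n. max (a j) (ereal (- real n))) \<longlonglongrightarrow> a j" for j
    proof -
      have "(\<lambda>n. ereal (- real n)) \<longlonglongrightarrow> -\<infinity>"
        unfolding tendsto_MInfty
      proof
        fix r :: real
        obtain N where "- r < real N" using reals_Archimedean2 by blast
        then show "\<forall>\<^sub>F n in sequentially. ereal (- real n) < ereal r"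
          unfolding eventually_sequentially by (intro exI[of _ N]) auto
      qed
      from tendsto_max[OF tendsto_const this] show ?thesis by simp
    qed
    have dec: "decseq (\<lambda>n. max (a j) (ereal (- real n)))" for j
      by (auto simp: decseq_def intro: max.mono le_max_iff_disj[THEN iffD2, OF disjI2])
    have d: "(\<lambda>n. measure \<rho> {y. \<forall>j. y j \<le> max (a j) (ereal (- real n))})
        \<longlonglongrightarrow> measure \<rho> {y. \<forall>j. y j \<le> a j}" if "is_law \<rho>" for \<rho>
      by (rule ereal_boxes_decseq[OF that dec lim])
    have "measure \<mu> {y. \<forall>j. y j \<le> max (a j) (ereal (- real n))} = measure \<nu> {y. \<forall>j. y j \<le> max (a j) (ereal (- real n))}" for n
      by (rule notbot) (auto simp: max_def)
    then show ?thesis using d[OF mu] d[OF nu] by (simp add: LIMSEQ_unique)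
  qed
  show ?thesis
  proof (rule measure_eqI_generator_eq)
    let ?E = "range (\<lambda>a. {y :: 'n \<Rightarrow> ereal. \<forall>j. y j \<le> a j})"
    show "Int_stable ?E"
    proof (rule Int_stableI)
      fix A B assume "A \<in> ?E" "B \<in> ?E"
      then obtain a b where "A = {y. \<forall>j. y j \<le> a j}" "B = {y. \<forall>j. y j \<le> b j}" by blast
      then have "A \<inter> B = {y. \<forall>j. y j \<le> min (a j) (b j)}" by auto
      then show "A \<inter> B \<in> ?E" by (intro image_eqI[of _ _ "\<lambda>j. min (a j) (b j)"]) auto
    qed
    show "sets \<mu> = sigma_sets UNIV ?E" "sets \<nu> = sigma_sets UNIV ?E"
      using mu nu sets_ereal_space_eq by (auto simp: is_law_def)
    show "range (\<lambda>_::nat. UNIV) \<subseteq> ?E"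
      by (auto intro!: image_eqI[of _ _ "\<lambda>_. \<infinity>"])
    show "emeasure \<mu> X = emeasure \<nu> X" if "X \<in> ?E" for X
      using that down_set by (auto simp: mu.emeasure_eq_measure nu.emeasure_eq_measure)
  qed auto
qed

text \<open>Uniqueness for a cdf prescribed only between the endpoints: above an upper endpoint the cdf
  is a limit from the left, since total mass 1 is attained strictly below the upper endpoints.\<close>

lemma law_eqI_inside:
  fixes \<mu> \<nu> :: "('n::finite \<Rightarrow> ereal) measure"
  assumes sigma: "\<And>j. 0 < \<sigma> j" and mu: "is_law \<mu>" and nu: "is_law \<nu>"
    and eq: "\<And>x. (\<And>j. inside (\<gamma> j) (\<sigma> j) (x j)) \<Longrightarrow> joint_cdf \<mu> x = joint_cdf \<nu> x"
    and zero: "\<And>x j. 0 < \<gamma> j \<Longrightarrow> x j < - \<sigma> j / \<gamma> j \<Longrightarrow> joint_cdf \<mu> x = 0 \<and> joint_cdf \<nu> x = 0"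
    and top: "AE y in \<nu>. \<forall>j. \<gamma> j < 0 \<longrightarrow> y j < ereal (- \<sigma> j / \<gamma> j)"
  shows "\<mu> = \<nu>"
proof -
  interpret mu: prob_space \<mu> using mu by (simp add: is_law_def)
  interpret nu: prob_space \<nu> using nu by (simp add: is_law_def)
  \<comment> \<open>real bounds increasing to the upper endpoints, or to \<open>\<infinity>\<close>\<close>
  define b where "b n j = (if \<gamma> j < 0 then - \<sigma> j / \<gamma> j - (1 / real (Suc n)) * (- \<sigma> j / \<gamma> j) else real n)" for n j
  have b_inside: "inside (\<gamma> j) (\<sigma> j) (b n j)" for n j
  proof (cases "\<gamma> j < 0")
    case True
    then have "\<gamma> j * b n j = - \<sigma> j + 1 / real (Suc n) * \<sigma> j"
      unfolding b_def by (simp add: right_diff_distrib)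
    then have "\<sigma> j + \<gamma> j * b n j = 1 / real (Suc n) * \<sigma> j" by simp
    then show ?thesis using sigma[of j] by (simp add: inside_def)
  next
    case False
    then show ?thesis using sigma[of j] by (simp add: inside_def b_def add_pos_nonneg)
  qed
  have b_inc: "incseq (\<lambda>n. b n j)" for j
  proof (cases "\<gamma> j < 0")
    case True
    then have "0 \<le> - \<sigma> j / \<gamma> j" using sigma[of j] by (simp add: divide_nonneg_neg less_imp_le)
    then have "1 / real (Suc n) * (- \<sigma> j / \<gamma> j) \<le> 1 / real (Suc m) * (- \<sigma> j / \<gamma> j)" if "m \<le> n" for m n
      using that by (intro mult_right_mono divide_left_mono) auto
    then show ?thesis unfolding b_def incseq_def using True by simp
  qed (auto simp: incseq_def b_def)
  have b_lim: "\<exists>n. y < ereal (b n j)" if "y < \<infinity>" "\<gamma> j < 0 \<longrightarrow> y < ereal (- \<sigma> j / \<gamma> j)" for y j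
  proof (cases "\<gamma> j < 0")
    case True
    have "(\<lambda>n. - \<sigma> j / \<gamma> j - (1 / real (Suc n)) * (- \<sigma> j / \<gamma> j)) \<longlonglongrightarrow> - \<sigma> j / \<gamma> j - 0 * (- \<sigma> j / \<gamma> j)"
      by (intro tendsto_intros LIMSEQ_inverse_real_of_nat[unfolded inverse_eq_divide])
    then have "(\<lambda>n. ereal (b n j)) \<longlonglongrightarrow> ereal (- \<sigma> j / \<gamma> j)" using True by (simp add: b_def)
    from order_tendstoD(1)[OF this] True that(2) show ?thesis
      by (meson eventually_sequentially order_refl)
  next
    case False
    then show ?thesis using that(1) reals_Archimedean2 by (cases y) (auto simp: b_def)
  qed
  have b_all: "\<exists>n. \<forall>j. y j \<le> ereal (b n j)" 
    if "\<forall>j. y j < \<infinity>" "\<forall>j. \<gamma> j < 0 \<longrightarrow> y j < ereal (- \<sigma> j / \<gamma> j)" for y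
  proof -
    have "\<exists>n. y j < ereal (b n j)" for j
      using that by (intro b_lim) auto
    then obtain N where N: "\<And>j. y j < ereal (b (N j) j)" by metis
    have "y j \<le> ereal (b (Max (range N)) j)" for j
    proof -
      have "b (N j) j \<le> b (Max (range N)) j" by (intro incseqD[OF b_inc] Max_ge) auto
      then show ?thesis using N[of j] by (metis ereal_less_eq(3) less_imp_le order_trans)
    qed
    then show ?thesis by (intro exI[of _ "Max (range N)"] allI)
  qed
  have b_lt: "\<gamma> j < 0 \<longrightarrow> b n j < - \<sigma> j / \<gamma> j" for n j
    using b_inside[of j n] by (auto simp: inside_def field_simps)
  have fin: "AE y in \<mu>. \<forall>j. y j < \<infinity>" "AE y in \<nu>. \<forall>j. y j < \<infinity>" using mu nu by (auto simp: is_law_def)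
  \<comment> \<open>the first law also lives strictly below the upper endpoints\<close>
  have top_mu: "AE y in \<mu>. \<exists>n. \<forall>j. y j \<le> ereal (b n j)"
  proof -
    have bs: "{y. \<forall>j. y j \<le> ereal (b n j)} \<in> sets \<mu>" "{y. \<forall>j. y j \<le> ereal (b n j)} \<in> sets \<nu>" for n
      by (rule ereal_box_sets[OF mu], rule ereal_box_sets[OF nu])
    have inc: "incseq (\<lambda>n. {y. \<forall>j. y j \<le> ereal (b n j)})"
      using incseqD[OF b_inc] by (auto simp: incseq_def intro: order_trans)
    have "(\<lambda>n. measure \<mu> {y. \<forall>j. y j \<le> ereal (b n j)}) \<longlonglongrightarrow> measure \<mu> (\<Union>n. {y. \<forall>j. y j \<le> ereal (b n j)})"
      using inc bs by (intro mu.finite_Lim_measure_incseq) auto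
    moreover have "(\<lambda>n. measure \<nu> {y. \<forall>j. y j \<le> ereal (b n j)}) \<longlonglongrightarrow> measure \<nu> (\<Union>n. {y. \<forall>j. y j \<le> ereal (b n j)})"
      using inc bs by (intro nu.finite_Lim_measure_incseq) auto
    moreover have "measure \<mu> {y. \<forall>j. y j \<le> ereal (b n j)} = measure \<nu> {y. \<forall>j. y j \<le> ereal (b n j)}" for n
      using eq[of "b n"] b_inside by (simp add: joint_cdf_eq[OF mu] joint_cdf_eq[OF nu])
    ultimately have "measure \<mu> (\<Union>n. {y. \<forall>j. y j \<le> ereal (b n j)}) = measure \<nu> (\<Union>n. {y. \<forall>j. y j \<le> ereal (b n j)})"
      by (simp add: LIMSEQ_unique)
    also have "\<dots> = 1"
    proof -
      have "AE y in \<nu>. y \<in> (\<Union>n. {y. \<forall>j. y j \<le> ereal (b n j)})"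
        using top fin(2) by eventually_elim (simp add: b_all)
      then show ?thesis using bs(2) by (intro nu.prob_eq_1[THEN iffD2]) auto
    qed
    finally have "AE y in \<mu>. y \<in> (\<Union>n. {y. \<forall>j. y j \<le> ereal (b n j)})"
      using bs(1) by (subst (asm) mu.prob_eq_1) auto
    then show ?thesis by simp
  qed
  have top_nu: "AE y in \<nu>. \<exists>n. \<forall>j. y j \<le> ereal (b n j)"
    using top fin(2) by eventually_elim (simp add: b_all)
  have approx: "(\<lambda>n. joint_cdf \<rho> (\<lambda>j. min (x j) (b n j))) \<longlonglongrightarrow> joint_cdf \<rho> x" 
    if rho: "is_law \<rho>" and top: "AE y in \<rho>. \<exists>n. \<forall>j. y j \<le> ereal (b n j)" for \<rho> x
    unfolding joint_cdf_eq[OF rho]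
  proof (rule ereal_boxes_incseq[OF rho])
    show "incseq (\<lambda>n. ereal (min (x j) (b n j)))" for j
      using incseqD[OF b_inc] by (simp add: incseq_def min.coboundedI2)
    show "AE y in \<rho>. (\<forall>j. y j \<le> ereal (x j)) \<longleftrightarrow> (\<exists>n. \<forall>j. y j \<le> ereal (min (x j) (b n j)))"
      using top by eventually_elim auto
  qed
  have above: "joint_cdf \<mu> x = joint_cdf \<nu> x" if x: "\<And>j. above_end (\<gamma> j) (\<sigma> j) (x j)" for x
  proof -
    have "joint_cdf \<mu> (\<lambda>j. min (x j) (b n j)) = joint_cdf \<nu> (\<lambda>j. min (x j) (b n j))" for n
    proof (rule eq)
      fix j
      show "inside (\<gamma> j) (\<sigma> j) (min (x j) (b n j))"
      proof (cases "b n j \<le> x j")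
        case False
        have "\<gamma> j < 0 \<Longrightarrow> \<gamma> j * b n j \<le> \<gamma> j * x j" using False by (simp add: mult_left_mono_neg)
        then have "\<gamma> j < 0 \<Longrightarrow> 0 < \<sigma> j + \<gamma> j * x j"
          using b_inside[of j n] unfolding inside_def by linarith
        then show ?thesis using False x[of j] sigma[of j]
          by (cases "\<gamma> j" "0::real" rule: linorder_cases) (auto simp: inside_def above_end_def)
      qed (use b_inside in \<open>simp add: min_absorb2\<close>)
    qed
    with approx[OF mu top_mu, of x] approx[OF nu top_nu, of x] show ?thesis
      by (simp add: LIMSEQ_unique)
  qed
  show ?thesis
  proof (rule law_eqI[OF mu nu])
    fix x
    show "joint_cdf \<mu> x = joint_cdf \<nu> x"
    proof (cases "\<exists>j. 0 < \<gamma> j \<and> x j < - \<sigma> j / \<gamma> j")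
      case True then show ?thesis using zero by metis
    next
      case False
      have ab: "above_end (\<gamma> j) (\<sigma> j) (x j + 1 / real (Suc n))" for n j
      proof (cases "0 < \<gamma> j")
        case True
        then have "- \<sigma> j / \<gamma> j \<le> x j" using False by force
        then have "0 \<le> \<sigma> j + \<gamma> j * x j" using pos_divide_le_eq[OF True, of "- \<sigma> j" "x j"] by (simp only: mult.commute)
        moreover have "0 < \<gamma> j * (1 / real (Suc n))" using True by simp
        ultimately show ?thesis by (simp add: above_end_def algebra_simps)
      qed (simp add: above_end_def)
      have lim: "(\<lambda>n. joint_cdf \<rho> (\<lambda>j. x j + 1 / real (Suc n))) \<longlonglongrightarrow> joint_cdf \<rho> x" if rho: "is_law \<rho>" for \<rho>
        unfolding joint_cdf_eq[OF rho]
      proof (rule ereal_boxes_decseq[OF rho])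
        fix j
        show "decseq (\<lambda>n. ereal (x j + 1 / real (Suc n)))"
          by (auto simp: decseq_def intro!: divide_left_mono)
        have "(\<lambda>n. x j + 1 / real (Suc n)) \<longlonglongrightarrow> x j + 0"
          by (intro tendsto_intros LIMSEQ_inverse_real_of_nat[unfolded inverse_eq_divide])
        then show "(\<lambda>n. ereal (x j + 1 / real (Suc n))) \<longlonglongrightarrow> ereal (x j)" by simp
      qed
      from above[OF ab] lim[OF mu] lim[OF nu] show ?thesis by (simp add: LIMSEQ_unique)
    qed
  qed
qed

section \<open>The generalized Pareto law of a generator\<close>

abbreviation real_space :: "('n \<Rightarrow> real) measure" where
  "real_space \<equiv> Pi\<^sub>M UNIV (\<lambda>_. borel)"

text \<open>The maximum of the components of a vector.\<close>

abbreviation vmax :: "('n::finite \<Rightarrow> real) \<Rightarrow> real" where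
  "vmax z \<equiv> Max (range z)"

lemma vmax_le_iff: "vmax (z :: 'n::finite \<Rightarrow> real) \<le> s \<longleftrightarrow> (\<forall>j. z j \<le> s)"
  by (subst Max_le_iff) auto

lemma vmax_ge: "z j \<le> vmax (z :: 'n::finite \<Rightarrow> real)"
  by (intro Max_ge) auto

lemma vmax_in: "\<exists>j. vmax (z :: 'n::finite \<Rightarrow> real) = z j"
proof -
  have "vmax z \<in> range z" by (rule Max_in) auto
  then show ?thesis by blast
qed

lemma vmax_cmult: "0 \<le> c \<Longrightarrow> vmax (\<lambda>j. c * z j) = c * vmax (z :: 'n::finite \<Rightarrow> real)"
proof (rule antisym)
  assume c: "0 \<le> c"
  show "vmax (\<lambda>j. c * z j) \<le> c * vmax z"
    unfolding vmax_le_iff using c vmax_ge mult_left_mono by blast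
  obtain j where "vmax z = z j" using vmax_in by blast
  then show "c * vmax z \<le> vmax (\<lambda>j. c * z j)" using vmax_ge[of "\<lambda>j. c * z j" j] by simp
qed

lemma vmax_nonneg: "(\<And>j. 0 \<le> z j) \<Longrightarrow> 0 \<le> vmax (z :: 'n::finite \<Rightarrow> real)"
  using vmax_ge[of z undefined] by (meson order_trans)

lemma vmax_le_sum: "(\<And>j. 0 \<le> z j) \<Longrightarrow> vmax (z :: 'n::finite \<Rightarrow> real) \<le> (\<Sum>j\<in>UNIV. z j)"
  unfolding vmax_le_iff by (auto intro: member_le_sum)

lemma vmax_max: "vmax (\<lambda>j. max (z j) (w j)) = max (vmax z) (vmax (w :: 'n::finite \<Rightarrow> real))"
proof (rule antisym)
  show "vmax (\<lambda>j. max (z j) (w j)) \<le> max (vmax z) (vmax w)"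
    unfolding vmax_le_iff by (intro allI max.mono vmax_ge)
  show "max (vmax z) (vmax w) \<le> vmax (\<lambda>j. max (z j) (w j))"
    unfolding max.bounded_iff vmax_le_iff using vmax_ge[of "\<lambda>j. max (z j) (w j)"] by (simp add: max.bounded_iff)
qed

lemma borel_measurable_vmax [measurable]:
  assumes "\<And>j. (\<lambda>x. f x j) \<in> borel_measurable M"
  shows "(\<lambda>x. vmax (f x :: 'n::finite \<Rightarrow> real)) \<in> borel_measurable M"
proof -
  have "{x \<in> space M. vmax (f x) \<le> a} \<in> sets M" for a
    unfolding vmax_le_iff using assms by measurable
  then show ?thesis by (subst borel_measurable_iff_le) simp
qed

text \<open>A generator is the law of a random vector \<open>Z \<ge> 0\<close> whose components have positive finite
  means.\<close>

definition generator :: "('n::finite \<Rightarrow> real) measure \<Rightarrow> bool" where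
  "generator M \<longleftrightarrow> prob_space M \<and> sets M = sets real_space \<and> (AE z in M. \<forall>j. 0 \<le> z j) \<and>
     (\<forall>j. integrable M (\<lambda>z. z j) \<and> 0 < (\<integral>z. z j \<partial>M))"

text \<open>The function \<open>u \<mapsto> E max\<^sub>j (Z\<^sub>j u\<^sub>j)\<close>, which on the nonnegative orthant
  is the D-norm generated by \<open>Z\<close>.\<close>

definition D_norm :: "('n::finite \<Rightarrow> real) measure \<Rightarrow> ('n \<Rightarrow> real) \<Rightarrow> real" where
  "D_norm M u = (\<integral>z. vmax (\<lambda>j. z j * u j) \<partial>M)"

text \<open>The domain under the graph of \<open>max\<^sub>j z\<^sub>j\<close>; its measure is \<open>E max\<^sub>j Z\<^sub>j\<close>.\<close>

definition gp_region :: "(('n::finite \<Rightarrow> real) \<times> real) set" where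
  "gp_region = {(z, s). 0 < s \<and> s < vmax z}"

text \<open>The GP law of a generator. With the maximum \<open>m\<close> of \<open>z\<close>, drawing \<open>(z, s)\<close> uniformly from the region
  amounts to tilting the law of \<open>Z\<close> by \<open>m\<close> and taking \<open>s / m\<close> uniform on \<open>(0, 1)\<close>; this is the usual
  construction of a GP vector from \<open>S = log (z / m)\<close> and an independent standard exponential
  variable \<open>- log (s / m)\<close>.\<close>

definition gp_law ::
  "('n::finite \<Rightarrow> real) \<Rightarrow> ('n \<Rightarrow> real) \<Rightarrow> ('n \<Rightarrow> real) measure \<Rightarrow> ('n \<Rightarrow> ereal) measure" where
  "gp_law \<sigma> \<gamma> M = distr (uniform_measure (M \<Otimes>\<^sub>M lborel) gp_region) ereal_space
     (\<lambda>(z, s) j. gp_point (\<gamma> j) (\<sigma> j) (z j) s)"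

text \<open>The section at height \<open>s\<close> of the event \<open>X \<le> x\<close>; this is the difference of two values of
  \<open>F\<^sub>R\<close> or \<open>F\<^sub>U\<close> in the numerators of the (R) and (U) cdfs.\<close>

definition gp_slice ::
  "('n::finite \<Rightarrow> real) \<Rightarrow> ('n \<Rightarrow> real) \<Rightarrow> ('n \<Rightarrow> real) measure \<Rightarrow> ('n \<Rightarrow> real) \<Rightarrow> real \<Rightarrow> real" where
  "gp_slice \<sigma> \<gamma> M x s = measure M {z. s < vmax z \<and> (\<forall>j. below (\<gamma> j) (\<sigma> j) (z j) (x j) s)}"

text \<open>A generator together with the parameters of the margins.\<close>

locale gen =
  fixes M :: "('n::finite \<Rightarrow> real) measure" and \<sigma> \<gamma> :: "'n \<Rightarrow> real"
  assumes gen: "generator M" and sigma_pos: "\<And>j. 0 < \<sigma> j"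
begin

sublocale prob_space M using gen by (simp add: generator_def)

lemma sets_M [measurable_cong]: "sets M = sets real_space"
  using gen by (simp add: generator_def)

lemma space_M [simp]: "space M = UNIV"
  using sets_eq_imp_space_eq[OF sets_M] by (simp add: space_PiM)

lemma nonneg: "AE z in M. \<forall>j. 0 \<le> z j"
  using gen by (simp add: generator_def)

lemma integrable_comp: "integrable M (\<lambda>z. z j)" and mean_pos: "0 < (\<integral>z. z j \<partial>M)"
  using gen by (auto simp: generator_def)

lemma integrable_vmax:
  assumes "\<And>j. 0 \<le> u j" shows "integrable M (\<lambda>z. vmax (\<lambda>j. z j * u j))"
proof (rule Bochner_Integration.integrable_bound)
  show "integrable M (\<lambda>z. \<Sum>j\<in>UNIV. z j * u j)" using integrable_comp by auto
  show "AE z in M. norm (vmax (\<lambda>j. z j * u j)) \<le> norm (\<Sum>j\<in>UNIV. z j * u j)"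
    using nonneg
  proof eventually_elim
    case (elim z)
    then have nn: "0 \<le> z j * u j" for j using assms by simp
    show ?case using vmax_nonneg[of "\<lambda>j. z j * u j", OF nn] vmax_le_sum[of "\<lambda>j. z j * u j", OF nn]
      by (simp del: Max_le_iff)
  qed
qed measurable

lemma integrable_vmax1: "integrable M vmax"
  using integrable_vmax[of "\<lambda>_. 1"] by simp

lemma D_norm_mono:
  assumes "\<And>j. 0 \<le> u j" "\<And>j. u j \<le> w j" shows "D_norm M u \<le> D_norm M w"
  unfolding D_norm_def
proof (rule integral_mono_AE)
  show "AE z in M. vmax (\<lambda>j. z j * u j) \<le> vmax (\<lambda>j. z j * w j)"
    using nonneg
  proof eventually_elim
    case (elim z)
    show ?case unfolding vmax_le_iff
      using elim assms vmax_ge[of "\<lambda>j. z j * w j"] by (meson mult_left_mono order_trans)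
  qed
qed (use assms in \<open>auto intro!: integrable_vmax intro: order_trans\<close>)

lemma D_norm_cmult: "0 \<le> c \<Longrightarrow> D_norm M (\<lambda>j. c * u j) = c * D_norm M u"
  unfolding D_norm_def by (simp add: mult.left_commute vmax_cmult)

lemma D_norm_ge:
  assumes "\<And>j. 0 \<le> u j" shows "(\<integral>z. z j \<partial>M) * u j \<le> D_norm M u"
proof -
  have "(\<integral>z. z j \<partial>M) * u j = (\<integral>z. z j * u j \<partial>M)" by simp
  also have "\<dots> \<le> D_norm M u"
    unfolding D_norm_def using assms integrable_comp vmax_ge[of "\<lambda>j. _ j * u j"]
    by (intro integral_mono integrable_vmax) auto
  finally show ?thesis .
qed

lemma D_norm_pos: assumes "\<And>j. 0 \<le> u j" "0 < u j" shows "0 < D_norm M u"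
  using D_norm_ge[OF assms(1), of j] mean_pos[of j] assms(2)
  by (meson less_le_trans mult_pos_pos)

lemma D_norm_single: "0 \<le> a \<Longrightarrow> D_norm M (\<lambda>i. if i = j then a else 0) = (\<integral>z. z j \<partial>M) * a"
proof -
  assume a: "0 \<le> a"
  have "D_norm M (\<lambda>i. if i = j then a else 0) = (\<integral>z. z j * a \<partial>M)"
    unfolding D_norm_def
  proof (rule integral_cong_AE)
    show "AE z in M. vmax (\<lambda>i. z i * (if i = j then a else 0)) = z j * a"
      using nonneg
    proof eventually_elim
      case (elim z)
      then have "0 \<le> z j * a" using a by simp
      then show ?case
        by (intro antisym) (auto simp: vmax_le_iff intro: order_trans[OF _ vmax_ge[of _ j]])
    qed
  qed measurable
  then show ?thesis by simp
qed

text \<open>The total mass of the region.\<close>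

abbreviation V1 :: real where "V1 \<equiv> D_norm M (\<lambda>_. 1)"

lemma V1_pos: "0 < V1" by (rule D_norm_pos) auto

lemma V1_eq: "V1 = (\<integral>z. vmax z \<partial>M)" by (simp add: D_norm_def)

lemma gp_region_sets [measurable]: "gp_region \<in> sets (M \<Otimes>\<^sub>M lborel)"
proof -
  have "{p \<in> space (M \<Otimes>\<^sub>M lborel). 0 < snd p \<and> snd p < vmax (fst p)} \<in> sets (M \<Otimes>\<^sub>M lborel)"
    by measurable
  also have "{p \<in> space (M \<Otimes>\<^sub>M lborel). 0 < snd p \<and> snd p < vmax (fst p)} = gp_region"
    by (auto simp: gp_region_def space_pair_measure)
  finally show ?thesis .
qed

text \<open>The measure of a set whose sections are intervals with end points \<open>a z\<close> and \<open>b z\<close>; the end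
  points may or may not belong to the sections.\<close>

lemma emeasure_region_sub:
  fixes a :: "('n \<Rightarrow> real) \<Rightarrow> real"
  assumes [measurable]: "a \<in> borel_measurable M" and A: "A \<in> sets (M \<Otimes>\<^sub>M lborel)"
    and eq: "AE z in M. 0 \<le> a z \<and> a z \<le> b z \<and> (\<forall>s. (z, s) \<in> A \<longrightarrow> a z \<le> s \<and> s \<le> b z) \<and> (\<forall>s. a z < s \<and> s < b z \<longrightarrow> (z, s) \<in> A)"
    and b: "integrable M b" and a: "integrable M a"
  shows "emeasure (M \<Otimes>\<^sub>M lborel) A = ennreal ((\<integral>z. b z \<partial>M) - (\<integral>z. a z \<partial>M))"
proof -
  have "emeasure (M \<Otimes>\<^sub>M lborel) A = (\<integral>\<^sup>+z. emeasure lborel (Pair z -` A) \<partial>M)"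
    using A by (rule lborel.emeasure_pair_measure_alt)
  also have "\<dots> = (\<integral>\<^sup>+z. ennreal (b z - a z) \<partial>M)"
  proof (rule nn_integral_cong_AE)
    show "AE z in M. emeasure lborel (Pair z -` A) = ennreal (b z - a z)"
      using eq
    proof eventually_elim
      case (elim z)
      have m: "Pair z -` A \<in> sets lborel" using A by (rule sets_Pair1)
      have "emeasure lborel {a z<..<b z} \<le> emeasure lborel (Pair z -` A)"
        using elim m by (intro emeasure_mono) auto
      moreover have "emeasure lborel (Pair z -` A) \<le> emeasure lborel {a z..b z}"
        using elim by (intro emeasure_mono) auto
      ultimately show ?case using elim by simp
    qed
  qed
  also have "\<dots> = ennreal (\<integral>z. b z - a z \<partial>M)"
    using a b eq by (intro nn_integral_eq_integral) auto
  finally show ?thesis using a b by simp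
qed

lemma emeasure_gp_region: "emeasure (M \<Otimes>\<^sub>M lborel) gp_region = ennreal V1"
proof -
  have "emeasure (M \<Otimes>\<^sub>M lborel) gp_region = ennreal ((\<integral>z. vmax z \<partial>M) - (\<integral>z. 0 \<partial>M))"
  proof (rule emeasure_region_sub[OF _ gp_region_sets _ integrable_vmax1])
    show "AE z in M. 0 \<le> (0::real) \<and> 0 \<le> vmax z \<and> (\<forall>s. (z, s) \<in> gp_region \<longrightarrow> 0 \<le> s \<and> s \<le> vmax z) \<and>
        (\<forall>s. 0 < s \<and> s < vmax z \<longrightarrow> (z, s) \<in> gp_region)"
      using nonneg by eventually_elim (auto simp: gp_region_def vmax_nonneg)
  qed auto
  then show ?thesis by (simp add: V1_eq)
qed

lemma region_nontrivial: "emeasure (M \<Otimes>\<^sub>M lborel) gp_region \<noteq> 0" "emeasure (M \<Otimes>\<^sub>M lborel) gp_region \<noteq> \<infinity>"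
  using V1_pos by (auto simp: emeasure_gp_region)

lemma measure_gp_region: "measure (M \<Otimes>\<^sub>M lborel) gp_region = V1"
  using V1_pos by (simp add: measure_def emeasure_gp_region)

lemma gp_point_measurable [measurable]:
  "(\<lambda>(z, s) j. gp_point (\<gamma> j) (\<sigma> j) (z j) s) \<in> M \<Otimes>\<^sub>M lborel \<rightarrow>\<^sub>M ereal_space"
proof -
  have [measurable]: "(\<lambda>p. fst p j) \<in> borel_measurable (M \<Otimes>\<^sub>M lborel)" for j
    by (rule measurable_compose[OF measurable_fst]) measurable
  have "(\<lambda>p. gp_point (\<gamma> j) (\<sigma> j) (fst p j) (snd p)) \<in> borel_measurable (M \<Otimes>\<^sub>M lborel)" for j
    unfolding gp_point_def etail_inv_def by measurable
  then have "(\<lambda>p. \<lambda>j. gp_point (\<gamma> j) (\<sigma> j) (fst p j) (snd p)) \<in> M \<Otimes>\<^sub>M lborel \<rightarrow>\<^sub>M ereal_space"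
    by (intro measurable_PiM_single') (simp_all add: space_PiM)
  then show ?thesis by (simp only: case_prod_beta')
qed

lemma gp_point_measurable_uniform:
  "(\<lambda>(z, s) j. gp_point (\<gamma> j) (\<sigma> j) (z j) s) \<in> uniform_measure (M \<Otimes>\<^sub>M lborel) gp_region \<rightarrow>\<^sub>M ereal_space"
  unfolding measurable_cong_sets[OF sets_uniform_measure refl] by (rule gp_point_measurable)

lemma gp_law_prob: "prob_space (gp_law \<sigma> \<gamma> M)"
  unfolding gp_law_def
  by (intro prob_space.prob_space_distr prob_space_uniform_measure region_nontrivial gp_point_measurable_uniform)

lemma gp_law_is_law: "is_law (gp_law \<sigma> \<gamma> M)"
  unfolding is_law_def
proof (intro conjI gp_law_prob)
  show "AE y in gp_law \<sigma> \<gamma> M. \<forall>j. y j < \<infinity>"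
    unfolding gp_law_def
  proof (subst AE_distr_iff[OF gp_point_measurable_uniform])
    show "{y \<in> space ereal_space. \<forall>j. y j < \<infinity>} \<in> sets (ereal_space :: ('n \<Rightarrow> ereal) measure)" by measurable
  qed (auto simp: gp_point_def case_prod_beta)
qed (simp add: gp_law_def)

lemma measure_gp_law:
  assumes [measurable]: "A \<in> sets ereal_space"
  shows "measure (gp_law \<sigma> \<gamma> M) A =
    measure (M \<Otimes>\<^sub>M lborel) {(z, s). (z, s) \<in> gp_region \<and> (\<lambda>j. gp_point (\<gamma> j) (\<sigma> j) (z j) s) \<in> A} / V1"
proof -
  let ?f = "(\<lambda>(z, s) j. gp_point (\<gamma> j) (\<sigma> j) (z j) s) :: ('n \<Rightarrow> real) \<times> real \<Rightarrow> 'n \<Rightarrow> ereal"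
  have sp: "space (M \<Otimes>\<^sub>M lborel) = UNIV" by (simp add: space_pair_measure)
  have "measure (gp_law \<sigma> \<gamma> M) A = measure (uniform_measure (M \<Otimes>\<^sub>M lborel) gp_region) (?f -` A)"
    unfolding gp_law_def by (subst measure_distr[OF gp_point_measurable_uniform assms]) (simp add: sp)
  also have "\<dots> = measure (M \<Otimes>\<^sub>M lborel) (gp_region \<inter> ?f -` A) / V1"
    using measurable_sets[OF gp_point_measurable assms] unfolding sp Int_UNIV_right
    by (subst measure_uniform_measure[OF region_nontrivial]) (simp_all only: measure_gp_region)
  also have "gp_region \<inter> ?f -` A = {(z, s). (z, s) \<in> gp_region \<and> (\<lambda>j. gp_point (\<gamma> j) (\<sigma> j) (z j) s) \<in> A}"
    by auto
  finally show ?thesis .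
qed

text \<open>The event \<open>X \<le> x\<close> inside the region.\<close>

definition cell :: "('n \<Rightarrow> real) \<Rightarrow> (('n \<Rightarrow> real) \<times> real) set" where
  "cell x = {(z, s). (z, s) \<in> gp_region \<and> (\<forall>j. below (\<gamma> j) (\<sigma> j) (z j) (x j) s)}"

lemma below_sets:
  "{p. \<forall>j. below (\<gamma> j) (\<sigma> j) (fst p j) (x j) (snd p)} \<in> sets (M \<Otimes>\<^sub>M lborel)"
proof -
  have [measurable]: "(\<lambda>p. fst p j) \<in> borel_measurable (M \<Otimes>\<^sub>M lborel)" for j
    by (rule measurable_compose[OF measurable_fst]) measurable
  have "below (\<gamma> j) (\<sigma> j) z (x j) s \<longleftrightarrow> (z \<le> 0 \<and> (0 < \<gamma> j \<longrightarrow> 0 \<le> \<sigma> j + \<gamma> j * x j)) \<or>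
      (0 < z \<and> above_end (\<gamma> j) (\<sigma> j) (x j) \<and> z * etail (\<gamma> j) (\<sigma> j) (x j) \<le> s)" for z s j
    by (auto simp: below_def)
  then have "{p. \<forall>j. below (\<gamma> j) (\<sigma> j) (fst p j) (x j) (snd p)} =
     {p \<in> space (M \<Otimes>\<^sub>M lborel). \<forall>j. (fst p j \<le> 0 \<and> (0 < \<gamma> j \<longrightarrow> 0 \<le> \<sigma> j + \<gamma> j * x j)) \<or>
      (0 < fst p j \<and> above_end (\<gamma> j) (\<sigma> j) (x j) \<and> fst p j * etail (\<gamma> j) (\<sigma> j) (x j) \<le> snd p)}"
    by (simp add: space_pair_measure)
  also have "\<dots> \<in> sets (M \<Otimes>\<^sub>M lborel)" by measurable
  finally show ?thesis .
qed

lemma cell_sets [measurable]: "cell x \<in> sets (M \<Otimes>\<^sub>M lborel)"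
proof -
  have "cell x = gp_region \<inter> {p. \<forall>j. below (\<gamma> j) (\<sigma> j) (fst p j) (x j) (snd p)}"
    by (auto simp: cell_def)
  then show ?thesis using sets.Int[OF gp_region_sets below_sets] by (simp only:)
qed

lemma joint_cdf_gp_law: "joint_cdf (gp_law \<sigma> \<gamma> M) x = measure (M \<Otimes>\<^sub>M lborel) (cell x) / V1"
proof -
  have "{y. \<forall>j. y j \<le> ereal (x j)} \<in> sets ereal_space"
    using ereal_box_sets[OF gp_law_is_law] gp_law_is_law by (simp add: is_law_def)
  note m = measure_gp_law[OF this]
  have "(z, s) \<in> gp_region \<and> (\<lambda>j. gp_point (\<gamma> j) (\<sigma> j) (z j) s) \<in> {y. \<forall>j. y j \<le> ereal (x j)}
      \<longleftrightarrow> (z, s) \<in> cell x" for z s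
    by (auto simp: cell_def gp_region_def gp_point_le_iff[OF sigma_pos])
  then have "{(z, s). (z, s) \<in> gp_region \<and> (\<lambda>j. gp_point (\<gamma> j) (\<sigma> j) (z j) s) \<in> {y. \<forall>j. y j \<le> ereal (x j)}} = cell x"
    by blast
  then show ?thesis using m by (simp add: joint_cdf_eq[OF gp_law_is_law])
qed

text \<open>Above the lower endpoints the cdf is an explicit expression in the function
  \<open>u \<mapsto> E max\<^sub>j (Z\<^sub>j u\<^sub>j)\<close>, because the cell over \<open>z\<close> is an interval.\<close>

lemma joint_cdf_gp_law_above:
  assumes x: "\<And>j. above_end (\<gamma> j) (\<sigma> j) (x j)"
  shows "joint_cdf (gp_law \<sigma> \<gamma> M) x =
    (D_norm M (\<lambda>j. etail (\<gamma> j) (\<sigma> j) (min0 x j)) - D_norm M (\<lambda>j. etail (\<gamma> j) (\<sigma> j) (x j))) / V1"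
proof -
  define a where "a z = vmax (\<lambda>j. z j * etail (\<gamma> j) (\<sigma> j) (x j))" for z :: "'n \<Rightarrow> real"
  define b where "b z = vmax (\<lambda>j. z j * etail (\<gamma> j) (\<sigma> j) (min0 x j))" for z :: "'n \<Rightarrow> real"
  have ia: "integrable M a" and ib: "integrable M b"
    unfolding a_def b_def by (intro integrable_vmax etail_nonneg)+
  have bz: "b z = max (a z) (vmax z)" if "\<forall>j. 0 \<le> z j" for z
  proof -
    have "z j * max (etail (\<gamma> j) (\<sigma> j) (x j)) 1 = max (z j * etail (\<gamma> j) (\<sigma> j) (x j)) (z j)" for j
      using max_mult_distrib_left[of "z j" "etail (\<gamma> j) (\<sigma> j) (x j)" 1] that by simp
    then show ?thesis unfolding a_def b_def min0_def etail_min0[OF sigma_pos x] by (simp add: vmax_max)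
  qed
  have "emeasure (M \<Otimes>\<^sub>M lborel) (cell x) = ennreal ((\<integral>z. b z \<partial>M) - (\<integral>z. a z \<partial>M))"
  proof (rule emeasure_region_sub[OF _ cell_sets _ ib ia])
    show "AE z in M. 0 \<le> a z \<and> a z \<le> b z \<and> (\<forall>s. (z, s) \<in> cell x \<longrightarrow> a z \<le> s \<and> s \<le> b z) \<and>
        (\<forall>s. a z < s \<and> s < b z \<longrightarrow> (z, s) \<in> cell x)"
      using nonneg
    proof eventually_elim
      case (elim z)
      have "0 \<le> a z" unfolding a_def by (rule vmax_nonneg) (use elim in auto)
      moreover have "(z, s) \<in> cell x \<longleftrightarrow> 0 < s \<and> s < vmax z \<and> a z \<le> s" for s
      proof -
        have "below (\<gamma> j) (\<sigma> j) (z j) (x j) s \<longleftrightarrow> z j * etail (\<gamma> j) (\<sigma> j) (x j) \<le> s" if "0 < s" for j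
        proof (cases "z j = 0")
          case True
          then show ?thesis using x[of j] that by (auto simp: below_def above_end_def)
        next
          case False
          then show ?thesis using x[of j] elim by (auto simp: below_def antisym)
        qed
        then show ?thesis unfolding cell_def gp_region_def a_def vmax_le_iff by auto
      qed
      moreover have "a z \<le> b z" "\<And>s. s < b z \<Longrightarrow> a z < s \<Longrightarrow> s < vmax z" "\<And>s. s < vmax z \<Longrightarrow> s \<le> b z"
        using bz[OF elim] by (auto simp del: Max_gr_iff Max_less_iff Max_le_iff Max_ge_iff)
      ultimately show ?case by (meson less_imp_le le_less_trans)
    qed
  qed (use ia in simp)
  moreover have "(\<integral>z. a z \<partial>M) \<le> (\<integral>z. b z \<partial>M)"
    using nonneg by (intro integral_mono_AE ia ib) (auto simp: bz elim!: eventually_mono)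
  ultimately show ?thesis
    unfolding joint_cdf_gp_law by (simp add: measure_def D_norm_def a_def b_def)
qed

lemma joint_cdf_gp_law_zero:
  assumes "0 < \<gamma> j" "x j < - \<sigma> j / \<gamma> j"
  shows "joint_cdf (gp_law \<sigma> \<gamma> M) x = 0"
proof -
  have "\<sigma> j + \<gamma> j * x j < 0" using assms by (simp add: field_simps)
  then have "\<not> below (\<gamma> j) (\<sigma> j) z (x j) s" for z s using assms(1) by (auto simp: below_def above_end_def)
  then have "cell x = {}" by (auto simp: cell_def)
  then show ?thesis by (simp add: joint_cdf_gp_law)
qed

text \<open>For \<open>\<gamma> < 0\<close> the upper endpoint is not attained, since \<open>s / z\<close> is positive.\<close>

lemma gp_law_upper: "AE y in gp_law \<sigma> \<gamma> M. \<forall>j. \<gamma> j < 0 \<longrightarrow> y j < ereal (- \<sigma> j / \<gamma> j)"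
proof -
  have "gp_point (\<gamma> j) (\<sigma> j) z s < ereal (- \<sigma> j / \<gamma> j)" if "0 < s" "\<gamma> j < 0" for z s j
  proof (cases "z \<le> 0")
    case False
    then have "0 < \<sigma> j + \<gamma> j * etail_inv (\<gamma> j) (\<sigma> j) (s / z)"
      using inside_etail_inv[OF sigma_pos, of "s / z"] that by (simp add: inside_def)
    then have "etail_inv (\<gamma> j) (\<sigma> j) (s / z) < - \<sigma> j / \<gamma> j"
      using that neg_less_divide_eq[of "\<gamma> j" "etail_inv (\<gamma> j) (\<sigma> j) (s / z)" "- \<sigma> j"]
      by (simp only: mult.commute)
    then show ?thesis using False by (simp add: gp_point_def)
  qed (use that in \<open>simp add: gp_point_def\<close>)
  then have "AE p in uniform_measure (M \<Otimes>\<^sub>M lborel) gp_region.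
     \<forall>j. \<gamma> j < 0 \<longrightarrow> gp_point (\<gamma> j) (\<sigma> j) (fst p j) (snd p) < ereal (- \<sigma> j / \<gamma> j)"
    by (intro AE_uniform_measureI gp_region_sets AE_I2) (auto simp: gp_region_def)
  then show ?thesis unfolding gp_law_def
  proof (subst AE_distr_iff[OF gp_point_measurable_uniform])
    show "{y \<in> space ereal_space. \<forall>j. \<gamma> j < 0 \<longrightarrow> y j < ereal (- \<sigma> j / \<gamma> j)} \<in> sets (ereal_space :: ('n \<Rightarrow> ereal) measure)"
      by measurable
  qed (simp add: case_prod_beta)
qed

lemma slice_nonneg: "0 \<le> gp_slice \<sigma> \<gamma> M x s"
  by (simp add: gp_slice_def)

text \<open>Fubini in the other order: slices at fixed \<open>s\<close>.\<close>

lemma slice_integral: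
  "(LINT s:{0<..}|lborel. gp_slice \<sigma> \<gamma> M x s) = measure (M \<Otimes>\<^sub>M lborel) (cell x)"
proof -
  interpret pair_sigma_finite M lborel ..
  let ?A = "{p. (\<forall>j. below (\<gamma> j) (\<sigma> j) (fst p j) (x j) (snd p)) \<and> snd p < vmax (fst p)}"
  have "?A = {p. \<forall>j. below (\<gamma> j) (\<sigma> j) (fst p j) (x j) (snd p)} \<inter> {p \<in> space (M \<Otimes>\<^sub>M lborel). snd p < vmax (fst p)}"
    by (auto simp: space_pair_measure)
  moreover have "{p \<in> space (M \<Otimes>\<^sub>M lborel). snd p < vmax (fst p)} \<in> sets (M \<Otimes>\<^sub>M lborel)"
    by measurable
  ultimately have A: "?A \<in> sets (M \<Otimes>\<^sub>M lborel)" using sets.Int[OF below_sets] by (simp only:)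
  have sl: "gp_slice \<sigma> \<gamma> M x s = measure M ((\<lambda>z. (z, s)) -` ?A)" for s
    by (auto simp: gp_slice_def intro!: arg_cong[where f="measure M"])
  have meas: "gp_slice \<sigma> \<gamma> M x \<in> borel_measurable lborel"
    unfolding sl measure_def using measurable_emeasure_Pair2[OF A] by measurable
  have "emeasure (M \<Otimes>\<^sub>M lborel) (cell x) = (\<integral>\<^sup>+s. emeasure M ((\<lambda>z. (z, s)) -` cell x) \<partial>lborel)"
    by (rule emeasure_pair_measure_alt2[OF cell_sets])
  also have "\<dots> = (\<integral>\<^sup>+s. ennreal (indicator {0<..} s * gp_slice \<sigma> \<gamma> M x s) \<partial>lborel)"
  proof (rule nn_integral_cong)
    fix s
    have "(\<lambda>z. (z, s)) -` cell x = (if 0 < s then (\<lambda>z. (z, s)) -` ?A else {})"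
      by (auto simp: cell_def gp_region_def)
    then show "emeasure M ((\<lambda>z. (z, s)) -` cell x) = ennreal (indicator {0<..} s * gp_slice \<sigma> \<gamma> M x s)"
      by (simp add: sl emeasure_eq_measure)
  qed
  finally have *: "emeasure (M \<Otimes>\<^sub>M lborel) (cell x) = \<dots>" .
  have "(LINT s:{0<..}|lborel. gp_slice \<sigma> \<gamma> M x s) = (\<integral>s. indicator {0<..} s * gp_slice \<sigma> \<gamma> M x s \<partial>lborel)"
    by (simp add: set_lebesgue_integral_def)
  also have "\<dots> = enn2real (emeasure (M \<Otimes>\<^sub>M lborel) (cell x))"
    unfolding * using meas
    by (intro integral_eq_nn_integral AE_I2 mult_nonneg_nonneg) (simp_all add: slice_nonneg)
  finally show ?thesis
    by (simp add: measure_def)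
qed

lemma joint_cdf_gp_law_slice:
  "joint_cdf (gp_law \<sigma> \<gamma> M) x = (LINT s:{0<..}|lborel. gp_slice \<sigma> \<gamma> M x s) / V1"
  by (simp add: joint_cdf_gp_law slice_integral)

lemma V1_tail: "(LINT s:{0<..}|lborel. measure M {z. s < vmax z}) = V1"
proof -
  interpret pair_sigma_finite M lborel ..
  have m: "(\<lambda>s. measure M {z. s < vmax z}) \<in> borel_measurable lborel"
  proof -
    have "{p \<in> space (M \<Otimes>\<^sub>M lborel). snd p < vmax (fst p)} \<in> sets (M \<Otimes>\<^sub>M lborel)" by measurable
    from measurable_emeasure_Pair2[OF this] show ?thesis
      unfolding measure_def by (simp add: vimage_def space_pair_measure)
  qed
  have "emeasure (M \<Otimes>\<^sub>M lborel) gp_region = (\<integral>\<^sup>+s. emeasure M ((\<lambda>z. (z, s)) -` gp_region) \<partial>lborel)"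
    by (rule emeasure_pair_measure_alt2[OF gp_region_sets])
  also have "\<dots> = (\<integral>\<^sup>+s. ennreal (indicator {0<..} s * measure M {z. s < vmax z}) \<partial>lborel)"
  proof (rule nn_integral_cong)
    fix s
    have "(\<lambda>z :: 'n \<Rightarrow> real. (z, s)) -` gp_region = (if 0 < s then {z. s < vmax z} else {})"
      by (auto simp: gp_region_def)
    then show "emeasure M ((\<lambda>z. (z, s)) -` gp_region) = ennreal (indicator {0<..} s * measure M {z. s < vmax z})"
      by (cases "0 < s") (simp_all add: emeasure_eq_measure del: Max_gr_iff)
  qed
  finally have *: "ennreal V1 = \<dots>" by (simp add: emeasure_gp_region)
  have "(LINT s:{0<..}|lborel. measure M {z. s < vmax z}) = enn2real (ennreal V1)"
    unfolding * set_lebesgue_integral_def real_scaleR_def using m by (intro integral_eq_nn_integral) auto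
  then show ?thesis using V1_pos by simp
qed

end

section \<open>The cdfs of the three representations\<close>

lemma generatorI:
  fixes M :: "('n::finite \<Rightarrow> real) measure"
  assumes p: "prob_space M" and s: "sets M = sets real_space" and nn: "AE z in M. \<forall>j. 0 \<le> z j"
    and pos: "\<And>j. 0 < (\<integral>\<^sup>+z. ennreal (z j) \<partial>M)" and fin: "\<And>j. (\<integral>\<^sup>+z. ennreal (z j) \<partial>M) < \<infinity>"
  shows "generator M"
proof -
  have [measurable]: "(\<lambda>z. z j) \<in> borel_measurable M" for j
    using s by (simp cong: measurable_cong_sets)
  have nnj: "AE z in M. 0 \<le> z j" for j using nn by eventually_elim simp
  have int: "integrable M (\<lambda>z. z j)" for j
    using fin[of j] nnj by (intro integrableI_nonneg) auto
  have "0 < (\<integral>z. z j \<partial>M)" for j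
    using pos[of j] nn_integral_eq_integral[OF int nnj, of j] by simp
  with p s nn int show ?thesis by (simp add: generator_def)
qed

text \<open>Images of laws under maps that act on each coordinate separately, in both directions between
  \<open>[-\<infinity>, \<infinity>)\<close> and \<open>[0, \<infinity>)\<close>.\<close>

definition to_real :: "('n \<Rightarrow> ereal \<Rightarrow> real) \<Rightarrow> ('n::finite \<Rightarrow> ereal) measure \<Rightarrow> ('n \<Rightarrow> real) measure" where
  "to_real f \<rho> = distr \<rho> real_space (\<lambda>y j. f j (y j))"

definition to_ereal :: "('n \<Rightarrow> real \<Rightarrow> ereal) \<Rightarrow> ('n::finite \<Rightarrow> real) measure \<Rightarrow> ('n \<Rightarrow> ereal) measure" where
  "to_ereal f M = distr M ereal_space (\<lambda>z j. f j (z j))"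

lemma real_box_sets: "{z :: 'n::finite \<Rightarrow> real. \<forall>j. P j (z j)} \<in> sets real_space"
  if [measurable]: "\<And>j. Measurable.pred borel (P j)" 
proof -
  have "{z \<in> space real_space. \<forall>j. P j (z j :: real)} \<in> sets real_space" by measurable
  then show ?thesis by (simp add: space_PiM)
qed

lemma to_real_measurable:
  assumes rho: "is_law \<rho>" and f: "\<And>j. f j \<in> borel_measurable borel"
  shows "(\<lambda>y j. f j (y j)) \<in> \<rho> \<rightarrow>\<^sub>M (real_space :: ('n::finite \<Rightarrow> real) measure)"
  using f law_component_measurable[OF rho]
  by (intro measurable_PiM_single') (auto simp: space_PiM)

lemma to_ereal_measurable:
  assumes M: "sets M = sets real_space" and f: "\<And>j. f j \<in> borel_measurable borel"
  shows "(\<lambda>z j. f j (z j)) \<in> M \<rightarrow>\<^sub>M (ereal_space :: ('n::finite \<Rightarrow> ereal) measure)"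
proof -
  have "(\<lambda>z. z j) \<in> borel_measurable M" for j using M by (simp cong: measurable_cong_sets)
  then show ?thesis using f by (intro measurable_PiM_single') (auto simp: space_PiM)
qed

lemma generator_to_real:
  fixes \<rho> :: "('n::finite \<Rightarrow> ereal) measure"
  assumes rho: "is_law \<rho>" and f: "\<And>j. f j \<in> borel_measurable borel" and nn: "\<And>j y. 0 \<le> f j y"
    and pos: "\<And>j. 0 < (\<integral>\<^sup>+y. ennreal (f j (y j)) \<partial>\<rho>)" and fin: "\<And>j. (\<integral>\<^sup>+y. ennreal (f j (y j)) \<partial>\<rho>) < \<infinity>"
  shows "generator (to_real f \<rho>)"
proof (rule generatorI)
  note m = to_real_measurable[OF rho f]
  show "prob_space (to_real f \<rho>)"
    unfolding to_real_def using rho m by (intro prob_space.prob_space_distr) (auto simp: is_law_def)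
  show "AE z in to_real f \<rho>. \<forall>j. 0 \<le> z j"
    unfolding to_real_def
  proof (subst AE_distr_iff[OF m])
    show "{z \<in> space real_space. \<forall>j. 0 \<le> z j} \<in> sets (real_space :: ('n \<Rightarrow> real) measure)" by measurable
  qed (simp add: nn)
  have "(\<integral>\<^sup>+z. ennreal (z j) \<partial>to_real f \<rho>) = (\<integral>\<^sup>+y. ennreal (f j (y j)) \<partial>\<rho>)" for j
    unfolding to_real_def by (subst nn_integral_distr[OF m]) auto
  then show "0 < (\<integral>\<^sup>+z. ennreal (z j) \<partial>to_real f \<rho>)" "(\<integral>\<^sup>+z. ennreal (z j) \<partial>to_real f \<rho>) < \<infinity>" for j
    using pos fin by simp_all
qed (simp add: to_real_def)

lemma measure_to_real:
  fixes \<rho> :: "('n::finite \<Rightarrow> ereal) measure"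
  assumes rho: "is_law \<rho>" and f: "\<And>j. f j \<in> borel_measurable borel"
    and P: "\<And>j. Measurable.pred borel (P j)"
    and eq: "AE y in \<rho>. \<forall>j. y j \<le> ereal (a j) \<longleftrightarrow> P j (f j (y j))"
  shows "joint_cdf \<rho> a = measure (to_real f \<rho>) {z. \<forall>j. P j (z j)}"
proof -
  interpret prob_space \<rho> using rho by (simp add: is_law_def)
  note m = to_real_measurable[OF rho f]
  have "measure (to_real f \<rho>) {z. \<forall>j. P j (z j)} = measure \<rho> {y. \<forall>j. P j (f j (y j))}"
    unfolding to_real_def using real_box_sets[OF P]
    by (subst measure_distr[OF m]) (simp_all add: space_law[OF rho] vimage_def)
  also have "\<dots> = measure \<rho> {y. \<forall>j. y j \<le> ereal (a j)}"
  proof (rule finite_measure_eq_AE)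
    show "AE y in \<rho>. (y \<in> {y. \<forall>j. P j (f j (y j))}) = (y \<in> {y. \<forall>j. y j \<le> ereal (a j)})"
      using eq by eventually_elim simp
    show "{y. \<forall>j. P j (f j (y j))} \<in> events"
      using measurable_sets[OF m real_box_sets[OF P]] by (simp add: space_law[OF rho] vimage_def)
  qed (rule ereal_box_sets[OF rho])
  finally show ?thesis by (simp add: joint_cdf_eq[OF rho])
qed

lemma is_law_to_ereal:
  fixes M :: "('n::finite \<Rightarrow> real) measure"
  assumes p: "prob_space M" and s: "sets M = sets real_space" and f: "\<And>j. f j \<in> borel_measurable borel"
    and fin: "\<And>j z. f j z < \<infinity>"
  shows "is_law (to_ereal f M)"
  unfolding is_law_def to_ereal_def
proof (intro conjI)
  note m = to_ereal_measurable[OF s f]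
  show "prob_space (distr M ereal_space (\<lambda>z j. f j (z j)))"
    using p m by (rule prob_space.prob_space_distr)
  show "AE y in distr M ereal_space (\<lambda>z j. f j (z j)). \<forall>j. y j < \<infinity>"
  proof (subst AE_distr_iff[OF m])
    show "{y \<in> space ereal_space. \<forall>j. y j < \<infinity>} \<in> sets (ereal_space :: ('n \<Rightarrow> ereal) measure)" by measurable
  qed (use fin in simp)
qed simp

lemma AE_to_ereal:
  fixes M :: "('n::finite \<Rightarrow> real) measure"
  assumes s: "sets M = sets real_space" and f: "\<And>j. f j \<in> borel_measurable borel"
    and P: "{y \<in> space ereal_space. P y} \<in> sets ereal_space"
  shows "(AE y in to_ereal f M. P y) \<longleftrightarrow> (AE z in M. P (\<lambda>j. f j (z j)))"
  unfolding to_ereal_def using P by (rule AE_distr_iff[OF to_ereal_measurable[OF s f]])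

lemma nn_integral_to_ereal:
  fixes M :: "('n::finite \<Rightarrow> real) measure"
  assumes s: "sets M = sets real_space" and f: "\<And>j. f j \<in> borel_measurable borel"
    and g: "g \<in> borel_measurable borel"
  shows "(\<integral>\<^sup>+y. ennreal (g (y j)) \<partial>to_ereal f M) = (\<integral>\<^sup>+z. ennreal (g (f j (z j))) \<partial>M)"
proof -
  note [measurable] = g
  have "(\<lambda>y. ennreal (g (y j))) \<in> borel_measurable (ereal_space :: ('n \<Rightarrow> ereal) measure)" by measurable
  then show ?thesis
    unfolding to_ereal_def by (subst nn_integral_distr[OF to_ereal_measurable[OF s f]]) auto
qed

lemma joint_cdf_to_ereal:
  fixes M :: "('n::finite \<Rightarrow> real) measure"
  assumes p: "prob_space M" and s: "sets M = sets real_space" and f: "\<And>j. f j \<in> borel_measurable borel"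
    and fin: "\<And>j z. f j z < \<infinity>"
  shows "joint_cdf (to_ereal f M) a = measure M {z. \<forall>j. f j (z j) \<le> ereal (a j)}"
proof -
  have sp: "space M = UNIV" using sets_eq_imp_space_eq[OF s] by (simp add: space_PiM)
  have "{y. \<forall>j. y j \<le> ereal (a j)} \<in> sets (to_ereal f M)"
    by (rule ereal_box_sets[OF is_law_to_ereal[OF p s f fin]])
  then have "{y. \<forall>j. y j \<le> ereal (a j)} \<in> sets ereal_space" by (simp add: to_ereal_def)
  then show ?thesis
    unfolding joint_cdf_eq[OF is_law_to_ereal[OF p s f fin]] unfolding to_ereal_def
    by (subst measure_distr[OF to_ereal_measurable[OF s f]]) (simp_all add: sp vimage_def)
qed

lemma below_pred: "Measurable.pred borel (\<lambda>z. below \<gamma> \<sigma> z x s)"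
proof -
  have "(\<lambda>z. below \<gamma> \<sigma> z x s) = (\<lambda>z. (z \<le> 0 \<and> (0 < \<gamma> \<longrightarrow> 0 \<le> \<sigma> + \<gamma> * x)) \<or>
      (0 < z \<and> above_end \<gamma> \<sigma> x \<and> z * etail \<gamma> \<sigma> x \<le> s))"
    by (auto simp: below_def fun_eq_iff)
  then show ?thesis by simp
qed

context gen
begin

text \<open>The event that \<open>R\<close> or \<open>U\<close> stays below its argument at time \<open>s\<close>, expressed by \<open>Z\<close>.\<close>

definition down_set :: "('n \<Rightarrow> real) \<Rightarrow> real \<Rightarrow> ('n \<Rightarrow> real) set" where
  "down_set x s = {z. \<forall>j. below (\<gamma> j) (\<sigma> j) (z j) (x j) s}"

lemma down_set_sets [measurable]: "down_set x s \<in> sets M"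
  unfolding down_set_def sets_M by (intro real_box_sets below_pred)

lemma vmax_sets: "{z. s < vmax z} \<in> sets M" "{z. \<forall>j. z j \<le> s} \<in> sets M"
proof -
  have "{z \<in> space M. s < vmax z} \<in> sets M" "{z \<in> space M. \<forall>j. z j \<le> s} \<in> sets M" by measurable
  then show "{z. s < vmax z} \<in> sets M" "{z. \<forall>j. z j \<le> s} \<in> sets M" by simp_all
qed

lemma not_vmax_le: "s < vmax z \<longleftrightarrow> \<not> (\<forall>j. z j \<le> s)" for z :: "'n \<Rightarrow> real"
  unfolding vmax_le_iff[symmetric] by (rule linorder_not_le[symmetric])

lemma down_set_0: "0 < s \<Longrightarrow> down_set (\<lambda>_. 0) s = {z. \<forall>j. z j \<le> s}"
  by (simp add: down_set_def below_0[OF sigma_pos])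

text \<open>Replacing \<open>x\<close> by \<open>x \<and> 0\<close> adds the condition \<open>max\<^sub>j z\<^sub>j \<le> s\<close>.\<close>

lemma slice_eq_down_set_diff:
  assumes "0 < s" shows "measure M (down_set x s) - measure M (down_set (min0 x) s) = gp_slice \<sigma> \<gamma> M x s"
proof -
  have sub: "down_set (min0 x) s \<subseteq> down_set x s"
    by (auto simp: down_set_def min0_def below_min0[OF sigma_pos assms])
  have "{z. s < vmax z \<and> (\<forall>j. below (\<gamma> j) (\<sigma> j) (z j) (x j) s)} = down_set x s - down_set (min0 x) s"
    by (auto simp only: down_set_def min0_def below_min0[OF sigma_pos assms] not_vmax_le)
  then show ?thesis unfolding gp_slice_def
    using finite_measure_Diff[OF down_set_sets down_set_sets sub] by simp
qed

lemma one_minus_down_set_0: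
  assumes "0 < s" shows "1 - measure M (down_set (\<lambda>_. 0) s) = measure M {z. s < vmax z}"
proof -
  have "measure M {z. s < vmax z} = measure M (space M - {z. \<forall>j. z j \<le> s})"
    by (rule arg_cong[where f="measure M"]) (auto simp only: not_vmax_le space_M)
  then show ?thesis using prob_compl[OF vmax_sets(2)] assms by (simp add: down_set_0)
qed

lemma GP_R_eq:
  assumes rep: "\<And>x t. 0 < t \<Longrightarrow> joint_cdf \<rho> (R_arg \<sigma> \<gamma> x t) = measure M (down_set x t)"
  shows "GP_R \<sigma> \<gamma> \<rho> = gp_law \<sigma> \<gamma> M"
proof -
  have "(LINT t:{0<..}|lborel. joint_cdf \<rho> (R_arg \<sigma> \<gamma> x t) - joint_cdf \<rho> (R_arg \<sigma> \<gamma> (min0 x) t))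
      = (LINT t:{0<..}|lborel. gp_slice \<sigma> \<gamma> M x t)" for x
    by (intro set_lebesgue_integral_cong) (auto simp: rep slice_eq_down_set_diff)
  moreover have "(LINT t:{0<..}|lborel. 1 - joint_cdf \<rho> (R_arg \<sigma> \<gamma> (\<lambda>_. 0) t)) =
      (LINT t:{0<..}|lborel. measure M {z. t < vmax z})"
    by (intro set_lebesgue_integral_cong) (auto simp: rep one_minus_down_set_0 simp del: Max_gr_iff)
  ultimately have "H_R \<sigma> \<gamma> \<rho> x = joint_cdf (gp_law \<sigma> \<gamma> M) x" for x
    by (simp add: H_R_def joint_cdf_gp_law_slice V1_tail)
  then show ?thesis unfolding GP_R_def
    by (intro the_equality) (auto simp: gp_law_is_law intro!: law_eqI[OF _ gp_law_is_law])
qed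

text \<open>The cdf prescribed between the endpoints determines the law, by \<open>law_eqI_inside\<close>.\<close>

lemma cdf_spec_unique:
  assumes H: "\<And>x. (\<And>j. inside (\<gamma> j) (\<sigma> j) (x j)) \<Longrightarrow> H x = joint_cdf (gp_law \<sigma> \<gamma> M) x"
  shows "(THE \<mu>. cdf_spec \<sigma> \<gamma> H \<mu>) = gp_law \<sigma> \<gamma> M"
proof (rule the_equality)
  show "cdf_spec \<sigma> \<gamma> H (gp_law \<sigma> \<gamma> M)"
    unfolding cdf_spec_def using gp_law_is_law H joint_cdf_gp_law_zero
    by (auto simp: inside_def add.commute)
  fix \<mu> assume mu: "cdf_spec \<sigma> \<gamma> H \<mu>"
  show "\<mu> = gp_law \<sigma> \<gamma> M"
  proof (rule law_eqI_inside[OF sigma_pos _ gp_law_is_law _ _ gp_law_upper])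
    show "is_law \<mu>" using mu by (simp add: cdf_spec_def)
    show "joint_cdf \<mu> x = joint_cdf (gp_law \<sigma> \<gamma> M) x" if "\<And>j. inside (\<gamma> j) (\<sigma> j) (x j)" for x
      using mu H[OF that] that by (simp add: cdf_spec_def inside_def add.commute)
    show "joint_cdf \<mu> x = 0 \<and> joint_cdf (gp_law \<sigma> \<gamma> M) x = 0" if "0 < \<gamma> j" "x j < - \<sigma> j / \<gamma> j" for x j
      using mu that joint_cdf_gp_law_zero[of j x] unfolding cdf_spec_def by blast
  qed
qed

lemma U_arg_0: "U_arg \<sigma> \<gamma> (\<lambda>_. 0) t = (\<lambda>_. ln t)"
  by (simp add: U_arg_def fun_eq_iff)

lemma GP_U_eq:
  assumes rep: "\<And>x t. 0 < t \<Longrightarrow> (\<And>j. inside (\<gamma> j) (\<sigma> j) (x j)) \<Longrightarrow> joint_cdf \<rho> (U_arg \<sigma> \<gamma> x t) = measure M (down_set x t)"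
  shows "GP_U \<sigma> \<gamma> \<rho> = gp_law \<sigma> \<gamma> M"
  unfolding GP_U_def
proof (rule cdf_spec_unique)
  fix x assume x: "\<And>j. inside (\<gamma> j) (\<sigma> j) (x j)"
  have x0: "inside (\<gamma> j) (\<sigma> j) (min0 x j)" for j unfolding min0_def by (rule inside_min0[OF sigma_pos x])
  have "(LINT t:{0<..}|lborel. joint_cdf \<rho> (U_arg \<sigma> \<gamma> x t) - joint_cdf \<rho> (U_arg \<sigma> \<gamma> (min0 x) t))
      = (LINT t:{0<..}|lborel. gp_slice \<sigma> \<gamma> M x t)"
    using rep[OF _ x] rep[OF _ x0] by (intro set_lebesgue_integral_cong) (auto simp: slice_eq_down_set_diff)
  moreover have "joint_cdf \<rho> (\<lambda>_. ln t) = measure M (down_set (\<lambda>_. 0) t)" if "0 < t" for t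
    using rep[OF that, of "\<lambda>_. 0"] sigma_pos by (simp add: inside_def U_arg_0)
  then have "(LINT t:{0<..}|lborel. 1 - joint_cdf \<rho> (\<lambda>_. ln t)) =
      (LINT t:{0<..}|lborel. measure M {z. t < vmax z})"
    by (intro set_lebesgue_integral_cong) (auto simp: one_minus_down_set_0 simp del: Max_gr_iff)
  ultimately show "H_U \<sigma> \<gamma> \<rho> x = joint_cdf (gp_law \<sigma> \<gamma> M) x"
    by (simp add: H_U_def joint_cdf_gp_law_slice V1_tail)
qed

lemma V1_eq_1: "AE z in M. vmax z = 1 \<Longrightarrow> V1 = 1"
proof -
  assume "AE z in M. vmax z = 1"
  then have "V1 = (\<integral>z. 1 \<partial>M)" unfolding V1_eq by (intro integral_cong_AE) auto
  then show ?thesis using prob_space by simp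
qed

lemma GP_S_eq:
  assumes rep: "\<And>x t. 0 < t \<Longrightarrow> (\<And>j. inside (\<gamma> j) (\<sigma> j) (x j)) \<Longrightarrow> joint_cdf \<rho> (U_arg \<sigma> \<gamma> x t) = measure M (down_set x t)"
    and one: "AE z in M. vmax z = 1"
  shows "GP_S \<sigma> \<gamma> \<rho> = gp_law \<sigma> \<gamma> M"
  unfolding GP_S_def
proof (rule cdf_spec_unique)
  fix x assume x: "\<And>j. inside (\<gamma> j) (\<sigma> j) (x j)"
  have "gp_slice \<sigma> \<gamma> M x t = (if t < 1 then measure M (down_set x t) else 0)" for t
  proof -
    have m: "{z. t < vmax z \<and> (\<forall>j. below (\<gamma> j) (\<sigma> j) (z j) (x j) t)} \<in> sets M"
      using sets.Int[OF vmax_sets(1)[of t] down_set_sets[of x t]] by (simp add: down_set_def Collect_conj_eq)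
    have "gp_slice \<sigma> \<gamma> M x t = measure M (if t < 1 then down_set x t else {})"
      unfolding gp_slice_def
    proof (rule finite_measure_eq_AE[OF _ m])
      show "AE z in M. (z \<in> {z. t < vmax z \<and> (\<forall>j. below (\<gamma> j) (\<sigma> j) (z j) (x j) t)}) = (z \<in> (if t < 1 then down_set x t else {}))"
        using one by eventually_elim (simp add: down_set_def del: Max_gr_iff)
    qed simp
    then show ?thesis by simp
  qed
  then have "(LINT t:{0<..}|lborel. gp_slice \<sigma> \<gamma> M x t) = (LINT t:{0<..<1}|lborel. joint_cdf \<rho> (U_arg \<sigma> \<gamma> x t))"
    unfolding set_lebesgue_integral_def using rep[OF _ x]
    by (intro Bochner_Integration.integral_cong) (auto simp: indicator_def)
  then show "H_S \<sigma> \<gamma> \<rho> x = joint_cdf (gp_law \<sigma> \<gamma> M) x"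
    by (simp add: H_S_def joint_cdf_gp_law_slice V1_eq_1[OF one])
qed

end

section \<open>The three classes of laws and their conditional margins\<close>

text \<open>The substitution \<open>Z = (\<gamma> R / \<sigma>) ^ (1/\<gamma>)\<close>, which is \<open>exp U\<close> for \<open>R = \<sigma>/\<gamma> exp (\<gamma> U)\<close>, with \<open>Z = exp (R / \<sigma>)\<close>
  for \<open>\<gamma> = 0\<close>.\<close>

definition R_radius :: "real \<Rightarrow> real \<Rightarrow> ereal \<Rightarrow> real" where
  "R_radius \<sigma> \<gamma> r = (if r = -\<infinity> then 0 else if \<gamma> = 0 then exp (real_of_ereal r / \<sigma>)
     else (\<gamma> * real_of_ereal r / \<sigma>) powr (1 / \<gamma>))"

text \<open>The inverse substitution. At \<open>Z = 0\<close> it gives the least admissible value of \<open>R\<close>: \<open>0\<close> for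
  \<open>\<gamma> > 0\<close> and \<open>-\<infinity>\<close> otherwise.\<close>

definition R_point :: "real \<Rightarrow> real \<Rightarrow> real \<Rightarrow> ereal" where
  "R_point \<sigma> \<gamma> z = (if z \<le> 0 then (if 0 < \<gamma> then 0 else -\<infinity>) else if \<gamma> = 0 then ereal (\<sigma> * ln z)
     else ereal (\<sigma> / \<gamma> * z powr \<gamma>))"

text \<open>The logarithm with \<open>log 0 = -\<infinity>\<close>.\<close>

definition U_point :: "real \<Rightarrow> ereal" where
  "U_point z = (if z \<le> 0 then -\<infinity> else ereal (ln z))"

text \<open>The constant factor between the constrained moment of \<open>R\<close> and \<open>Z\<close>.\<close>

definition R_const :: "real \<Rightarrow> real \<Rightarrow> real" where
  "R_const \<sigma> \<gamma> = (if \<gamma> = 0 then 1 else (\<sigma> / \<bar>\<gamma>\<bar>) powr (1 / \<gamma>))"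

text \<open>The admissible values of a component of \<open>R\<close>.\<close>

definition R_range :: "real \<Rightarrow> ereal \<Rightarrow> bool" where
  "R_range \<gamma> r \<longleftrightarrow> r < \<infinity> \<and> (0 < \<gamma> \<longrightarrow> 0 \<le> r) \<and> (\<gamma> < 0 \<longrightarrow> r < 0)"

lemma R_point_range: "0 < \<sigma> \<Longrightarrow> R_range \<gamma> (R_point \<sigma> \<gamma> z)"
  by (auto simp: R_range_def R_point_def mult_neg_pos divide_pos_neg)

lemma R_radius_nonneg: "0 \<le> R_radius \<sigma> \<gamma> r" by (simp add: R_radius_def)

lemma R_radius_measurable: "R_radius \<sigma> \<gamma> \<in> borel_measurable borel"
  unfolding R_radius_def by measurable

lemma R_moment_measurable: "R_moment \<sigma> \<gamma> \<in> borel_measurable borel"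
  unfolding R_moment_def by measurable

lemma R_point_measurable: "R_point \<sigma> \<gamma> \<in> borel_measurable borel"
  unfolding R_point_def by measurable

lemma U_point_measurable: "U_point \<in> borel_measurable borel"
  unfolding U_point_def by measurable

lemma exp_ereal_measurable: "exp_ereal \<in> borel_measurable borel"
  unfolding exp_ereal_def by measurable

lemma R_const_pos: "0 < \<sigma> \<Longrightarrow> 0 < R_const \<sigma> \<gamma>"
  by (simp add: R_const_def)

lemma R_point_radius:
  assumes s: "0 < \<sigma>" and r: "R_range \<gamma> r"
  shows "R_point \<sigma> \<gamma> (R_radius \<sigma> \<gamma> r) = r"
proof (cases r)
  case (real y)
  consider "\<gamma> = 0" | "\<gamma> \<noteq> 0" "\<gamma> * y = 0" | "\<gamma> \<noteq> 0" "0 < \<gamma> * y"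
    using r real by (cases "\<gamma>" "0 :: real" rule: linorder_cases) (force simp: R_range_def mult_neg_neg)+
  then show ?thesis
  proof cases
    case 3
    then have "0 < \<gamma> * y / \<sigma>" using s by simp
    have "(w powr (1 / \<gamma>)) powr \<gamma> = w" if "0 < w" for w using 3 that by (simp add: powr_powr)
    from this[OF \<open>0 < \<gamma> * y / \<sigma>\<close>] have "((\<gamma> * y / \<sigma>) powr (1 / \<gamma>)) powr \<gamma> = \<gamma> * y / \<sigma>" .
    moreover have "0 < (\<gamma> * y / \<sigma>) powr (1 / \<gamma>)" using 3 s by auto
    ultimately show ?thesis using real 3 s by (simp add: R_point_def R_radius_def)
  qed (use real s r in \<open>auto simp: R_point_def R_radius_def R_range_def zero_ereal_def\<close>)
qed (use r in \<open>auto simp: R_range_def R_point_def R_radius_def\<close>)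

lemma R_moment_radius:
  assumes s: "0 < \<sigma>" and r: "R_range \<gamma> r"
  shows "R_moment \<sigma> \<gamma> r = R_const \<sigma> \<gamma> * R_radius \<sigma> \<gamma> r"
proof (cases "r = -\<infinity> \<or> \<gamma> = 0")
  case False
  then obtain y where y: "r = ereal y" using r by (cases r) (auto simp: R_range_def)
  have "0 \<le> \<gamma> * y" using r y
    by (cases "\<gamma>" "0 :: real" rule: linorder_cases) (auto simp: R_range_def mult_nonpos_nonpos zero_ereal_def)
  then have "\<bar>y\<bar> = \<sigma> / \<bar>\<gamma>\<bar> * (\<gamma> * y / \<sigma>)" using s False
    by (cases "\<gamma> < 0") (auto simp: zero_le_mult_iff)
  then have "\<bar>y\<bar> powr (1 / \<gamma>) = (\<sigma> / \<bar>\<gamma>\<bar>) powr (1 / \<gamma>) * (\<gamma> * y / \<sigma>) powr (1 / \<gamma>)"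
    using s \<open>0 \<le> \<gamma> * y\<close> by (metis abs_ge_zero divide_nonneg_nonneg less_imp_le powr_mult)
  then show ?thesis using False y by (simp add: R_moment_def R_const_def R_radius_def)
qed (auto simp: R_moment_def R_const_def R_radius_def)

lemma R_radius_point:
  assumes s: "0 < \<sigma>" and z: "0 \<le> z"
  shows "R_radius \<sigma> \<gamma> (R_point \<sigma> \<gamma> z) = z"
proof (cases "z = 0 \<or> \<gamma> = 0")
  case False
  then show ?thesis using z s by (simp add: R_radius_def R_point_def powr_powr)
qed (use z s in \<open>auto simp: R_radius_def R_point_def zero_ereal_def\<close>)

text \<open>For \<open>t > 0\<close> and \<open>z > 0\<close> both sides say \<open>z \<tau>(x) \<le> t\<close>; the comparison is reduced to that of
  \<open>etail_inv (t / z)\<close> with \<open>x\<close>.\<close>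

lemma R_point_le_iff:
  assumes s: "0 < \<sigma> j" and t: "0 < t"
  shows "R_point (\<sigma> j) (\<gamma> j) z \<le> ereal (R_arg \<sigma> \<gamma> x t j) \<longleftrightarrow> below (\<gamma> j) (\<sigma> j) z (x j) t"
proof (cases "z \<le> 0")
  case True
  have "0 \<le> t powr \<gamma> j * (x j + \<sigma> j / \<gamma> j) \<longleftrightarrow> 0 \<le> \<sigma> j + \<gamma> j * x j" if "0 < \<gamma> j"
  proof -
    have "0 \<le> t powr \<gamma> j * (x j + \<sigma> j / \<gamma> j) \<longleftrightarrow> 0 \<le> x j + \<sigma> j / \<gamma> j" using t by (simp add: zero_le_mult_iff)
    also have "\<dots> \<longleftrightarrow> 0 \<le> \<sigma> j + \<gamma> j * x j" using that by (simp add: field_simps)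
    finally show ?thesis .
  qed
  then show ?thesis using True
    by (auto simp: R_point_def R_arg_def below_def zero_ereal_def)
next
  case False
  then have z: "0 < z" by simp
  have "R_point (\<sigma> j) (\<gamma> j) z \<le> ereal (R_arg \<sigma> \<gamma> x t j) \<longleftrightarrow> etail_inv (\<gamma> j) (\<sigma> j) (t / z) \<le> x j"
  proof (cases "\<gamma> j = 0")
    case True
    then show ?thesis using z t by (simp add: R_point_def R_arg_def etail_inv_def ln_div algebra_simps)
  next
    case False
    have "R_point (\<sigma> j) (\<gamma> j) z \<le> ereal (R_arg \<sigma> \<gamma> x t j) \<longleftrightarrow>
        \<sigma> j / \<gamma> j * z powr \<gamma> j \<le> t powr \<gamma> j * (x j + \<sigma> j / \<gamma> j)"
      using z False by (simp add: R_point_def R_arg_def)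
    also have "\<dots> \<longleftrightarrow> \<sigma> j / \<gamma> j * z powr \<gamma> j / t powr \<gamma> j \<le> x j + \<sigma> j / \<gamma> j"
    proof -
      have "0 < t powr \<gamma> j" using t by simp
      then show ?thesis by (simp only: pos_divide_le_eq mult.commute)
    qed
    also have "\<sigma> j / \<gamma> j * z powr \<gamma> j / t powr \<gamma> j = \<sigma> j / \<gamma> j * (t / z) powr (- \<gamma> j)"
    proof -
      have "(t / z) powr (- \<gamma> j) = z powr \<gamma> j / t powr \<gamma> j" using t z by (simp add: powr_minus powr_divide)
      then show ?thesis by simp
    qed
    also have "\<dots> \<le> x j + \<sigma> j / \<gamma> j \<longleftrightarrow> etail_inv (\<gamma> j) (\<sigma> j) (t / z) \<le> x j"
      using False by (simp add: etail_inv_def right_diff_distrib) linarith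
    finally show ?thesis .
  qed
  also have "\<dots> \<longleftrightarrow> below (\<gamma> j) (\<sigma> j) z (x j) t"
    using gp_point_le_iff[OF s t, of "\<gamma> j" z "x j"] z by (simp add: gp_point_def)
  finally show ?thesis .
qed

lemma U_point_le_iff:
  assumes s: "0 < \<sigma> j" and t: "0 < t" and x: "inside (\<gamma> j) (\<sigma> j) (x j)"
  shows "U_point z \<le> ereal (U_arg \<sigma> \<gamma> x t j) \<longleftrightarrow> below (\<gamma> j) (\<sigma> j) z (x j) t"
proof (cases "z \<le> 0")
  case True
  then show ?thesis using x by (auto simp: U_point_def below_def inside_def)
next
  case False
  then have z: "0 < z" by simp
  have e: "0 < etail (\<gamma> j) (\<sigma> j) (x j)" by (rule etail_pos[OF s x])
  have "0 < 1 + \<gamma> j * x j / \<sigma> j" using inside_scaled[OF s] x by blast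
  then have "U_arg \<sigma> \<gamma> x t j = ln t - ln (etail (\<gamma> j) (\<sigma> j) (x j))"
    using s by (auto simp: U_arg_def etail_def ln_powr add.commute)
  then have "U_point z \<le> ereal (U_arg \<sigma> \<gamma> x t j) \<longleftrightarrow> ln z + ln (etail (\<gamma> j) (\<sigma> j) (x j)) \<le> ln t"
    using False by (simp add: U_point_def) linarith
  also have "\<dots> \<longleftrightarrow> z * etail (\<gamma> j) (\<sigma> j) (x j) \<le> t"
    using z e t ln_mult[of z "etail (\<gamma> j) (\<sigma> j) (x j)"]
      ln_le_cancel_iff[of "z * etail (\<gamma> j) (\<sigma> j) (x j)" t] by simp
  finally show ?thesis using False inside_imp_above_end[OF x] by (simp add: below_def)
qed

lemma U_point_exp: "u < \<infinity> \<Longrightarrow> U_point (exp_ereal u) = u"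
  by (cases u) (auto simp: U_point_def exp_ereal_def)

lemma exp_U_point: "0 \<le> z \<Longrightarrow> exp_ereal (U_point z) = z"
  by (auto simp: U_point_def exp_ereal_def)

text \<open>The laws of all generators, and of those with maximum 1.\<close>

definition gp_laws :: "('n::finite \<Rightarrow> real) \<Rightarrow> ('n \<Rightarrow> real) \<Rightarrow> ('n \<Rightarrow> ereal) measure set" where
  "gp_laws \<sigma> \<gamma> = {gp_law \<sigma> \<gamma> M | M. generator M}"

definition gp_laws1 :: "('n::finite \<Rightarrow> real) \<Rightarrow> ('n \<Rightarrow> real) \<Rightarrow> ('n \<Rightarrow> ereal) measure set" where
  "gp_laws1 \<sigma> \<gamma> = {gp_law \<sigma> \<gamma> M | M. generator M \<and> (AE z in M. vmax z = 1)}"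

context
  fixes \<sigma> \<gamma> :: "'n::finite \<Rightarrow> real"
  assumes sigma: "\<And>j. 0 < \<sigma> j"
begin

lemma R_range_admissible:
  assumes "R_admissible \<sigma> \<gamma> \<rho>" shows "AE r in \<rho>. \<forall>j. R_range (\<gamma> j) (r j)"
proof -
  have "AE r in \<rho>. R_range (\<gamma> j) (r j)" for j
  proof -
    have 1: "AE r in \<rho>. 0 < \<gamma> j \<longrightarrow> 0 \<le> r j"
      using assms by (cases "0 < \<gamma> j") (auto simp: R_admissible_def)
    have 2: "AE r in \<rho>. \<gamma> j < 0 \<longrightarrow> r j < 0"
      using assms by (cases "\<gamma> j < 0") (auto simp: R_admissible_def)
    have 3: "AE r in \<rho>. r j < \<infinity>" using assms by (auto simp: R_admissible_def is_law_def elim: eventually_mono)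
    show ?thesis using 1 2 3 by eventually_elim (simp add: R_range_def)
  qed
  then show ?thesis by (simp add: AE_all_countable)
qed

lemma GP_R_in:
  assumes "R_admissible \<sigma> \<gamma> \<rho>" shows "GP_R \<sigma> \<gamma> \<rho> \<in> gp_laws \<sigma> \<gamma>"
proof -
  let ?f = "\<lambda>j. R_radius (\<sigma> j) (\<gamma> j)"
  have rho: "is_law \<rho>" using assms by (simp add: R_admissible_def)
  note range = R_range_admissible[OF assms]
  have [measurable]: "(\<lambda>r. ?f j (r j)) \<in> borel_measurable \<rho>" for j
    using law_component_measurable[OF rho] R_radius_measurable by (rule measurable_compose)
  have mom: "(\<integral>\<^sup>+r. ennreal (R_moment (\<sigma> j) (\<gamma> j) (r j)) \<partial>\<rho>) =
      ennreal (R_const (\<sigma> j) (\<gamma> j)) * (\<integral>\<^sup>+r. ennreal (?f j (r j)) \<partial>\<rho>)" for j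
  proof -
    have "(\<integral>\<^sup>+r. ennreal (R_moment (\<sigma> j) (\<gamma> j) (r j)) \<partial>\<rho>) = (\<integral>\<^sup>+r. ennreal (R_const (\<sigma> j) (\<gamma> j)) * ennreal (?f j (r j)) \<partial>\<rho>)"
      using range
      by (intro nn_integral_cong_AE) (auto simp: R_moment_radius[OF sigma]
        ennreal_mult[OF less_imp_le[OF R_const_pos[OF sigma]] R_radius_nonneg] elim!: eventually_mono)
    then show ?thesis by (simp add: nn_integral_cmult)
  qed
  have "generator (to_real ?f \<rho>)"
  proof (rule generator_to_real[OF rho R_radius_measurable R_radius_nonneg])
    fix j
    have "0 < (\<integral>\<^sup>+r. ennreal (R_moment (\<sigma> j) (\<gamma> j) (r j)) \<partial>\<rho>)" "(\<integral>\<^sup>+r. ennreal (R_moment (\<sigma> j) (\<gamma> j) (r j)) \<partial>\<rho>) < \<infinity>"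
      using assms by (auto simp: R_admissible_def)
    then show "0 < (\<integral>\<^sup>+r. ennreal (?f j (r j)) \<partial>\<rho>)" "(\<integral>\<^sup>+r. ennreal (?f j (r j)) \<partial>\<rho>) < \<infinity>"
      unfolding mom using R_const_pos[OF sigma, of j "\<gamma> j"] by (auto simp: ennreal_zero_less_mult_iff ennreal_mult_less_top)
  qed
  then interpret gen "to_real ?f \<rho>" \<sigma> \<gamma> by (intro gen.intro sigma)
  have "GP_R \<sigma> \<gamma> \<rho> = gp_law \<sigma> \<gamma> (to_real ?f \<rho>)"
  proof (rule GP_R_eq)
    fix x and t :: real assume t: "0 < t"
    show "joint_cdf \<rho> (R_arg \<sigma> \<gamma> x t) = measure (to_real ?f \<rho>) (down_set x t)"
      unfolding down_set_def
    proof (rule measure_to_real[OF rho R_radius_measurable below_pred])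
      show "AE y in \<rho>. \<forall>j. (y j \<le> ereal (R_arg \<sigma> \<gamma> x t j)) = below (\<gamma> j) (\<sigma> j) (R_radius (\<sigma> j) (\<gamma> j) (y j)) (x j) t"
        using range
      proof eventually_elim
        case (elim y)
        have "R_point (\<sigma> j) (\<gamma> j) z \<le> ereal (R_arg \<sigma> \<gamma> x t j) \<longleftrightarrow> below (\<gamma> j) (\<sigma> j) z (x j) t" for z j
          by (rule R_point_le_iff[of \<sigma> j t]) (use sigma t in auto)
        with elim show ?case using R_point_radius[OF sigma] by metis
      qed
    qed
  qed
  then show ?thesis using gen by (auto simp: gp_laws_def)
qed

text \<open>The map \<open>Z = exp U\<close>.\<close>

lemma U_in:
  assumes "U_admissible \<rho>"
  shows "generator (to_real (\<lambda>_. exp_ereal) \<rho>)"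
    and "0 < t \<Longrightarrow> (\<And>j. inside (\<gamma> j) (\<sigma> j) (x j)) \<Longrightarrow> joint_cdf \<rho> (U_arg \<sigma> \<gamma> x t) =
      measure (to_real (\<lambda>_. exp_ereal) \<rho>) {z. \<forall>j. below (\<gamma> j) (\<sigma> j) (z j) (x j) t}"
proof -
  have rho: "is_law \<rho>" using assms by (simp add: U_admissible_def)
  show "generator (to_real (\<lambda>_. exp_ereal) \<rho>)"
    using assms by (intro generator_to_real rho exp_ereal_measurable) (auto simp: U_admissible_def exp_ereal_def)
  have fin: "AE y in \<rho>. \<forall>j. y j < \<infinity>" using rho by (simp add: is_law_def)
  show "joint_cdf \<rho> (U_arg \<sigma> \<gamma> x t) = measure (to_real (\<lambda>_. exp_ereal) \<rho>) {z. \<forall>j. below (\<gamma> j) (\<sigma> j) (z j) (x j) t}"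
    if t: "0 < t" and x: "\<And>j. inside (\<gamma> j) (\<sigma> j) (x j)"
  proof (rule measure_to_real[OF rho exp_ereal_measurable below_pred])
    show "AE y in \<rho>. \<forall>j. (y j \<le> ereal (U_arg \<sigma> \<gamma> x t j)) = below (\<gamma> j) (\<sigma> j) (exp_ereal (y j)) (x j) t"
      using fin
    proof eventually_elim
      case (elim y)
      have "U_point z \<le> ereal (U_arg \<sigma> \<gamma> x t j) \<longleftrightarrow> below (\<gamma> j) (\<sigma> j) z (x j) t" for z j
        by (rule U_point_le_iff[of \<sigma> j t \<gamma> x]) (use sigma t x in auto)
      with elim show ?case using U_point_exp by metis
    qed
  qed
qed

lemma GP_U_in: assumes "U_admissible \<rho>" shows "GP_U \<sigma> \<gamma> \<rho> \<in> gp_laws \<sigma> \<gamma>"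
proof -
  interpret gen "to_real (\<lambda>_. exp_ereal) \<rho>" \<sigma> \<gamma> by (intro gen.intro sigma U_in(1)[OF assms])
  have "GP_U \<sigma> \<gamma> \<rho> = gp_law \<sigma> \<gamma> (to_real (\<lambda>_. exp_ereal) \<rho>)"
    by (rule GP_U_eq) (auto simp: down_set_def intro!: U_in(2)[OF assms])
  then show ?thesis using gen by (auto simp: gp_laws_def)
qed

lemma Max_ereal_eq_0_iff:
  "Max (range (s :: 'n \<Rightarrow> ereal)) = 0 \<longleftrightarrow> vmax (\<lambda>j. exp_ereal (s j)) = 1" if "\<forall>j. s j < \<infinity>"
proof -
  have le: "exp_ereal (s j) \<le> 1 \<longleftrightarrow> s j \<le> 0" "exp_ereal (s j) = 1 \<longleftrightarrow> s j = 0" for j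
    using that[rule_format, of j] by (cases "s j"; simp add: exp_ereal_def zero_ereal_def)+
  have "Max (range s) = 0 \<longleftrightarrow> 0 \<in> range s \<and> (\<forall>j. s j \<le> 0)"
    by (subst Max_eq_iff) auto
  also have "\<dots> \<longleftrightarrow> 1 \<in> range (\<lambda>j. exp_ereal (s j)) \<and> (\<forall>j. exp_ereal (s j) \<le> 1)"
    using le by (metis (mono_tags, lifting) rangeE rangeI)
  also have "\<dots> \<longleftrightarrow> vmax (\<lambda>j. exp_ereal (s j)) = 1"
    by (subst Max_eq_iff) auto
  finally show ?thesis .
qed

lemma GP_S_in: assumes "S_admissible \<rho>" shows "GP_S \<sigma> \<gamma> \<rho> \<in> gp_laws1 \<sigma> \<gamma>"
proof -
  have U: "U_admissible \<rho>" and mx: "AE s in \<rho>. Max (range s) = 0" using assms by (auto simp: S_admissible_def)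
  have rho: "is_law \<rho>" using U by (simp add: U_admissible_def)
  interpret gen "to_real (\<lambda>_. exp_ereal) \<rho>" \<sigma> \<gamma> by (intro gen.intro sigma U_in(1)[OF U])
  have fin: "AE y in \<rho>. \<forall>j. y j < \<infinity>" using rho by (simp add: is_law_def)
  have one: "AE z in to_real (\<lambda>_. exp_ereal) \<rho>. vmax z = 1"
    unfolding to_real_def
  proof (subst AE_distr_iff[OF to_real_measurable[OF rho exp_ereal_measurable]])
    show "{z \<in> space real_space. vmax z = 1} \<in> sets (real_space :: ('n \<Rightarrow> real) measure)" by measurable
    show "AE y in \<rho>. vmax (\<lambda>j. exp_ereal (y j)) = 1"
      using fin mx by eventually_elim (simp add: Max_ereal_eq_0_iff)
  qed
  have "GP_S \<sigma> \<gamma> \<rho> = gp_law \<sigma> \<gamma> (to_real (\<lambda>_. exp_ereal) \<rho>)"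
    by (rule GP_S_eq[OF _ one]) (auto simp: down_set_def intro!: U_in(2)[OF U])
  then show ?thesis using gen one by (auto simp: gp_laws1_def)
qed

lemma gp_law_R: assumes M: "generator M" shows "gp_law \<sigma> \<gamma> M \<in> GP_R_class \<sigma> \<gamma>"
proof -
  interpret gen M \<sigma> \<gamma> by (intro gen.intro sigma M)
  let ?f = "\<lambda>j. R_point (\<sigma> j) (\<gamma> j)"
  let ?\<rho> = "to_ereal ?f M"
  have fin: "?f j z < \<infinity>" for j z by (auto simp: R_point_def)
  have law: "is_law ?\<rho>" by (rule is_law_to_ereal[OF prob_space_axioms sets_M R_point_measurable fin])
  have mom: "(\<integral>\<^sup>+r. ennreal (R_moment (\<sigma> j) (\<gamma> j) (r j)) \<partial>?\<rho>) =
      ennreal (R_const (\<sigma> j) (\<gamma> j) * (\<integral>z. z j \<partial>M))" for j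
  proof -
    have "(\<integral>\<^sup>+r. ennreal (R_moment (\<sigma> j) (\<gamma> j) (r j)) \<partial>?\<rho>) = (\<integral>\<^sup>+z. ennreal (R_moment (\<sigma> j) (\<gamma> j) (?f j (z j))) \<partial>M)"
      by (rule nn_integral_to_ereal[OF sets_M R_point_measurable R_moment_measurable])
    also have "\<dots> = (\<integral>\<^sup>+z. ennreal (R_const (\<sigma> j) (\<gamma> j) * z j) \<partial>M)"
      using nonneg by (intro nn_integral_cong_AE)
        (auto simp: R_moment_radius[OF sigma R_point_range[OF sigma]] R_radius_point[OF sigma] elim!: eventually_mono)
    also have "\<dots> = ennreal (\<integral>z. R_const (\<sigma> j) (\<gamma> j) * z j \<partial>M)"
      using nonneg R_const_pos[OF sigma, of j "\<gamma> j"] integrable_comp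
      by (intro nn_integral_eq_integral) (auto elim!: eventually_mono)
    finally show ?thesis by simp
  qed
  have range: "AE r in ?\<rho>. R_range (\<gamma> j) (r j)" for j
  proof (subst AE_to_ereal[OF sets_M R_point_measurable])
    show "{y \<in> space ereal_space. R_range (\<gamma> j) (y j)} \<in> sets (ereal_space :: ('n \<Rightarrow> ereal) measure)"
      unfolding R_range_def by measurable
  qed (simp add: R_point_range[OF sigma])
  have "R_admissible \<sigma> \<gamma> ?\<rho>"
    unfolding R_admissible_def mom
    using law range R_const_pos[OF sigma] mean_pos
    by (auto simp: R_range_def elim!: eventually_mono)
  moreover have "GP_R \<sigma> \<gamma> ?\<rho> = gp_law \<sigma> \<gamma> M"
  proof (rule GP_R_eq)
    fix x and t :: real assume "0 < t"
    then have "R_point (\<sigma> j) (\<gamma> j) z \<le> ereal (R_arg \<sigma> \<gamma> x t j) \<longleftrightarrow> below (\<gamma> j) (\<sigma> j) z (x j) t" for z j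
      by (intro R_point_le_iff[of \<sigma> j t]) (use sigma in auto)
    then show "joint_cdf ?\<rho> (R_arg \<sigma> \<gamma> x t) = measure M (down_set x t)"
      by (simp add: joint_cdf_to_ereal[OF prob_space_axioms sets_M R_point_measurable fin] down_set_def)
  qed
  ultimately show ?thesis unfolding GP_R_class_def by (intro CollectI exI[of _ ?\<rho>]) simp
qed

text \<open>The map \<open>U = log Z\<close>.\<close>

lemma U_point_admissible:
  assumes M: "generator M"
  shows "U_admissible (to_ereal (\<lambda>_. U_point) M)"
    and "0 < t \<Longrightarrow> (\<And>j. inside (\<gamma> j) (\<sigma> j) (x j)) \<Longrightarrow> joint_cdf (to_ereal (\<lambda>_. U_point) M) (U_arg \<sigma> \<gamma> x t) =
      measure M {z. \<forall>j. below (\<gamma> j) (\<sigma> j) (z j) (x j) t}"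
proof -
  interpret gen M \<sigma> \<gamma> by (intro gen.intro sigma M)
  let ?\<rho> = "to_ereal (\<lambda>_. U_point) M"
  have fin: "U_point z < \<infinity>" for z by (simp add: U_point_def)
  have law: "is_law ?\<rho>" by (rule is_law_to_ereal[OF prob_space_axioms sets_M U_point_measurable fin])
  have mom: "(\<integral>\<^sup>+r. ennreal (exp_ereal (r j)) \<partial>?\<rho>) = ennreal (\<integral>z. z j \<partial>M)" for j
  proof -
    have "(\<integral>\<^sup>+r. ennreal (exp_ereal (r j)) \<partial>?\<rho>) = (\<integral>\<^sup>+z. ennreal (exp_ereal (U_point (z j))) \<partial>M)"
      by (rule nn_integral_to_ereal[OF sets_M U_point_measurable exp_ereal_measurable])
    also have "\<dots> = (\<integral>\<^sup>+z. ennreal (z j) \<partial>M)"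
      using nonneg by (intro nn_integral_cong_AE) (auto simp: exp_U_point elim!: eventually_mono)
    also have "\<dots> = ennreal (\<integral>z. z j \<partial>M)"
      using nonneg integrable_comp by (intro nn_integral_eq_integral) (auto elim!: eventually_mono)
    finally show ?thesis .
  qed
  show "U_admissible ?\<rho>" unfolding U_admissible_def mom using law mean_pos by auto
  show "joint_cdf ?\<rho> (U_arg \<sigma> \<gamma> x t) = measure M {z. \<forall>j. below (\<gamma> j) (\<sigma> j) (z j) (x j) t}"
    if "0 < t" "\<And>j. inside (\<gamma> j) (\<sigma> j) (x j)"
  proof -
    have "U_point z \<le> ereal (U_arg \<sigma> \<gamma> x t j) \<longleftrightarrow> below (\<gamma> j) (\<sigma> j) z (x j) t" for z j
      by (rule U_point_le_iff[of \<sigma> j t \<gamma> x]) (use sigma that in auto)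
    then show ?thesis by (simp add: joint_cdf_to_ereal[OF prob_space_axioms sets_M U_point_measurable fin])
  qed
qed

lemma gp_law_U: assumes M: "generator M" shows "gp_law \<sigma> \<gamma> M \<in> GP_U_class \<sigma> \<gamma>"
proof -
  interpret gen M \<sigma> \<gamma> by (intro gen.intro sigma M)
  have "GP_U \<sigma> \<gamma> (to_ereal (\<lambda>_. U_point) M) = gp_law \<sigma> \<gamma> M"
    by (rule GP_U_eq) (auto simp: down_set_def intro!: U_point_admissible(2)[OF M])
  then show ?thesis using U_point_admissible(1)[OF M] 
    unfolding GP_U_class_def by (intro CollectI exI[of _ "to_ereal (\<lambda>_. U_point) M"]) simp
qed

lemma gp_law_S: assumes M: "generator M" and one: "AE z in M. vmax z = 1" shows "gp_law \<sigma> \<gamma> M \<in> GP_S_class \<sigma> \<gamma>"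
proof -
  interpret gen M \<sigma> \<gamma> by (intro gen.intro sigma M)
  let ?\<rho> = "to_ereal (\<lambda>_. U_point) M"
  have "GP_S \<sigma> \<gamma> ?\<rho> = gp_law \<sigma> \<gamma> M"
    by (rule GP_S_eq[OF _ one]) (auto simp: down_set_def intro!: U_point_admissible(2)[OF M])
  moreover have "AE s in ?\<rho>. Max (range s) = 0"
  proof (subst AE_to_ereal[OF sets_M U_point_measurable])
    have "Max (range s) = 0 \<longleftrightarrow> (\<exists>j. s j = 0) \<and> (\<forall>j. s j \<le> 0)" for s :: "'n \<Rightarrow> ereal"
      by (subst Max_eq_iff) auto
    then have "{y \<in> space ereal_space. Max (range y) = 0} = {y \<in> space (ereal_space :: ('n \<Rightarrow> ereal) measure). (\<exists>j. y j = 0) \<and> (\<forall>j. y j \<le> 0)}"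
      by simp
    also have "\<dots> \<in> sets ereal_space" by measurable
    finally show "{y \<in> space (ereal_space :: ('n \<Rightarrow> ereal) measure). Max (range y) = 0} \<in> sets ereal_space" .
    show "AE z in M. Max (range (\<lambda>j. U_point (z j))) = 0"
      using one nonneg
    proof eventually_elim
      case (elim z)
      have e: "(\<lambda>j. exp_ereal (U_point (z j))) = z" using elim by (simp add: exp_U_point)
      have "\<forall>j. U_point (z j) < \<infinity>" by (simp add: U_point_def)
      from Max_ereal_eq_0_iff[OF this] show ?case unfolding e using elim(1) by blast
    qed
  qed
  ultimately show ?thesis using U_point_admissible(1)[OF M] 
    unfolding GP_S_class_def by (intro CollectI exI[of _ ?\<rho>]) (simp add: S_admissible_def)
qed

lemma R_class_eq: "GP_R_class \<sigma> \<gamma> = gp_laws \<sigma> \<gamma>"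
  using GP_R_in gp_law_R by (auto simp: GP_R_class_def gp_laws_def)

lemma U_class_eq: "GP_U_class \<sigma> \<gamma> = gp_laws \<sigma> \<gamma>"
  using GP_U_in gp_law_U by (auto simp: GP_U_class_def gp_laws_def)

lemma S_class_eq: "GP_S_class \<sigma> \<gamma> = gp_laws1 \<sigma> \<gamma>"
  using GP_S_in gp_law_S by (auto simp: GP_S_class_def gp_laws1_def)

end

context gen
begin

text \<open>As \<open>etail x \<le> 1\<close> for \<open>x \<ge> 0\<close>, the event \<open>X\<^sub>j > x\<close> is \<open>{0 < s < z\<^sub>j etail x}\<close>; the bound by \<open>max\<^sub>i z\<^sub>i\<close>
  is then automatic.\<close>

lemma gp_law_exceed:
  assumes x: "0 \<le> x" "inside (\<gamma> j) (\<sigma> j) x"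
  shows "measure (gp_law \<sigma> \<gamma> M) {y. ereal x < y j} = (\<integral>z. z j \<partial>M) * etail (\<gamma> j) (\<sigma> j) x / V1"
proof -
  let ?e = "etail (\<gamma> j) (\<sigma> j) x"
  have e: "0 < ?e" "?e \<le> 1"
    using etail_pos[OF sigma_pos x(2)] etail_antimono[OF sigma_pos[of j] _ x(1), of "\<gamma> j"] sigma_pos[of j]
    by (auto simp: above_end_def)
  have "{y \<in> space ereal_space. ereal x < y j} \<in> sets (ereal_space :: ('n \<Rightarrow> ereal) measure)" by measurable
  then have A: "{y. ereal x < y j} \<in> sets (ereal_space :: ('n \<Rightarrow> ereal) measure)" by (simp add: space_PiM)
  let ?B = "{(z :: 'n \<Rightarrow> real, s). (z, s) \<in> gp_region \<and> (\<lambda>j. gp_point (\<gamma> j) (\<sigma> j) (z j) s) \<in> {y. ereal x < y j}}"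
  have B: "?B \<in> sets (M \<Otimes>\<^sub>M lborel)"
  proof -
    have "?B = gp_region \<inter> ((\<lambda>(z, s) j. gp_point (\<gamma> j) (\<sigma> j) (z j) s) -` {y. ereal x < y j} \<inter> space (M \<Otimes>\<^sub>M lborel))"
      by (auto simp: space_pair_measure)
    then show ?thesis using sets.Int[OF gp_region_sets measurable_sets[OF gp_point_measurable A]] by (simp only:)
  qed
  have iff: "ereal x < gp_point (\<gamma> j) (\<sigma> j) z s \<longleftrightarrow> s < z * ?e" if "0 \<le> z" "0 < s" for z s
    using gp_point_le_iff[OF sigma_pos[of j] that(2), of "\<gamma> j" z x] inside_imp_above_end[OF x(2)] that x(2)
    by (auto simp: below_def inside_def not_le[symmetric])
  have "emeasure (M \<Otimes>\<^sub>M lborel) ?B = ennreal ((\<integral>z. z j * ?e \<partial>M) - (\<integral>z. 0 \<partial>M))"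
  proof (rule emeasure_region_sub[OF _ B])
    show "AE z in M. 0 \<le> (0::real) \<and> 0 \<le> z j * ?e \<and> (\<forall>s. (z, s) \<in> ?B \<longrightarrow> 0 \<le> s \<and> s \<le> z j * ?e) \<and>
        (\<forall>s. 0 < s \<and> s < z j * ?e \<longrightarrow> (z, s) \<in> ?B)"
      using nonneg
    proof eventually_elim
      case (elim z)
      have "z j * ?e \<le> vmax z" using elim e vmax_ge[of z j] by (meson mult_left_le order_trans)
      then have "(z, s) \<in> ?B \<longleftrightarrow> 0 < s \<and> s < z j * ?e" for s
        using iff[of "z j" s] elim by (auto simp: gp_region_def simp del: Max_gr_iff)
      then show ?case using elim e by auto
    qed
  qed (use integrable_comp in auto)
  then have "measure (M \<Otimes>\<^sub>M lborel) ?B = (\<integral>z. z j \<partial>M) * ?e"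
    using mean_pos[of j] e by (simp add: measure_def)
  then show ?thesis using measure_gp_law[OF A] by simp
qed

lemma gp_law_margin:
  shows "0 < \<P>(y in gp_law \<sigma> \<gamma> M. 0 < y j)"
    and "0 \<le> x \<Longrightarrow> 0 < \<sigma> j + \<gamma> j * x \<Longrightarrow>
      \<P>(y in gp_law \<sigma> \<gamma> M. y j \<le> ereal x \<bar> 0 < y j) = 1 - gp_tail (\<gamma> j) (x / \<sigma> j)"
proof -
  let ?\<mu> = "gp_law \<sigma> \<gamma> M"
  interpret L: prob_space ?\<mu> by (rule gp_law_prob)
  have sp: "space ?\<mu> = UNIV" by (rule space_law[OF gp_law_is_law])
  have m: "{y. ereal a < y j} \<in> sets ?\<mu>" for a
  proof -
    note [measurable] = law_component_measurable[OF gp_law_is_law]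
    have "{y \<in> space ?\<mu>. ereal a < y j} \<in> sets ?\<mu>" by measurable
    then show ?thesis by (simp add: sp)
  qed
  have i0: "inside (\<gamma> j) (\<sigma> j) 0" using sigma_pos[of j] by (simp add: inside_def)
  have p0: "measure ?\<mu> {y. 0 < y j} = (\<integral>z. z j \<partial>M) / V1"
    using gp_law_exceed[OF order_refl i0] sigma_pos[of j] by (simp add: zero_ereal_def)
  then show pos: "0 < \<P>(y in ?\<mu>. 0 < y j)" using mean_pos[of j] V1_pos by (simp add: sp)
  assume x: "0 \<le> x" "0 < \<sigma> j + \<gamma> j * x"
  then have i: "inside (\<gamma> j) (\<sigma> j) x" by (simp add: inside_def)
  have "{y. y j \<le> ereal x \<and> 0 < y j} = {y. ereal 0 < y j} - {y. ereal x < y j}"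
    by (auto simp: zero_ereal_def)
  then have "measure ?\<mu> {y. y j \<le> ereal x \<and> 0 < y j} = measure ?\<mu> {y. ereal 0 < y j} - measure ?\<mu> {y. ereal x < y j}"
    using L.finite_measure_Diff[OF m m, of x 0] x(1)
    by (simp add: subset_eq) (metis ereal_less_eq(3) le_less_trans)
  also have "\<dots> = (\<integral>z. z j \<partial>M) / V1 * (1 - etail (\<gamma> j) (\<sigma> j) x)"
    using p0 gp_law_exceed[OF x(1) i] by (simp add: zero_ereal_def right_diff_distrib diff_divide_distrib)
  finally show "\<P>(y in ?\<mu>. y j \<le> ereal x \<bar> 0 < y j) = 1 - gp_tail (\<gamma> j) (x / \<sigma> j)"
    using p0 mean_pos[of j] V1_pos by (simp add: cond_prob_def sp etail_eq_gp_tail[OF sigma_pos i])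
qed

end

section \<open>A max-stable random vector from Poisson points\<close>

text \<open>A Poisson number \<open>N\<close> with mean 1 and an independent i.i.d. sequence; only the first \<open>N\<close> terms of
  the sequence count as points.\<close>

definition poisson_points :: "'b measure \<Rightarrow> (nat \<times> (nat \<Rightarrow> 'b)) measure" where
  "poisson_points B = measure_pmf (poisson_pmf 1) \<Otimes>\<^sub>M Pi\<^sub>M UNIV (\<lambda>_. B)"

lemma prob_space_poisson_points: "prob_space B \<Longrightarrow> prob_space (poisson_points B)"
  unfolding poisson_points_def
  by (intro prob_space_pair measure_pmf.prob_space_axioms prob_space_PiM)

lemma poisson_points_component [measurable]:
  "(\<lambda>p. snd p k) \<in> poisson_points B \<rightarrow>\<^sub>M B" "fst \<in> poisson_points B \<rightarrow>\<^sub>M count_space UNIV"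
proof -
  show "(\<lambda>p. snd p k) \<in> poisson_points B \<rightarrow>\<^sub>M B"
    unfolding poisson_points_def by (rule measurable_compose[OF measurable_snd]) simp
  have "fst \<in> poisson_points B \<rightarrow>\<^sub>M measure_pmf (poisson_pmf 1)"
    unfolding poisson_points_def by simp
  then show "fst \<in> poisson_points B \<rightarrow>\<^sub>M count_space UNIV" by (simp cong: measurable_cong_sets)
qed

text \<open>All counted points lie in \<open>A\<close>.\<close>

definition all_points :: "'b measure \<Rightarrow> 'b set \<Rightarrow> (nat \<times> (nat \<Rightarrow> 'b)) set" where
  "all_points B A = {p \<in> space (poisson_points B). \<forall>k. k < fst p \<longrightarrow> snd p k \<in> A}"

lemma all_points_sets:
  assumes [measurable]: "A \<in> sets B" shows "all_points B A \<in> sets (poisson_points B)"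
  unfolding all_points_def by measurable

text \<open>The probability generating function of the Poisson distribution.\<close>

lemma measure_all_points:
  assumes B: "prob_space B" and A: "A \<in> sets B"
  shows "measure (poisson_points B) (all_points B A) = exp (measure B A - 1)"
proof -
  interpret B: prob_space B by fact
  interpret S: product_prob_space "\<lambda>_::nat. B" UNIV by (rule product_prob_spaceI) fact
  let ?p = "measure B A"
  have slice: "emeasure (PiM UNIV (\<lambda>_::nat. B)) (Pair N -` all_points B A) = ennreal (?p ^ N)" for N
  proof -
    have "Pair N -` all_points B A = {w \<in> space (PiM UNIV (\<lambda>_::nat. B)). \<forall>k\<in>{..<N}. w k \<in> A}"
      by (auto simp: all_points_def poisson_points_def space_pair_measure)
    then have "emeasure (PiM UNIV (\<lambda>_::nat. B)) (Pair N -` all_points B A) = (\<Prod>k<N. emeasure B A)"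
      using S.emeasure_PiM_Collect[of "{..<N}" "\<lambda>_. A"] A by simp
    then show ?thesis by (simp add: B.emeasure_eq_measure ennreal_power)
  qed
  have "emeasure (poisson_points B) (all_points B A) = (\<integral>\<^sup>+N. ennreal (?p ^ N) \<partial>measure_pmf (poisson_pmf 1))"
    using all_points_sets[OF A] unfolding poisson_points_def
    by (subst S.emeasure_pair_measure_alt) (auto simp: slice)
  also have "\<dots> = (\<Sum>N. ennreal (?p ^ N / fact N * exp (-1)))"
    unfolding nn_integral_measure_pmf nn_integral_count_space_nat
    by (intro suminf_cong) (simp add: ennreal_mult''[symmetric] mult_ac)
  also have "\<dots> = ennreal (\<Sum>N. ?p ^ N / fact N * exp (-1))"
  proof (rule suminf_ennreal2)
    show "summable (\<lambda>N. ?p ^ N / fact N * exp (-1))"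
      using summable_exp[of ?p] by (intro summable_mult2) (simp add: divide_inverse mult.commute)
  qed simp
  also have "(\<Sum>N. ?p ^ N / fact N * exp (-1)) = exp ?p * exp (-1)"
    using exp_converges[of ?p] by (intro sums_unique[symmetric] sums_mult2) (simp add: divide_inverse mult.commute)
  finally show ?thesis by (simp add: measure_def exp_add[symmetric])
qed

lemma measure_all_points_sequence:
  assumes B: "prob_space B" and A: "\<And>n. A n \<in> sets B"
    and lim: "(\<lambda>N. \<Sum>n\<le>N. 1 - measure B (A n)) \<longlonglongrightarrow> D"
  shows "measure (PiM UNIV (\<lambda>_::nat. poisson_points B)) (Pi UNIV (\<lambda>n. all_points B (A n))) = exp (- D)"
proof -
  interpret P: prob_space "poisson_points B" by (rule prob_space_poisson_points[OF B])
  interpret S: sequence_space "poisson_points B" ..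
  have "(\<Prod>n\<le>N. measure (poisson_points B) (all_points B (A n))) = exp (- (\<Sum>n\<le>N. 1 - measure B (A n)))" for N
    by (simp add: measure_all_points[OF B A] exp_sum sum_negf[symmetric])
  moreover have "(\<lambda>N. exp (- (\<Sum>n\<le>N. 1 - measure B (A n)))) \<longlonglongrightarrow> exp (- D)"
    by (intro tendsto_intros lim)
  ultimately show ?thesis
    using S.measure_PiM_countable[of "\<lambda>n. all_points B (A n)"] all_points_sets[OF A]
    by (simp add: LIMSEQ_unique)
qed

context gen
begin

text \<open>A mark \<open>Z\<close> together with the position \<open>t\<close> of its time \<open>n + t\<close> in the interval \<open>[n, n + 1]\<close>.\<close>

definition base :: "(('n \<Rightarrow> real) \<times> real) measure" where
  "base = M \<Otimes>\<^sub>M uniform_measure lborel {0..1}"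

lemma prob_unif: "prob_space (uniform_measure lborel {0..1::real})"
  by (rule prob_space_uniform_measure) auto

lemma prob_base: "prob_space base"
  unfolding base_def by (intro prob_space_pair prob_unif prob_space_axioms)

lemma space_base: "space base = UNIV" by (simp add: base_def space_pair_measure)

lemma base_component [measurable]: "(\<lambda>b. fst b j) \<in> borel_measurable base" "snd \<in> borel_measurable base"
proof -
  show "(\<lambda>b. fst b j) \<in> borel_measurable base"
    unfolding base_def by (rule measurable_compose[OF measurable_fst]) measurable
  have "snd \<in> base \<rightarrow>\<^sub>M uniform_measure lborel {0..1}" unfolding base_def by simp
  then show "snd \<in> borel_measurable base" by (simp cong: measurable_cong_sets)
qed

text \<open>The marked point at time \<open>n + t\<close> does not exceed \<open>1/u\<close>.\<close>

definition good :: "('n \<Rightarrow> real) \<Rightarrow> nat \<Rightarrow> (('n \<Rightarrow> real) \<times> real) set" where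
  "good u n = {b. \<forall>j. fst b j / (real n + snd b) * u j \<le> 1}"

lemma good_sets: "good u n \<in> sets base"
proof -
  have "{b \<in> space base. \<forall>j. fst b j / (real n + snd b) * u j \<le> 1} \<in> sets base" by measurable
  then show ?thesis by (simp add: good_def space_base)
qed

text \<open>The integrand is the length of the part of \<open>[n, n + 1]\<close> below \<open>max\<^sub>j (z\<^sub>j u\<^sub>j)\<close>, so these terms
  telescope in \<open>n\<close>.\<close>

lemma measure_good:
  assumes u: "\<And>j. 0 \<le> u j"
  shows "1 - measure base (good u n) =
    (\<integral>z. min (vmax (\<lambda>j. z j * u j)) (real (Suc n)) - min (vmax (\<lambda>j. z j * u j)) (real n) \<partial>M)"
proof -
  interpret U: prob_space "uniform_measure lborel {0..1::real}" by (rule prob_unif)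
  interpret base: prob_space base by (rule prob_base)
  let ?v = "\<lambda>z. vmax (\<lambda>j. z j * u j)"
  let ?h = "\<lambda>z. min (?v z) (real (Suc n)) - min (?v z) (real n)"
  have h: "0 \<le> ?h z" "?h z \<le> 1" for z
  proof -
    have "0 \<le> min v (real (Suc n)) - min v (real n)" "min v (real (Suc n)) - min v (real n) \<le> 1" for v
      by (auto simp: min_def)
    then show "0 \<le> ?h z" "?h z \<le> 1" by blast+
  qed
  have ih: "integrable M ?h" using integrable_vmax[OF u] by (intro Bochner_Integration.integrable_diff integrable_min) auto
  have "emeasure base (good u n) = (\<integral>\<^sup>+z. emeasure (uniform_measure lborel {0..1}) (Pair z -` good u n) \<partial>M)"
    using good_sets unfolding base_def by (rule U.emeasure_pair_measure_alt)
  also have "\<dots> = (\<integral>\<^sup>+z. ennreal (1 - ?h z) \<partial>M)"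
  proof (rule nn_integral_cong_AE)
    show "AE z in M. emeasure (uniform_measure lborel {0..1}) (Pair z -` good u n) = ennreal (1 - ?h z)"
      using nonneg
    proof eventually_elim
      case (elim z)
      have m: "Pair z -` good u n \<in> sets lborel"
        using sets_Pair1[OF good_sets[of u n, unfolded base_def], of z] by simp
      have v: "0 \<le> ?v z" by (rule vmax_nonneg) (use elim u in auto)
      have iff: "t \<in> Pair z -` good u n \<longleftrightarrow> ?v z \<le> real n + t" if "0 < t" for t
      proof -
        have "0 < real n + t" using that by simp
        then show ?thesis unfolding vmax_le_iff by (simp add: good_def field_simps)
      qed
      define l where "l = min 1 (max 0 (?v z - real n))"
      have "min v (real (Suc n)) - min v (real n) = min 1 (max 0 (v - real n))" if "0 \<le> v" for v
        using that by (auto simp: min_def max_def)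
      from this[OF v] have l: "?h z = l" "0 \<le> l" "l \<le> 1" by (auto simp: l_def)
      have mem: "t \<in> Pair z -` good u n \<longleftrightarrow> l \<le> t" if "0 < t" "t < 1" for t
        unfolding iff[OF that(1)] using that by (auto simp: l_def simp del: Max_le_iff Max_less_iff Max_ge_iff Max_gr_iff)
      define S where "S = Pair z -` good u n"
      note mS = m[folded S_def] and memS = mem[folded S_def]
      have "{l<..<1} \<subseteq> {0..1} \<inter> S" using l memS by auto
      moreover have "{0..1} \<inter> S \<subseteq> {l..1} \<union> {0, 1}"
      proof
        fix t assume "t \<in> {0..1} \<inter> S"
        then show "t \<in> {l..1} \<union> {0, 1}" using memS[of t] by (cases "t = 0 \<or> t = 1") auto
      qed
      ultimately have "emeasure lborel {l<..<1} \<le> emeasure lborel ({0..1} \<inter> S)"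
        "emeasure lborel ({0..1} \<inter> S) \<le> emeasure lborel ({l..1} \<union> {0, 1})"
        using mS by (auto intro!: emeasure_mono simp del: Un_insert_right)
      moreover have "emeasure lborel ({l..1} \<union> {0, 1}) = emeasure lborel {l..1}"
        by (intro emeasure_Un_null_set countable_imp_null_set_lborel) auto
      ultimately have "emeasure lborel ({0..1} \<inter> S) = ennreal (1 - l)"
        using l by (simp del: Un_insert_right)
      then show ?case using mS l(1) by (simp add: divide_ennreal_def S_def[symmetric])
    qed
  qed
  also have "\<dots> = ennreal (\<integral>z. 1 - ?h z \<partial>M)"
    using ih h by (intro nn_integral_eq_integral) auto
  finally have "measure base (good u n) = (\<integral>z. 1 - ?h z \<partial>M)"
    using h(2) by (simp add: measure_def integral_nonneg)
  also have "\<dots> = 1 - (\<integral>z. ?h z \<partial>M)" using ih prob_space by (subst Bochner_Integration.integral_diff) auto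
  finally show ?thesis by simp
qed

lemma sum_measure_good:
  assumes u: "\<And>j. 0 \<le> u j"
  shows "(\<lambda>N. \<Sum>n\<le>N. 1 - measure base (good u n)) \<longlonglongrightarrow> D_norm M u"
proof -
  let ?v = "\<lambda>z. vmax (\<lambda>j. z j * u j)"
  have iv: "integrable M ?v" by (rule integrable_vmax[OF u])
  have im: "integrable M (\<lambda>z. min (?v z) (real n))" for n using iv by (intro integrable_min) auto
  have nn: "AE z in M. 0 \<le> ?v z"
    using nonneg by eventually_elim (use u in \<open>auto intro!: vmax_nonneg\<close>)
  have "(\<Sum>n\<le>N. 1 - measure base (good u n)) = (\<integral>z. min (?v z) (real (Suc N)) \<partial>M)" for N
  proof -
    have "(\<Sum>n\<le>N. 1 - measure base (good u n)) = (\<Sum>n\<le>N. (\<integral>z. min (?v z) (real (Suc n)) \<partial>M) - (\<integral>z. min (?v z) (real n) \<partial>M))"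
      unfolding measure_good[OF u] using im by (intro sum.cong refl Bochner_Integration.integral_diff)
    also have "\<dots> = (\<integral>z. min (?v z) (real (Suc N)) \<partial>M) - (\<integral>z. min (?v z) (real 0) \<partial>M)"
      by (induction N) auto
    also have "(\<integral>z. min (?v z) (real 0) \<partial>M) = (\<integral>z. 0 \<partial>M)"
      using nn by (intro integral_cong_AE) (auto simp: min_absorb2 simp del: Max_ge_iff Max_le_iff elim!: eventually_mono)
    finally show ?thesis by simp
  qed
  moreover have "(\<lambda>N. \<integral>z. min (?v z) (real (Suc N)) \<partial>M) \<longlonglongrightarrow> (\<integral>z. ?v z \<partial>M)"
  proof (rule integral_dominated_convergence[OF _ _ iv])
    show "AE z in M. (\<lambda>N. min (?v z) (real (Suc N))) \<longlonglongrightarrow> ?v z"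
    proof (rule AE_I2)
      fix z
      obtain N0 where "?v z \<le> real N0" using real_arch_simple by blast
      then have "\<forall>\<^sub>F N in sequentially. min (?v z) (real (Suc N)) = ?v z"
        unfolding eventually_sequentially by (intro exI[of _ N0]) (auto simp: min_def simp del: Max_le_iff)
      then show "(\<lambda>N. min (?v z) (real (Suc N))) \<longlonglongrightarrow> ?v z" by (rule tendsto_eventually)
    qed
    show "AE z in M. norm (min (?v z) (real (Suc N))) \<le> ?v z" for N
      using nn by eventually_elim auto
  qed auto
  ultimately show ?thesis by (simp add: D_norm_def)
qed

text \<open>Independent Poisson samples, one for each interval \<open>[n, n + 1]\<close>.\<close>

definition point_space :: "(nat \<Rightarrow> nat \<times> (nat \<Rightarrow> ('n \<Rightarrow> real) \<times> real)) measure" where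
  "point_space = PiM UNIV (\<lambda>_. poisson_points base)"

text \<open>The value \<open>Z / T\<close> of the \<open>k\<close>-th point of the \<open>n\<close>-th sample, and \<open>0\<close> for an index that is not
  counted.\<close>

definition point_value :: "(nat \<Rightarrow> nat \<times> (nat \<Rightarrow> ('n \<Rightarrow> real) \<times> real)) \<Rightarrow> nat \<times> nat \<Rightarrow> 'n \<Rightarrow> ereal" where
  "point_value \<omega> = (\<lambda>(n, k) j. if k < fst (\<omega> n) then ereal (fst (snd (\<omega> n) k) j / (real n + snd (snd (\<omega> n) k))) else 0)"

text \<open>The componentwise supremum, taken in the extended reals because it is finite only almost surely.\<close>

definition frechet :: "(nat \<Rightarrow> nat \<times> (nat \<Rightarrow> ('n \<Rightarrow> real) \<times> real)) \<Rightarrow> 'n \<Rightarrow> ereal" where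
  "frechet \<omega> j = (SUP nk. point_value \<omega> nk j)"

lemma point_value_measurable [measurable]: "(\<lambda>\<omega>. point_value \<omega> nk j) \<in> borel_measurable point_space"
proof -
  obtain n k where nk: "nk = (n, k)" by fastforce
  have c: "(\<lambda>\<omega>. \<omega> n) \<in> point_space \<rightarrow>\<^sub>M poisson_points base" unfolding point_space_def by simp
  have [measurable]: "(\<lambda>\<omega>. fst (\<omega> n)) \<in> point_space \<rightarrow>\<^sub>M count_space UNIV"
    by (rule measurable_compose[OF c poisson_points_component(2)])
  have b: "(\<lambda>\<omega>. snd (\<omega> n) k) \<in> point_space \<rightarrow>\<^sub>M base"
    by (rule measurable_compose[OF c poisson_points_component(1)])
  have [measurable]: "(\<lambda>\<omega>. fst (snd (\<omega> n) k) j) \<in> borel_measurable point_space"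
    "(\<lambda>\<omega>. snd (snd (\<omega> n) k)) \<in> borel_measurable point_space"
    using measurable_compose[OF b base_component(1)] measurable_compose[OF b base_component(2)] by simp_all
  show ?thesis unfolding nk point_value_def prod.case by measurable
qed

lemma frechet_measurable [measurable]: "(\<lambda>\<omega>. frechet \<omega> j) \<in> borel_measurable point_space"
  unfolding frechet_def by measurable

lemma prob_point_space: "prob_space point_space"
  unfolding point_space_def by (intro prob_space_PiM prob_space_poisson_points prob_base)

lemma measure_frechet:
  assumes u: "\<And>j. 0 \<le> u j"
  shows "measure point_space {\<omega> \<in> space point_space. \<forall>j. \<forall>nk. point_value \<omega> nk j * ereal (u j) \<le> 1} = exp (- D_norm M u)"
proof -
  have "{\<omega> \<in> space point_space. \<forall>j. \<forall>nk. point_value \<omega> nk j * ereal (u j) \<le> 1} =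
      Pi UNIV (\<lambda>n. all_points base (good u n))"
  proof -
    have "(\<forall>j. \<forall>nk. point_value \<omega> nk j * ereal (u j) \<le> 1) \<longleftrightarrow> (\<forall>n k. k < fst (\<omega> n) \<longrightarrow> snd (\<omega> n) k \<in> good u n)" for \<omega>
    proof -
      have "(\<forall>j. point_value \<omega> (n, k) j * ereal (u j) \<le> 1) \<longleftrightarrow> (k < fst (\<omega> n) \<longrightarrow> snd (\<omega> n) k \<in> good u n)" for n k
        by (simp add: point_value_def good_def one_ereal_def zero_ereal_def)
      then show ?thesis unfolding split_paired_All by blast
    qed
    then show ?thesis
      by (auto simp: point_space_def space_PiM all_points_def Pi_iff PiE_iff)
  qed
  then show ?thesis
    using measure_all_points_sequence[OF prob_base good_sets sum_measure_good[OF u]]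
    by (simp add: point_space_def)
qed

lemma frechet_nonneg: "0 \<le> frechet \<omega> j"
  unfolding frechet_def
  by (rule SUP_upper2[of "(0, fst (\<omega> 0))"]) (auto simp: point_value_def)

lemma frechet_le_iff:
  assumes "0 \<le> u" "frechet \<omega> j < \<infinity>"
  shows "real_of_ereal (frechet \<omega> j) * u \<le> 1 \<longleftrightarrow> (\<forall>nk. point_value \<omega> nk j * ereal u \<le> 1)"
proof (cases "u = 0")
  case False
  then have u: "0 < u" using assms by simp
  have pv: "point_value \<omega> nk j * ereal u \<le> 1 \<longleftrightarrow> point_value \<omega> nk j \<le> ereal (1 / u)" for nk
    using u by (cases nk) (auto simp: point_value_def one_ereal_def field_simps)
  obtain r where r: "frechet \<omega> j = ereal r" using assms(2) frechet_nonneg[of \<omega> j] by (cases "frechet \<omega> j") auto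
  have "real_of_ereal (frechet \<omega> j) * u \<le> 1 \<longleftrightarrow> frechet \<omega> j \<le> ereal (1 / u)"
    using u r by (simp add: field_simps)
  then show ?thesis unfolding pv frechet_def by (simp add: SUP_le_iff)
qed (simp add: zero_ereal_def[symmetric])

text \<open>The max-stable law with unit shape whose exponent function is the given D-norm. Both finiteness
  and positivity of the components follow from the formula, for \<open>u\<close> tending to \<open>0\<close> and to \<open>\<infinity>\<close>.\<close>

lemma frechet_exists:
  obtains N :: "('n \<Rightarrow> real) measure" where "prob_space N" "sets N = sets real_space"
    "AE y in N. \<forall>j. 0 < y j"
    "\<And>u. (\<And>j. 0 \<le> u j) \<Longrightarrow> measure N {y. \<forall>j. y j * u j \<le> 1} = exp (- D_norm M u)"
proof -
  interpret O: prob_space point_space by (rule prob_point_space)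
  let ?ev = "\<lambda>u. {\<omega> \<in> space point_space. \<forall>j. \<forall>nk. point_value \<omega> nk j * ereal (u j) \<le> 1}"
  have ev: "?ev u \<in> sets point_space" for u by measurable
  define Y where "Y \<omega> = (\<lambda>j. real_of_ereal (frechet \<omega> j))" for \<omega>
  have Y: "Y \<in> point_space \<rightarrow>\<^sub>M real_space"
    unfolding Y_def by (intro measurable_PiM_single') (auto simp: space_PiM)
  have fin: "AE \<omega> in point_space. \<forall>j. frechet \<omega> j < \<infinity>"
  proof -
    define F where "F m = ?ev (\<lambda>_. 1 / real (Suc m))" for m :: nat
    have Fs: "F m \<in> sets point_space" for m unfolding F_def by (rule ev)
    then have UF: "(\<Union>m. F m) \<in> sets point_space" by (intro sets.countable_UN) auto
    have "measure point_space (\<Union>m. F m) = 1"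
    proof (rule antisym)
      have "exp (- (1 / real (Suc m) * V1)) \<le> measure point_space (\<Union>m. F m)" for m
      proof -
        have "exp (- (1 / real (Suc m) * V1)) = measure point_space (F m)"
          using measure_frechet[of "\<lambda>_. 1 / real (Suc m)"] D_norm_cmult[of "1 / real (Suc m)" "\<lambda>_. 1"]
          by (simp add: F_def)
        also have "\<dots> \<le> measure point_space (\<Union>m. F m)"
          using UF by (intro O.finite_measure_mono) auto
        finally show ?thesis .
      qed
      moreover have "(\<lambda>m. exp (- (1 / real (Suc m) * V1))) \<longlonglongrightarrow> exp (- (0 * V1))"
        by (intro tendsto_intros LIMSEQ_inverse_real_of_nat[unfolded inverse_eq_divide])
      ultimately show "1 \<le> measure point_space (\<Union>m. F m)"
        by (intro LIMSEQ_le_const2[of _ 1]) auto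
    qed simp
    then have "AE \<omega> in point_space. \<omega> \<in> (\<Union>m. F m)" using UF O.prob_eq_1 by blast
    then show ?thesis
    proof eventually_elim
      case (elim \<omega>)
      then obtain m where m: "\<And>j nk. point_value \<omega> nk j * ereal (1 / real (Suc m)) \<le> 1" unfolding F_def by blast
      have "point_value \<omega> nk j \<le> ereal (real (Suc m))" for nk j
      proof -
        have "a \<le> real (Suc m)" if "a * (1 / real (Suc m)) \<le> 1" for a
          using that by (simp add: pos_divide_le_eq)
        moreover obtain v where "point_value \<omega> nk j = ereal v"
          by (cases "snd nk < fst (\<omega> (fst nk))") (auto simp: point_value_def zero_ereal_def case_prod_beta)
        ultimately show ?thesis using m[of nk j] by (simp add: one_ereal_def del: of_nat_Suc)
      qed
      then have "frechet \<omega> j \<le> ereal (real (Suc m))" for j unfolding frechet_def by (intro SUP_least)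
      then have "frechet \<omega> j < \<infinity>" for j by (rule le_less_trans) simp
      then show ?case by blast
    qed
  qed
  define N where "N = distr point_space real_space Y"
  have pN: "prob_space N" unfolding N_def by (rule O.prob_space_distr[OF Y])
  interpret N: prob_space N by (rule pN)
  have spN: "space N = UNIV" by (simp add: N_def space_PiM)
  have setN: "{y. \<forall>j. y j * u j \<le> 1} \<in> sets N" for u :: "'n \<Rightarrow> real"
  proof -
    have "{y \<in> space real_space. \<forall>j. y j * u j \<le> 1} \<in> sets (real_space :: ('n \<Rightarrow> real) measure)" by measurable
    then show ?thesis by (simp add: N_def space_PiM)
  qed
  have mN: "measure N {y. \<forall>j. y j * u j \<le> 1} = exp (- D_norm M u)" if u: "\<And>j. 0 \<le> u j" for u
  proof -
    have "measure N {y. \<forall>j. y j * u j \<le> 1} = measure point_space (Y -` {y. \<forall>j. y j * u j \<le> 1} \<inter> space point_space)"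
      using setN[of u] unfolding N_def by (intro measure_distr Y) simp
    also have "\<dots> = measure point_space (?ev u)"
    proof (rule O.finite_measure_eq_AE)
      show "AE \<omega> in point_space. (\<omega> \<in> Y -` {y. \<forall>j. y j * u j \<le> 1} \<inter> space point_space) = (\<omega> \<in> ?ev u)"
        using fin
      proof eventually_elim
        case (elim \<omega>)
        then have "(\<forall>j. Y \<omega> j * u j \<le> 1) = (\<forall>j. \<forall>nk. point_value \<omega> nk j * ereal (u j) \<le> 1)"
          using frechet_le_iff[OF u] unfolding Y_def by simp
        then show ?case by auto
      qed
      show "Y -` {y. \<forall>j. y j * u j \<le> 1} \<inter> space point_space \<in> O.events"
        using setN[of u] by (intro measurable_sets[OF Y]) (simp add: N_def)
    qed (rule ev)
    finally show ?thesis by (simp only: measure_frechet[OF u])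
  qed
  have pos: "AE y in N. \<forall>j. 0 < y j"
  proof -
    have "AE y in N. 0 < y j" for j
    proof -
      have s: "{y. y j \<le> 0} \<in> sets N"
      proof -
        have "{y \<in> space real_space. y j \<le> 0} \<in> sets (real_space :: ('n \<Rightarrow> real) measure)" by measurable
        then show ?thesis by (simp add: N_def space_PiM)
      qed
      have "measure N {y. y j \<le> 0} \<le> exp (- ((\<integral>z. z j \<partial>M) * real m))" for m
      proof -
        have "measure N {y. y j \<le> 0} \<le> measure N {y. \<forall>i. y i * (if i = j then real m else 0) \<le> 1}"
          using setN by (intro N.finite_measure_mono) (auto intro: order_trans[OF mult_nonpos_nonneg])
        also have "\<dots> = exp (- ((\<integral>z. z j \<partial>M) * real m))"
          by (subst mN) (auto simp: D_norm_single)
        finally show ?thesis .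
      qed
      moreover have "(\<lambda>m. exp (- ((\<integral>z. z j \<partial>M) * real m))) \<longlonglongrightarrow> 0"
        using mean_pos[of j]
        by (intro filterlim_compose[OF exp_at_bot] filterlim_uminus_at_bot[THEN iffD2])
          (auto intro!: filterlim_tendsto_pos_mult_at_top[OF tendsto_const] filterlim_real_sequentially)
      ultimately have "measure N {y. y j \<le> 0} \<le> 0" by (intro LIMSEQ_le_const) auto
      then have "measure N {y. y j \<le> 0} = 0" using measure_nonneg[of N] by (metis antisym)
      then have "AE y in N. y \<notin> {y. y j \<le> 0}" using s by (simp add: N.prob_eq_0)
      then show ?thesis by eventually_elim auto
    qed
    then show ?thesis by (simp add: AE_all_countable)
  qed
  show thesis by (rule that[OF pN _ pos mN]) (simp add: N_def)
qed

end

section \<open>GEV distributions and their GP distributions\<close>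

text \<open>A GEV margin is determined by \<open>\<gamma>\<close>, \<open>\<sigma>\<close> and one scale factor, which absorbs location and scale.\<close>

lemma gp_tail_scale:
  assumes s: "0 < \<sigma>" and a: "0 < \<alpha>" and sa: "\<sigma> = \<alpha> - \<gamma> * m" and x: "inside \<gamma> \<sigma> x"
  shows "gp_tail \<gamma> ((x - m) / \<alpha>) = (if \<gamma> = 0 then exp (m / \<sigma>) else (\<alpha> / \<sigma>) powr (1 / \<gamma>)) * etail \<gamma> \<sigma> x"
proof (cases "\<gamma> = 0")
  case True
  have "exp (- ((x - m) / \<sigma>)) = exp (m / \<sigma> + - x / \<sigma>)" by (simp add: diff_divide_distrib)
  then show ?thesis using True sa by (simp only: gp_tail_def etail_def exp_add) simp
next
  case False
  have p: "0 < 1 + \<gamma> * x / \<sigma>" using inside_scaled[OF s] x by blast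
  have "1 + \<gamma> * ((x - m) / \<alpha>) = (\<alpha> - \<gamma> * m + \<gamma> * x) / \<alpha>"
    using a by (simp add: field_simps)
  also have "\<dots> = (\<sigma> + \<gamma> * x) / \<alpha>" by (simp only: sa)
  also have "\<dots> = inverse (\<alpha> / \<sigma>) * (1 + \<gamma> * x / \<sigma>)"
    using s a by (simp add: field_simps)
  finally have e: "1 + \<gamma> * ((x - m) / \<alpha>) = inverse (\<alpha> / \<sigma>) * (1 + \<gamma> * x / \<sigma>)" .
  have "gp_tail \<gamma> ((x - m) / \<alpha>) = (inverse (\<alpha> / \<sigma>) * (1 + \<gamma> * x / \<sigma>)) powr (- 1 / \<gamma>)"
    using False by (simp only: gp_tail_def e if_False)
  also have "\<dots> = inverse (\<alpha> / \<sigma>) powr (- 1 / \<gamma>) * (1 + \<gamma> * x / \<sigma>) powr (- 1 / \<gamma>)"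
    by (rule powr_mult)
  also have "inverse (\<alpha> / \<sigma>) powr (- 1 / \<gamma>) = (\<alpha> / \<sigma>) powr (1 / \<gamma>)"
  proof -
    have "inverse w powr (- b) = w powr b" if "0 < w" for w b :: real
      using that by (simp add: powr_def ln_inverse)
    from this[of "\<alpha> / \<sigma>" "1 / \<gamma>"] show ?thesis using s a by simp
  qed
  finally show ?thesis using False p by (simp add: etail_def)
qed

text \<open>Laws on \<open>\<real>\<^sup>d\<close>.\<close>

locale real_law = prob_space P for P :: "('n::finite \<Rightarrow> real) measure" +
  assumes sets_P [measurable_cong]: "sets P = sets real_space"
begin

lemma space_P [simp]: "space P = UNIV"
  using sets_eq_imp_space_eq[OF sets_P] by (simp add: space_PiM)

lemma P_box_sets: "{y. \<forall>j. y j \<le> x j} \<in> sets P" "{y. y j \<le> a} \<in> sets P"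
proof -
  have "{y \<in> space P. \<forall>j. y j \<le> x j} \<in> sets P" "{y \<in> space P. y j \<le> a} \<in> sets P" by measurable
  then show "{y. \<forall>j. y j \<le> x j} \<in> sets P" "{y. y j \<le> a} \<in> sets P" by simp_all
qed

lemma real_cdf_eq: "real_cdf P x = measure P {y. \<forall>j. y j \<le> x j}"
  by (simp add: real_cdf_def)

lemma margin_cdf_eq: "margin_cdf P j x = measure P {y. y j \<le> x}"
proof -
  have "(\<lambda>y. y j) \<in> borel_measurable P" by measurable
  then show ?thesis unfolding margin_cdf_def cdf_def by (subst measure_distr) (auto simp: vimage_def)
qed

lemma margin_mono: "x \<le> y \<Longrightarrow> margin_cdf P j x \<le> margin_cdf P j y"
  unfolding margin_cdf_eq by (intro finite_measure_mono P_box_sets) auto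

lemma margin_le_1: "margin_cdf P j x \<le> 1" and margin_nonneg: "0 \<le> margin_cdf P j x"
  by (auto simp: margin_cdf_eq)

lemma real_cdf_le_margin: "real_cdf P x \<le> margin_cdf P j (x j)"
  unfolding margin_cdf_eq real_cdf_eq by (intro finite_measure_mono P_box_sets) auto

end

text \<open>Laws whose margins become \<open>exp (- c u)\<close> in the coordinate \<open>u = etail x\<close>.\<close>

locale frechet_margins = real_law P for P :: "('n::finite \<Rightarrow> real) measure" +
  fixes \<sigma> \<gamma> c :: "'n \<Rightarrow> real"
  assumes sigma_pos: "\<And>j. 0 < \<sigma> j" and c_pos: "\<And>j. 0 < c j"
    and margin: "\<And>j x. inside (\<gamma> j) (\<sigma> j) x \<Longrightarrow> margin_cdf P j x = exp (- (c j * etail (\<gamma> j) (\<sigma> j) x))"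
begin

lemma margin_inv: "0 < u \<Longrightarrow> margin_cdf P j (etail_inv (\<gamma> j) (\<sigma> j) u) = exp (- (c j * u))"
  by (simp add: margin inside_etail_inv sigma_pos etail_etail_inv)

lemma margin_zero:
  assumes "\<not> above_end (\<gamma> j) (\<sigma> j) x" shows "margin_cdf P j x = 0"
proof -
  have "margin_cdf P j x \<le> exp (- (c j * real (Suc n)))" for n
  proof -
    have "\<not> etail_inv (\<gamma> j) (\<sigma> j) (real (Suc n)) \<le> x"
      using etail_inv_le_iff[OF sigma_pos[of j], of "real (Suc n)" "\<gamma> j" x] assms by simp
    then show ?thesis using margin_mono[of x "etail_inv (\<gamma> j) (\<sigma> j) (real (Suc n))" j]
      by (subst margin_inv[symmetric]) auto
  qed
  moreover have "(\<lambda>n. exp (- (c j * real (Suc n)))) \<longlonglongrightarrow> 0"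
    using c_pos[of j]
    by (intro filterlim_compose[OF exp_at_bot] filterlim_uminus_at_bot[THEN iffD2])
      (auto intro!: filterlim_tendsto_pos_mult_at_top[OF tendsto_const]
        filterlim_compose[OF filterlim_real_sequentially filterlim_Suc] simp del: of_nat_Suc)
  ultimately have "margin_cdf P j x \<le> 0" by (intro LIMSEQ_le_const) auto
  then show ?thesis using margin_nonneg[of j x] by simp
qed

lemma margin_one:
  assumes "above_end (\<gamma> j) (\<sigma> j) x" "\<not> inside (\<gamma> j) (\<sigma> j) x" shows "margin_cdf P j x = 1"
proof -
  have "exp (- (c j * (1 / real (Suc n)))) \<le> margin_cdf P j x" for n
  proof -
    have "etail_inv (\<gamma> j) (\<sigma> j) (1 / real (Suc n)) \<le> x"
      using etail_inv_le_iff[OF sigma_pos[of j], of "1 / real (Suc n)" "\<gamma> j" x] assms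
        etail_beyond[OF sigma_pos assms(2)] by simp
    then show ?thesis using margin_mono by (subst margin_inv[symmetric]) auto
  qed
  moreover have "(\<lambda>n. exp (- (c j * (1 / real (Suc n))))) \<longlonglongrightarrow> exp (- (c j * 0))"
    by (intro tendsto_intros LIMSEQ_inverse_real_of_nat[unfolded inverse_eq_divide])
  ultimately have "1 \<le> margin_cdf P j x" by (intro LIMSEQ_le_const2[of _ 1]) auto
  then show ?thesis using margin_le_1[of j x] by simp
qed

lemma lower_endpoint_less_iff: "lower_endpoint P j < ereal x \<longleftrightarrow> above_end (\<gamma> j) (\<sigma> j) x"
proof -
  have "lower_endpoint P j < ereal x \<longleftrightarrow> (\<exists>y<x. 0 < margin_cdf P j y)"
    unfolding lower_endpoint_def INF_less_iff by auto
  also have "\<dots> \<longleftrightarrow> (\<exists>y<x. above_end (\<gamma> j) (\<sigma> j) y)"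
  proof -
    have "0 < margin_cdf P j y \<longleftrightarrow> above_end (\<gamma> j) (\<sigma> j) y" for y
      using margin_zero[of j y] margin_one[of j y] margin[of j y] by (cases "inside (\<gamma> j) (\<sigma> j) y") force+
    then show ?thesis by simp
  qed
  also have "\<dots> \<longleftrightarrow> above_end (\<gamma> j) (\<sigma> j) x"
  proof (cases "0 < \<gamma> j")
    case True
    have "(0 < \<sigma> j + \<gamma> j * y) = (- \<sigma> j / \<gamma> j < y)" for y using True by (simp add: field_simps) linarith
    then show ?thesis using True dense[of "- \<sigma> j / \<gamma> j" x] unfolding above_end_def by (metis less_trans)
  next
    case False
    then show ?thesis unfolding above_end_def using lt_ex[of x] by blast
  qed
  finally show ?thesis .
qed

lemma less_lower_endpoint_iff: "ereal x < lower_endpoint P j \<longleftrightarrow> 0 < \<gamma> j \<and> x < - \<sigma> j / \<gamma> j"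
proof -
  have above: "above_end (\<gamma> j) (\<sigma> j) y \<longleftrightarrow> (0 < \<gamma> j \<longrightarrow> - \<sigma> j / \<gamma> j < y)" for y
    by (auto simp: above_end_def field_simps)
  show ?thesis
  proof
    assume l: "ereal x < lower_endpoint P j"
    then obtain y where y: "x < y" "ereal y < lower_endpoint P j"
      by (metis ereal_dense2 ereal_less(2) less_ereal.simps(1))
    then have "\<not> above_end (\<gamma> j) (\<sigma> j) y" using lower_endpoint_less_iff by (meson less_asym)
    then show "0 < \<gamma> j \<and> x < - \<sigma> j / \<gamma> j" using y unfolding above by auto
  next
    assume x: "0 < \<gamma> j \<and> x < - \<sigma> j / \<gamma> j"
    then obtain y where "x < y" "y < - \<sigma> j / \<gamma> j" using dense by blast
    then have "\<not> lower_endpoint P j < ereal y" using x unfolding lower_endpoint_less_iff above by auto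
    then show "ereal x < lower_endpoint P j" using \<open>x < y\<close> by (meson ereal_less_eq(3) less_ereal.simps(1) less_le_trans linorder_not_le)
  qed
qed

text \<open>The constant \<open>k\<close> cancels in the definition of the GP distribution.\<close>

lemma gp_of_eq:
  assumes M: "generator M" and k: "0 < k"
    and cdf: "\<And>x. (\<And>j. above_end (\<gamma> j) (\<sigma> j) (x j)) \<Longrightarrow>
      real_cdf P x = exp (- (k * D_norm M (\<lambda>j. etail (\<gamma> j) (\<sigma> j) (x j))))"
  shows "gp_of P = gp_law \<sigma> \<gamma> M"
proof -
  interpret G: gen M \<sigma> \<gamma> by (intro gen.intro M sigma_pos)
  let ?D = "\<lambda>x. D_norm M (\<lambda>j. etail (\<gamma> j) (\<sigma> j) (x j))"
  have c0: "real_cdf P (\<lambda>_. 0) = exp (- (k * D_norm M (\<lambda>_. 1)))"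
    using cdf[of "\<lambda>_. 0"] sigma_pos by (simp add: above_end_def)
  have H: "1 / ln (real_cdf P (\<lambda>_. 0)) * ln (real_cdf P (min0 x) / real_cdf P x) = joint_cdf (gp_law \<sigma> \<gamma> M) x"
    if x: "\<And>j. above_end (\<gamma> j) (\<sigma> j) (x j)" for x
  proof -
    have "above_end (\<gamma> j) (\<sigma> j) (min0 x j)" for j unfolding min0_def by (rule above_end_min0[OF sigma_pos x])
    then have "1 / ln (real_cdf P (\<lambda>_. 0)) * ln (real_cdf P (min0 x) / real_cdf P x) =
        1 / (- (k * D_norm M (\<lambda>_. 1))) * (- (k * ?D (min0 x)) + k * ?D x)"
      by (simp add: c0 cdf x exp_diff[symmetric])
    also have "\<dots> = (?D (min0 x) - ?D x) / D_norm M (\<lambda>_. 1)" using k G.V1_pos by (simp add: field_simps)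
    finally show ?thesis by (simp add: G.joint_cdf_gp_law_above[OF x])
  qed
  show ?thesis unfolding gp_of_def lower_endpoint_less_iff less_lower_endpoint_iff
  proof (rule the_equality)
    show "is_law (gp_law \<sigma> \<gamma> M) \<and> (\<forall>x. (\<forall>j. above_end (\<gamma> j) (\<sigma> j) (x j)) \<longrightarrow> joint_cdf (gp_law \<sigma> \<gamma> M) x =
        1 / ln (real_cdf P (\<lambda>_. 0)) * ln (real_cdf P (min0 x) / real_cdf P x)) \<and>
      (\<forall>x. (\<exists>j. 0 < \<gamma> j \<and> x j < - \<sigma> j / \<gamma> j) \<longrightarrow> joint_cdf (gp_law \<sigma> \<gamma> M) x = 0)"
      using G.gp_law_is_law H G.joint_cdf_gp_law_zero by auto
    fix \<mu> assume mu: "is_law \<mu> \<and> (\<forall>x. (\<forall>j. above_end (\<gamma> j) (\<sigma> j) (x j)) \<longrightarrow> joint_cdf \<mu> x =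
        1 / ln (real_cdf P (\<lambda>_. 0)) * ln (real_cdf P (min0 x) / real_cdf P x)) \<and>
      (\<forall>x. (\<exists>j. 0 < \<gamma> j \<and> x j < - \<sigma> j / \<gamma> j) \<longrightarrow> joint_cdf \<mu> x = 0)"
    show "\<mu> = gp_law \<sigma> \<gamma> M"
    proof (rule law_eqI_inside[OF sigma_pos _ G.gp_law_is_law _ _ G.gp_law_upper])
      show "joint_cdf \<mu> x = joint_cdf (gp_law \<sigma> \<gamma> M) x" if "\<And>j. inside (\<gamma> j) (\<sigma> j) (x j)" for x
        using mu H[of x] inside_imp_above_end[OF that] by simp
      show "joint_cdf \<mu> x = 0 \<and> joint_cdf (gp_law \<sigma> \<gamma> M) x = 0" if "0 < \<gamma> j" "x j < - \<sigma> j / \<gamma> j" for x j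
        using mu that G.joint_cdf_gp_law_zero[of j x] by blast
    qed (use mu in blast)
  qed
qed

end

context gen
begin

text \<open>The affine norming that multiplies the tail by \<open>1/t\<close>.\<close>

lemma etail_affine:
  fixes j :: 'n
  assumes "0 < t" and a_def: "a = t powr \<gamma> j" and b_def: "b = (if \<gamma> j = 0 then \<sigma> j * ln t else \<sigma> j / \<gamma> j * (t powr \<gamma> j - 1))"
  shows "above_end (\<gamma> j) (\<sigma> j) (a * x + b) \<longleftrightarrow> above_end (\<gamma> j) (\<sigma> j) x"
    and "etail (\<gamma> j) (\<sigma> j) (a * x + b) = etail (\<gamma> j) (\<sigma> j) x / t"
proof -
  have a: "0 < a" using assms by simp
  have e: "1 + \<gamma> j * (a * x + b) / \<sigma> j = a * (1 + \<gamma> j * x / \<sigma> j)" if "\<gamma> j \<noteq> 0"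
    using that sigma_pos[of j] by (simp add: a_def b_def field_simps)
  show "above_end (\<gamma> j) (\<sigma> j) (a * x + b) \<longleftrightarrow> above_end (\<gamma> j) (\<sigma> j) x"
  proof (cases "0 < \<gamma> j")
    case True
    then have "inside (\<gamma> j) (\<sigma> j) (a * x + b) \<longleftrightarrow> 0 < a * (1 + \<gamma> j * x / \<sigma> j)"
      using e inside_scaled[OF sigma_pos[of j], of "\<gamma> j" "a * x + b"] by simp
    also have "\<dots> \<longleftrightarrow> inside (\<gamma> j) (\<sigma> j) x"
      using a inside_scaled[OF sigma_pos[of j], of "\<gamma> j" x] by (simp only: zero_less_mult_iff) auto
    finally show ?thesis by (simp add: above_end_def inside_def)
  qed (simp add: above_end_def)
  show "etail (\<gamma> j) (\<sigma> j) (a * x + b) = etail (\<gamma> j) (\<sigma> j) x / t"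
  proof (cases "\<gamma> j = 0")
    case True
    then have "- (a * x + b) / \<sigma> j = - x / \<sigma> j - ln t" using assms sigma_pos[of j] by (simp add: field_simps)
    then show ?thesis using True assms(1) by (simp add: etail_def exp_diff)
  next
    case False
    have "max 0 (a * (1 + \<gamma> j * x / \<sigma> j)) = a * max 0 (1 + \<gamma> j * x / \<sigma> j)"
      using a by (simp add: max_mult_distrib_left)
    moreover have "a powr (- 1 / \<gamma> j) = 1 / t"
      using False assms(1) by (simp add: a_def powr_powr powr_minus_divide)
    ultimately show ?thesis using False a e by (simp add: etail_def powr_mult)
  qed
qed

text \<open>The vector \<open>X\<^sub>j = etail_inv (1 / Y\<^sub>j)\<close>, with \<open>Y\<close> from \<open>frechet_exists\<close>, has a GEV law with cdf
  \<open>exp (- D(etail x))\<close>.\<close>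

lemma gp_law_in_GP_class:
  shows "gp_law \<sigma> \<gamma> M \<in> GP_class \<sigma> \<gamma>"
proof -
  have "\<exists>N. prob_space N \<and> sets N = sets real_space \<and> (AE y in N. \<forall>j. 0 < y j) \<and>
    (\<forall>u. (\<forall>j. 0 \<le> u j) \<longrightarrow> measure N {y. \<forall>j. y j * u j \<le> 1} = exp (- D_norm M u))"
    by (rule frechet_exists) blast
  then obtain N :: "('n \<Rightarrow> real) measure" where N: "prob_space N" "sets N = sets real_space" "AE y in N. \<forall>j. 0 < y j"
    "\<And>u. (\<forall>j. 0 \<le> u j) \<Longrightarrow> measure N {y. \<forall>j. y j * u j \<le> 1} = exp (- D_norm M u)"
    by blast
  interpret N: real_law N by (intro real_law.intro real_law_axioms.intro N)
  define X where "X y = (\<lambda>j. etail_inv (\<gamma> j) (\<sigma> j) (1 / y j))" for y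
  have X: "X \<in> N \<rightarrow>\<^sub>M real_space"
    unfolding X_def etail_inv_def using N.sets_P by (intro measurable_PiM_single') (auto simp: space_PiM)
  define P where "P = distr N real_space X"
  interpret P: real_law P
    by (intro real_law.intro real_law_axioms.intro) (auto simp: P_def intro: N.prob_space_distr X)
  have le_iff: "X y j \<le> x \<longleftrightarrow> above_end (\<gamma> j) (\<sigma> j) x \<and> y j * etail (\<gamma> j) (\<sigma> j) x \<le> 1" if "0 < y j" for y j x
    using etail_inv_le_iff[OF sigma_pos[of j], of "1 / y j" "\<gamma> j" x] that by (simp add: X_def field_simps)
  have P_eq: "measure P A = measure N (X -` A)" if "A \<in> sets P" for A
    using that unfolding P_def by (subst measure_distr[OF X]) auto
  have Nsets: "{y. \<forall>j. y j * u j \<le> 1} \<in> sets N" for u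
  proof -
    have "{y \<in> space N. \<forall>j. y j * u j \<le> 1} \<in> sets N" by measurable
    then show ?thesis by simp
  qed
  have cdf: "real_cdf P x = exp (- D_norm M (\<lambda>j. etail (\<gamma> j) (\<sigma> j) (x j)))"
    if x: "\<And>j. above_end (\<gamma> j) (\<sigma> j) (x j)" for x
  proof -
    have "real_cdf P x = measure N (X -` {y. \<forall>j. y j \<le> x j})"
      unfolding P.real_cdf_eq by (rule P_eq[OF P.P_box_sets(1)])
    also have "\<dots> = measure N {y. \<forall>j. y j * etail (\<gamma> j) (\<sigma> j) (x j) \<le> 1}"
    proof (rule N.finite_measure_eq_AE)
      show "AE y in N. (y \<in> X -` {y. \<forall>j. y j \<le> x j}) = (y \<in> {y. \<forall>j. y j * etail (\<gamma> j) (\<sigma> j) (x j) \<le> 1})"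
        using N(3) by eventually_elim (simp add: le_iff x)
      show "X -` {y. \<forall>j. y j \<le> x j} \<in> N.events"
        using measurable_sets[OF X, of "{y. \<forall>j. y j \<le> x j}"] P.P_box_sets(1)[of x] by (simp add: P_def)
    qed (rule Nsets)
    finally show ?thesis using N(4) by simp
  qed
  have cdf0: "real_cdf P x = 0" if "\<not> above_end (\<gamma> j) (\<sigma> j) (x j)" for x j
  proof -
    have "real_cdf P x = measure N (X -` {y. \<forall>j. y j \<le> x j})"
      unfolding P.real_cdf_eq by (rule P_eq[OF P.P_box_sets(1)])
    also have "\<dots> = measure N {}"
    proof (rule N.finite_measure_eq_AE)
      show "AE y in N. (y \<in> X -` {y. \<forall>j. y j \<le> x j}) = (y \<in> {})"
        using N(3) by eventually_elim (use le_iff that in auto)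
      show "X -` {y. \<forall>j. y j \<le> x j} \<in> N.events"
        using measurable_sets[OF X, of "{y. \<forall>j. y j \<le> x j}"] P.P_box_sets(1)[of x] by (simp add: P_def)
    qed simp
    finally show ?thesis by simp
  qed
  define c where "c j = (\<integral>z. z j \<partial>M)" for j
  have c_pos: "0 < c j" for j unfolding c_def by (rule mean_pos)
  have margin: "margin_cdf P j x = exp (- (c j * etail (\<gamma> j) (\<sigma> j) x))" if x: "inside (\<gamma> j) (\<sigma> j) x" for j x
  proof -
    have "margin_cdf P j x = measure N (X -` {y. y j \<le> x})"
      unfolding P.margin_cdf_eq by (rule P_eq[OF P.P_box_sets(2)])
    also have "\<dots> = measure N {y. \<forall>i. y i * (if i = j then etail (\<gamma> j) (\<sigma> j) x else 0) \<le> 1}"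
    proof (rule N.finite_measure_eq_AE)
      show "AE y in N. (y \<in> X -` {y. y j \<le> x}) = (y \<in> {y. \<forall>i. y i * (if i = j then etail (\<gamma> j) (\<sigma> j) x else 0) \<le> 1})"
        using N(3) by eventually_elim (auto simp: le_iff inside_imp_above_end[OF x])
      show "X -` {y. y j \<le> x} \<in> N.events"
        using measurable_sets[OF X, of "{y. y j \<le> x}"] P.P_box_sets(2)[of j x] by (simp add: P_def)
    qed (rule Nsets)
    also have "\<dots> = exp (- (c j * etail (\<gamma> j) (\<sigma> j) x))"
      by (subst N(4)) (auto simp: D_norm_single c_def)
    finally show ?thesis .
  qed
  interpret F: frechet_margins P \<sigma> \<gamma> c
    by unfold_locales (auto simp: sigma_pos c_pos margin)
  have V0: "real_cdf P (\<lambda>_. 0) = exp (- V1)"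
    using cdf[of "\<lambda>_. 0"] sigma_pos by (simp add: above_end_def)
  \<comment> \<open>scale and location that make \<open>c j\<close> the factor in \<open>gp_tail_scale\<close>\<close>
  define \<alpha> where "\<alpha> j = (if \<gamma> j = 0 then \<sigma> j else \<sigma> j * c j powr \<gamma> j)" for j
  define m where "m j = (if \<gamma> j = 0 then \<sigma> j * ln (c j) else (\<alpha> j - \<sigma> j) / \<gamma> j)" for j
  have \<alpha>: "0 < \<alpha> j" "\<sigma> j = \<alpha> j - \<gamma> j * m j" for j
    using sigma_pos[of j] c_pos[of j] by (auto simp: \<alpha>_def m_def)
  have scale: "(if \<gamma> j = 0 then exp (m j / \<sigma> j) else (\<alpha> j / \<sigma> j) powr (1 / \<gamma> j)) = c j" for j
    using sigma_pos[of j] c_pos[of j] by (simp add: \<alpha>_def m_def powr_powr)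
  have gm: "gev_margins P \<gamma> m \<alpha>"
    unfolding gev_margins_def
  proof (intro conjI allI impI)
    fix j x assume "0 < \<alpha> j + \<gamma> j * (x - m j)"
    then have x: "inside (\<gamma> j) (\<sigma> j) x" using \<alpha>(2)[of j] by (simp add: inside_def right_diff_distrib)
    show "margin_cdf P j x = exp (- gp_tail (\<gamma> j) ((x - m j) / \<alpha> j))"
      using margin[OF x] gp_tail_scale[OF sigma_pos[of j] \<alpha> x] scale[of j] by simp
  qed (rule \<alpha>(1))
  have "is_gev P"
    unfolding is_gev_def
  proof (intro conjI allI)
    show "prob_space P" by (rule P.prob_space_axioms)
    show "sets P = sets real_space" by (rule P.sets_P)
    show "max_stable P"
      unfolding max_stable_def
    proof (intro allI impI exI conjI)
      fix t :: real and j :: 'n assume "0 < t"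
      then show "0 < (\<lambda>j. t powr \<gamma> j) j" by simp
    next
      fix t :: real and x assume t: "0 < t"
      let ?a = "\<lambda>j. t powr \<gamma> j" and ?b = "\<lambda>j. if \<gamma> j = 0 then \<sigma> j * ln t else \<sigma> j / \<gamma> j * (t powr \<gamma> j - 1)"
      show "real_cdf P (\<lambda>j. ?a j * x j + ?b j) powr t = real_cdf P x"
      proof (cases "\<forall>j. above_end (\<gamma> j) (\<sigma> j) (x j)")
        case True
        then have "real_cdf P (\<lambda>j. ?a j * x j + ?b j) = exp (- D_norm M (\<lambda>j. (1 / t) * etail (\<gamma> j) (\<sigma> j) (x j)))"
          using etail_affine[OF t refl refl] by (subst cdf) auto
        moreover have "D_norm M (\<lambda>j. (1 / t) * etail (\<gamma> j) (\<sigma> j) (x j)) = 1 / t * D_norm M (\<lambda>j. etail (\<gamma> j) (\<sigma> j) (x j))"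
          by (rule D_norm_cmult) (use t in simp)
        ultimately have "real_cdf P (\<lambda>j. ?a j * x j + ?b j) = exp (- (1 / t * D_norm M (\<lambda>j. etail (\<gamma> j) (\<sigma> j) (x j))))"
          by (simp only:)
        moreover have "exp (- (1 / t * d)) powr t = exp (- d)" for d using t by (simp add: powr_def)
        ultimately show ?thesis using True by (simp only: cdf)
      next
        case False
        then obtain j where j: "\<not> above_end (\<gamma> j) (\<sigma> j) (x j)" by blast
        then have "\<not> above_end (\<gamma> j) (\<sigma> j) (?a j * x j + ?b j)" using etail_affine(1)[OF t refl refl] by simp
        then show ?thesis using j cdf0[of j x] cdf0[of j "\<lambda>j. ?a j * x j + ?b j"] by simp
      qed
    qed
    fix j
    show "\<not> (\<exists>v. AE y in P. y j = v)"
    proof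
      assume "\<exists>v. AE y in P. y j = v"
      then obtain v where v: "AE y in P. y j = v" by blast
      have "margin_cdf P j 0 = 0 \<or> margin_cdf P j 0 = 1"
      proof (cases "v \<le> 0")
        case True
        have "AE y in P. y \<in> {y. y j \<le> 0}" using v by eventually_elim (use True in simp)
        then show ?thesis unfolding P.margin_cdf_eq using P.prob_eq_1[OF P.P_box_sets(2)] by blast
      next
        case False
        have "AE y in P. y \<notin> {y. y j \<le> 0}" using v by eventually_elim (use False in simp)
        then show ?thesis unfolding P.margin_cdf_eq using P.prob_eq_0[OF P.P_box_sets(2)] by blast
      qed
      then show False using margin[of j 0] sigma_pos[of j] c_pos[of j] by (simp add: inside_def)
    qed
  qed
  moreover have "gp_of P = gp_law \<sigma> \<gamma> M"
    by (rule F.gp_of_eq[OF gen zero_less_one]) (simp add: cdf)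
  moreover have "0 < real_cdf P (\<lambda>_. 0)" "real_cdf P (\<lambda>_. 0) < 1" using V0 V1_pos by simp_all
  ultimately show ?thesis unfolding GP_class_def using gm \<alpha>(2) by (intro CollectI exI[of _ P]) auto
qed

end

section \<open>Weak compactness on the unit cube\<close>

text \<open>Retraction of the real line onto the unit interval, so that the digits below are \<open>0\<close> or
  \<open>1\<close> for every real argument.\<close>

definition clip :: "real \<Rightarrow> real" where "clip x = max 0 (min 1 x)"

text \<open>The numerator of the truncation of \<open>clip x\<close> to \<open>k\<close> binary digits. The minimum matters only for
  \<open>clip x = 1\<close>, which is thereby expanded as \<open>0.111...\<close>.\<close>

definition trunc :: "nat \<Rightarrow> real \<Rightarrow> int" where
  "trunc k x = min \<lfloor>2 ^ k * clip x\<rfloor> (2 ^ k - 1)"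

text \<open>The binary digits of \<open>clip x\<close>.\<close>

definition digit :: "nat \<Rightarrow> real \<Rightarrow> int" where
  "digit k x = trunc (Suc k) x - 2 * trunc k x"

lemma digit_range: "digit k x \<in> {0, 1}"
proof -
  define y where "y = 2 ^ k * clip x"
  have y: "0 \<le> y" "y \<le> 2 ^ k" by (auto simp: y_def clip_def)
  have e: "2 ^ Suc k * clip x = 2 * y" by (simp add: y_def)
  have "\<lfloor>y\<rfloor> \<le> 2 ^ k" using y(2) by (simp add: floor_le_iff)
  moreover have "\<lfloor>2 * y\<rfloor> = 2 * \<lfloor>y\<rfloor> \<or> \<lfloor>2 * y\<rfloor> = 2 * \<lfloor>y\<rfloor> + 1" by linarith
  moreover have "\<lfloor>2 * y\<rfloor> = 2 ^ Suc k" if "\<lfloor>y\<rfloor> = 2 ^ k"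
  proof -
    have "y = 2 ^ k" using that y(2) by (metis antisym floor_eq_iff of_int_numeral of_int_power)
    then show ?thesis by (simp add: floor_eq_iff)
  qed
  ultimately show ?thesis
    unfolding digit_def trunc_def e unfolding y_def[symmetric] by (auto simp: min_def)
qed

lemma digit_sums: "(\<lambda>k. (1/2) ^ Suc k * real_of_int (digit k x)) sums clip x"
proof -
  have part: "(\<Sum>k<K. (1/2) ^ Suc k * real_of_int (digit k x)) = real_of_int (trunc K x) / 2 ^ K" for K
  proof (induction K)
    case 0
    have "clip x \<le> 1" "0 \<le> clip x" by (auto simp: clip_def)
    then have "trunc 0 x = 0" by (simp add: trunc_def)
    then show ?case by simp
  next
    case (Suc K)
    then show ?case by (simp add: digit_def field_simps power_divide)
  qed
  have up: "real_of_int (trunc K x) / 2 ^ K \<le> clip x" for K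
  proof -
    have "real_of_int (trunc K x) \<le> 2 ^ K * clip x" unfolding trunc_def by linarith
    then show ?thesis by (simp add: field_simps)
  qed
  have lo: "clip x - (1/2) ^ K \<le> real_of_int (trunc K x) / 2 ^ K" for K
  proof -
    have "2 ^ K * clip x \<le> 2 ^ K" by (auto simp: clip_def)
    moreover have "real_of_int (2 ^ K - 1) = 2 ^ K - 1" by simp
    ultimately have "2 ^ K * clip x - 1 \<le> real_of_int (trunc K x)" unfolding trunc_def min_def by (auto; linarith)
    then have "(2 ^ K * clip x - 1) / 2 ^ K \<le> real_of_int (trunc K x) / 2 ^ K"
      by (rule divide_right_mono) simp
    moreover have "(2 ^ K * clip x - 1) / 2 ^ K = clip x - (1/2) ^ K" by (simp add: field_simps power_divide)
    ultimately show ?thesis by simp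
  qed
  have "(\<lambda>K. clip x - (1/2) ^ K) \<longlonglongrightarrow> clip x - 0"
    by (intro tendsto_intros LIMSEQ_power_zero) simp
  then have l: "(\<lambda>K. clip x - (1/2) ^ K) \<longlonglongrightarrow> clip x" by simp
  have "(\<lambda>K. real_of_int (trunc K x) / 2 ^ K) \<longlonglongrightarrow> clip x"
    by (rule tendsto_sandwich[OF _ _ l tendsto_const]) (auto intro!: always_eventually lo up)
  then show ?thesis unfolding sums_def part .
qed

text \<open>The point of the Cantor set with ternary digits \<open>2 c\<^sub>i\<close>.\<close>

definition ternary :: "(nat \<Rightarrow> int) \<Rightarrow> real" where
  "ternary c = (\<Sum>i. 2 * real_of_int (c i) * (1/3) ^ Suc i)"

lemma ternary_summable:
  assumes "\<And>i. c i \<in> {0, 1::int}" shows "summable (\<lambda>i. 2 * real_of_int (c i) * (1/3) ^ Suc i)"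
proof (rule summable_comparison_test')
  show "summable (\<lambda>i. 2 * (1/3::real) ^ Suc i)"
    by (intro summable_mult summable_geometric summable_Suc_iff[THEN iffD2]) simp
  show "norm (2 * real_of_int (c i) * (1/3) ^ Suc i) \<le> 2 * (1/3::real) ^ Suc i" for i
    using assms[of i] by auto
qed

lemma ternary_range:
  assumes c: "\<And>i. c i \<in> {0, 1::int}" shows "0 \<le> ternary c" "ternary c \<le> 1"
proof -
  show "0 \<le> ternary c"
    unfolding ternary_def
  proof (rule suminf_nonneg[OF ternary_summable[OF c]])
    show "0 \<le> 2 * real_of_int (c i) * (1/3) ^ Suc i" for i using c[of i] by auto
  qed
  have g: "(\<lambda>i. 2/3 * (1/3::real) ^ i) sums (2/3 * (1 / (1 - 1/3)))"
    by (intro sums_mult geometric_sums) simp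
  have "ternary c \<le> (\<Sum>i. 2/3 * (1/3::real) ^ i)"
    unfolding ternary_def
  proof (rule suminf_le[OF _ ternary_summable[OF c] sums_summable[OF g]])
    show "2 * real_of_int (c i) * (1/3) ^ Suc i \<le> 2/3 * (1/3) ^ i" for i using c[of i] by auto
  qed
  then show "ternary c \<le> 1" using sums_unique[OF g] by simp
qed

lemma ternary_shift:
  assumes c: "\<And>i. c i \<in> {0, 1::int}"
  shows "3 * ternary c = 2 * real_of_int (c 0) + ternary (\<lambda>i. c (Suc i))"
proof -
  have s: "(\<Sum>i. 2 * real_of_int (c (Suc i)) * (1/3) ^ Suc (Suc i)) = ternary c - 2 * real_of_int (c 0) * (1/3) ^ Suc 0"
    unfolding ternary_def by (rule suminf_split_head[OF ternary_summable[OF c]])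
  have "(\<Sum>i. 2 * real_of_int (c (Suc i)) * (1/3) ^ Suc (Suc i)) = (\<Sum>i. (1/3) * (2 * real_of_int (c (Suc i)) * (1/3) ^ Suc i))"
    by (intro suminf_cong) simp
  also have "\<dots> = 1/3 * ternary (\<lambda>i. c (Suc i))"
    unfolding ternary_def using ternary_summable[of "\<lambda>i. c (Suc i)"] c by (intro suminf_mult) auto
  finally show ?thesis using s by simp
qed

lemma ternary_power:
  assumes c: "\<And>i. c i \<in> {0, 1::int}"
  shows "\<exists>N::int. 3 ^ i * ternary c = 2 * real_of_int N + ternary (\<lambda>m. c (m + i))"
proof (induction i)
  case 0 then show ?case by (intro exI[of _ 0]) simp
next
  case (Suc i)
  then obtain N where N: "3 ^ i * ternary c = 2 * real_of_int N + ternary (\<lambda>m. c (m + i))" by blast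
  have "3 ^ Suc i * ternary c = 3 * (3 ^ i * ternary c)" by simp
  also have "\<dots> = 6 * real_of_int N + 3 * ternary (\<lambda>m. c (m + i))" unfolding N by simp
  also have "3 * ternary (\<lambda>m. c (m + i)) = 2 * real_of_int (c i) + ternary (\<lambda>m. c (m + Suc i))"
    using ternary_shift[of "\<lambda>m. c (m + i)"] c by simp
  finally show ?case by (intro exI[of _ "3 * N + c i"]) simp
qed

text \<open>A continuous even function of period 2 that is \<open>0\<close> on \<open>[0, 1/3]\<close> and \<open>1\<close> on \<open>[2/3, 1]\<close>. Applied to
  \<open>3\<^sup>i t\<close> it reads off the \<open>i\<close>-th digit of a point \<open>t\<close> of the Cantor set, because up to an
  even integer \<open>3\<^sup>i t\<close> is the point with the shifted digits.\<close>

definition zigzag :: "real \<Rightarrow> real" where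
  "zigzag s = clip (1/2 - cos (pi * s))"

lemma zigzag_ternary:
  assumes c: "\<And>i. c i \<in> {0, 1::int}"
  shows "zigzag (3 ^ i * ternary c) = real_of_int (c i)"
proof -
  obtain N where N: "3 ^ i * ternary c = 2 * real_of_int N + ternary (\<lambda>m. c (m + i))"
    using ternary_power[of c, OF c] by blast
  define r where "r = ternary (\<lambda>m. c (m + i))"
  define r' where "r' = ternary (\<lambda>m. c (m + Suc i))"
  have r: "3 * r = 2 * real_of_int (c i) + r'"
    unfolding r_def r'_def using ternary_shift[of "\<lambda>m. c (m + i)"] c by simp
  have r': "0 \<le> r'" "r' \<le> 1" unfolding r'_def using ternary_range[of "\<lambda>m. c (m + Suc i)"] c by auto
  have "cos (pi * (2 * real_of_int N + r)) = cos (pi * r)"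
  proof -
    have "pi * (2 * real_of_int N + r) = 2 * pi * real_of_int N + pi * r" by (simp add: algebra_simps)
    then show ?thesis by (simp only: cos_add cos_int_2pin sin_int_2pin)
  qed
  then have z: "zigzag (3 ^ i * ternary c) = clip (1/2 - cos (pi * r))"
    by (simp add: zigzag_def N r_def)
  consider "c i = 0" | "c i = 1" using c[of i] by auto
  then show ?thesis
  proof cases
    case 1
    then have "pi * r \<le> pi * (1/3)" "0 \<le> pi * r" using r r' by auto
    then have "cos (pi / 3) \<le> cos (pi * r)" by (intro cos_monotone_0_pi_le) auto
    then show ?thesis using 1 z by (simp add: clip_def cos_60)
  next
    case 2
    then have "pi * (2/3) \<le> pi * r" "pi * r \<le> pi" using r r' by auto
    then have "cos (pi * r) \<le> cos (pi * (2/3))" by (intro cos_monotone_0_pi_le) auto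
    also have "cos (pi * (2/3)) = - (1/2)" using cos_120 by (simp add: mult.commute)
    finally show ?thesis using 2 z by (simp add: clip_def)
  qed
qed

lemma zigzag_range: "0 \<le> zigzag s" "zigzag s \<le> 1" by (auto simp: zigzag_def clip_def)

lemma zigzag_continuous: "continuous_on A (\<lambda>t. zigzag (a * t))"
  unfolding zigzag_def clip_def by (intro continuous_intros)

lemma half_sums: "(\<lambda>k. (1/2::real) ^ Suc k) sums 1"
  using power_half_series by simp

text \<open>An enumeration of the coordinates.\<close>

definition coord_index :: "'n::finite \<Rightarrow> nat" where
  "coord_index = (SOME e. bij_betw e UNIV {..<CARD('n)})"

lemma coord_index_bij: "bij_betw (coord_index :: 'n \<Rightarrow> nat) UNIV {..<CARD('n::finite)}"
  unfolding coord_index_def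
proof (rule someI_ex[where P = "\<lambda>e. bij_betw e (UNIV :: 'n set) {..<CARD('n)}"])
  have "\<exists>e. bij_betw e (UNIV :: 'n set) {0..<CARD('n)}" by (rule ex_bij_betw_finite_nat) simp
  then show "\<exists>e. bij_betw e (UNIV :: 'n set) {..<CARD('n)}" by (simp add: atLeast0LessThan)
qed

text \<open>The space-filling curve of Schoenberg: for \<open>t\<close> in the Cantor set, the digits of
  \<open>t\<close> with index \<open>i\<close> modulo \<open>d\<close> are the binary digits of the coordinate with number \<open>i\<close>. It is continuous on the whole real line.\<close>

definition curve :: "real \<Rightarrow> 'n::finite \<Rightarrow> real" where
  "curve t j = (\<Sum>k. (1/2) ^ Suc k * zigzag (3 ^ (k * CARD('n) + coord_index j) * t))"

text \<open>A measurable right inverse of the curve on the unit cube, with values in the Cantor set: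
  the binary digits of the coordinates are interleaved.\<close>

definition encode :: "('n::finite \<Rightarrow> real) \<Rightarrow> real" where
  "encode w = ternary (\<lambda>i. digit (i div CARD('n)) (w (inv_into UNIV coord_index (i mod CARD('n)))))"

lemma curve_encode: "curve (encode w) j = clip (w j)" for w :: "'n::finite \<Rightarrow> real"
proof -
  have ax: "coord_index j < CARD('n)" using bij_betwE[OF coord_index_bij[where ?'n = 'n]] by simp
  have "inv_into UNIV coord_index (coord_index j) = j" by (rule inv_into_f_f[OF bij_betw_imp_inj_on[OF coord_index_bij]]) simp
  then have "zigzag (3 ^ (k * CARD('n) + coord_index j) * encode w) = real_of_int (digit k (w j))" for k
    unfolding encode_def by (subst zigzag_ternary) (use digit_range ax in auto)
  then show ?thesis unfolding curve_def using sums_unique[OF digit_sums] by simp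
qed

lemma encode_range: "0 \<le> encode w" "encode w \<le> 1"
  unfolding encode_def by (rule ternary_range[OF digit_range])+

lemma curve_summable: "summable (\<lambda>k. (1/2) ^ Suc k * zigzag (a k * t))"
proof (rule summable_comparison_test'[OF sums_summable[OF half_sums]])
  show "norm ((1/2) ^ Suc k * zigzag (a k * t)) \<le> (1/2) ^ Suc k" for k
    using zigzag_range[of "a k * t"] by (simp add: mult_le_cancel_left1 abs_mult)
qed

lemma curve_range: "0 \<le> curve t j" "curve t j \<le> 1"
proof -
  show "0 \<le> curve t j"
    unfolding curve_def by (intro suminf_nonneg curve_summable mult_nonneg_nonneg zigzag_range) simp
  have "curve t j \<le> (\<Sum>k. (1/2) ^ Suc k)"
    unfolding curve_def
    by (intro suminf_le curve_summable sums_summable[OF half_sums] mult_left_le zigzag_range) simp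
  then show "curve t j \<le> 1" using sums_unique[OF half_sums] by simp
qed

lemma curve_continuous: "continuous_on UNIV (\<lambda>t. curve t (j :: 'n::finite))"
proof -
  let ?f = "\<lambda>k t. (1/2) ^ Suc k * zigzag (3 ^ (k * CARD('n) + coord_index j) * t)"
  have "uniform_limit UNIV (\<lambda>n t. \<Sum>k<n. ?f k t) (\<lambda>t. \<Sum>k. ?f k t) sequentially"
  proof (rule Weierstrass_m_test[OF _ sums_summable[OF half_sums]])
    show "norm (?f k t) \<le> (1/2) ^ Suc k" for k t
      using zigzag_range[of "3 ^ (k * CARD('n) + coord_index j) * t"] by (simp add: mult_le_cancel_left1 abs_mult)
  qed
  moreover have "continuous_on UNIV (\<lambda>t. \<Sum>k<n. ?f k t)" for n
    by (intro continuous_intros zigzag_continuous)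
  ultimately show ?thesis
    unfolding curve_def by (intro uniform_limit_theorem) auto
qed

lemma digit_measurable: "(\<lambda>x. real_of_int (digit k x)) \<in> borel_measurable borel"
proof -
  have "real_of_int (trunc k x) = min (real_of_int \<lfloor>2 ^ k * clip x\<rfloor>) (2 ^ k - 1)" for k x
    by (simp add: trunc_def of_int_min)
  then show ?thesis unfolding digit_def of_int_diff of_int_mult clip_def by simp
qed

lemma encode_measurable:
  assumes "sets Q = sets (real_space :: ('n::finite \<Rightarrow> real) measure)"
  shows "encode \<in> borel_measurable Q"
proof -
  have "(\<lambda>w. w j) \<in> borel_measurable Q" for j using assms by (simp cong: measurable_cong_sets)
  note [measurable] = measurable_compose[OF this digit_measurable]
  show ?thesis unfolding encode_def ternary_def by measurable
qed

lemma continuous_on_Max_image: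
  fixes f :: "'n \<Rightarrow> 'a::topological_space \<Rightarrow> real"
  assumes "finite A" "A \<noteq> {}" "\<And>j. j \<in> A \<Longrightarrow> continuous_on S (f j)"
  shows "continuous_on S (\<lambda>t. Max ((\<lambda>j. f j t) ` A))"
  using assms
proof (induction A rule: finite_ne_induct)
  case (insert a A)
  then have "Max ((\<lambda>j. f j t) ` insert a A) = max (f a t) (Max ((\<lambda>j. f j t) ` A))" for t by simp
  then show ?case using insert by (auto intro!: continuous_on_max)
qed simp

lemma vmax_abs_le:
  fixes w u :: "'n::finite \<Rightarrow> real"
  assumes "\<And>j. 0 \<le> w j" "\<And>j. w j \<le> 1"
  shows "\<bar>vmax (\<lambda>j. w j * u j)\<bar> \<le> vmax (\<lambda>j. \<bar>u j\<bar>)"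
proof -
  have *: "\<bar>w j * u j\<bar> \<le> vmax (\<lambda>j. \<bar>u j\<bar>)" for j
  proof -
    have "\<bar>w j * u j\<bar> \<le> \<bar>u j\<bar>" using assms by (simp add: abs_mult mult_left_le_one_le)
    then show ?thesis using vmax_ge[of "\<lambda>j. \<bar>u j\<bar>" j] by linarith
  qed
  obtain j where "vmax (\<lambda>j. w j * u j) = w j * u j" using vmax_in[of "\<lambda>j. w j * u j"] by blast
  with *[of j] show ?thesis by (simp only:)
qed

text \<open>Selection of a weakly convergent subsequence, stated only for the integrands \<open>max\<^sub>j (w\<^sub>j u\<^sub>j)\<close>. The laws
  are transported to the real line by \<open>encode\<close>, and the limit is transported back by the curve.
  No continuity of \<open>encode\<close> is needed, as the integrands are composed with the curve only.\<close>

lemma unit_cube_compactness: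
  fixes Q :: "nat \<Rightarrow> ('n::finite \<Rightarrow> real) measure"
  assumes Q: "\<And>n. prob_space (Q n)" "\<And>n. sets (Q n) = sets real_space"
    and cube: "\<And>n. AE w in Q n. \<forall>j. 0 \<le> w j \<and> w j \<le> 1"
  obtains r M where "strict_mono r" "prob_space M" "sets M = sets real_space"
    "AE w in M. \<forall>j. 0 \<le> w j \<and> w j \<le> 1"
    "\<And>u. (\<lambda>n. \<integral>w. vmax (\<lambda>j. w j * u j) \<partial>Q (r n)) \<longlonglongrightarrow> (\<integral>w. vmax (\<lambda>j. w j * u j) \<partial>M)"
proof -
  define \<mu> where "\<mu> n = distr (Q n) borel encode" for n
  have enc: "encode \<in> borel_measurable (Q n)" for n by (rule encode_measurable[OF Q(2)])
  have rd: "real_distribution (\<mu> n)" for n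
    unfolding \<mu>_def by (rule prob_space.real_distribution_distr[OF Q(1) enc])
  have one: "measure (\<mu> n) {-1<..2} = 1" for n
  proof -
    have "encode -` {-1<..2} \<inter> space (Q n) = space (Q n)"
    proof -
      have "encode w \<in> {-1<..2}" for w using encode_range[of w] by simp
      then show ?thesis by blast
    qed
    then show ?thesis unfolding \<mu>_def by (subst measure_distr[OF enc]) (auto simp: prob_space.prob_space[OF Q(1)])
  qed
  have "tight \<mu>"
    unfolding tight_def by (intro conjI allI impI rd exI[of _ "-1"] exI[of _ 2]) (simp_all add: one)
  from tight_imp_convergent_subsubsequence[OF this strict_mono_id]
  obtain r N where r: "strict_mono r" and N: "real_distribution N" and conv: "weak_conv_m (\<mu> \<circ> r) N"
    by (auto simp: comp_assoc)
  interpret N: real_distribution N by (rule N)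
  have cm: "(\<lambda>t. curve t j) \<in> borel_measurable borel" for j :: 'n
    by (rule borel_measurable_continuous_onI[OF curve_continuous])
  have cN: "curve \<in> N \<rightarrow>\<^sub>M (real_space :: ('n \<Rightarrow> real) measure)"
    using cm by (intro measurable_PiM_single') (auto simp: space_PiM cong: measurable_cong_sets)
  define M :: "('n \<Rightarrow> real) measure" where "M = distr N real_space curve"
  have sM: "sets M = sets real_space" by (simp add: M_def)
  have vm: "(\<lambda>w. vmax (\<lambda>j. w j * u j)) \<in> borel_measurable (real_space :: ('n \<Rightarrow> real) measure)" for u by measurable
  show thesis
  proof (rule that[OF r _ sM])
    show "prob_space M" unfolding M_def by (rule N.prob_space_distr[OF cN])
    show "AE w in M. \<forall>j. 0 \<le> w j \<and> w j \<le> 1"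
      unfolding M_def
    proof (subst AE_distr_iff[OF cN])
      show "{w \<in> space real_space. \<forall>j. 0 \<le> w j \<and> w j \<le> 1} \<in> sets (real_space :: ('n \<Rightarrow> real) measure)" by measurable
    qed (simp add: curve_range)
    fix u :: "'n \<Rightarrow> real"
    define g where "g t = vmax (\<lambda>j. curve t j * u j)" for t
    have g_cont: "continuous_on UNIV g"
      unfolding g_def by (rule continuous_on_Max_image) (auto intro!: continuous_intros curve_continuous)
    have g_bd: "norm (g t) \<le> vmax (\<lambda>j. \<bar>u j\<bar>)" for t
      unfolding g_def real_norm_def by (rule vmax_abs_le) (auto simp: curve_range)
    have gm: "g \<in> borel_measurable borel" by (rule borel_measurable_continuous_onI[OF g_cont])
    have "(\<lambda>n. integral\<^sup>L ((\<mu> \<circ> r) n) g) \<longlonglongrightarrow> integral\<^sup>L N g"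
      by (rule weak_conv_imp_integral_bdd_continuous_conv[OF _ N conv _ g_bd])
        (use rd g_cont in \<open>auto simp: continuous_on_eq_continuous_at\<close>)
    moreover have "integral\<^sup>L (\<mu> n) g = (\<integral>w. vmax (\<lambda>j. w j * u j) \<partial>Q n)" for n
    proof -
      have "integral\<^sup>L (\<mu> n) g = (\<integral>w. g (encode w) \<partial>Q n)"
        unfolding \<mu>_def by (rule integral_distr[OF enc gm])
      also have "\<dots> = (\<integral>w. vmax (\<lambda>j. w j * u j) \<partial>Q n)"
      proof (rule integral_cong_AE)
        show "AE w in Q n. g (encode w) = vmax (\<lambda>j. w j * u j)"
          using cube by eventually_elim (simp add: g_def curve_encode clip_def)
        show "(\<lambda>w. vmax (\<lambda>j. w j * u j)) \<in> borel_measurable (Q n)"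
          using vm Q(2) by (simp cong: measurable_cong_sets)
      qed (rule measurable_compose[OF enc gm])
      finally show ?thesis .
    qed
    moreover have "integral\<^sup>L N g = (\<integral>w. vmax (\<lambda>j. w j * u j) \<partial>M)"
      unfolding M_def g_def by (rule integral_distr[OF cN vm, symmetric])
    ultimately show "(\<lambda>n. \<integral>w. vmax (\<lambda>j. w j * u j) \<partial>Q (r n)) \<longlonglongrightarrow> (\<integral>w. vmax (\<lambda>j. w j * u j) \<partial>M)"
      by simp
  qed
qed

section \<open>Homogeneity of max-stable cdfs\<close>

text \<open>Together with \<open>le_powr_bound\<close> this compares \<open>v\<close> and \<open>v\<^sup>p\<close> for \<open>p\<close> close to 1.\<close>

lemma powr_le_linear:
  fixes v p :: real
  assumes "0 < p" "p < 1" "0 \<le> v" shows "v powr p \<le> p * v + (1 - p)"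
proof (cases "v = 0")
  case False
  then show ?thesis using Youngs_inequality_0[of p "1 - p" v 1] assms by simp
qed (use assms in simp)

lemma le_powr_bound:
  fixes v p B :: real
  assumes "0 < p" "p < 1" "0 \<le> v" "v \<le> B" shows "v \<le> B powr (1 - p) * v powr p"
proof (cases "v = 0")
  case False
  have "v = v powr (1 - p) * v powr p" using False assms by (simp add: powr_add[symmetric])
  also have "\<dots> \<le> B powr (1 - p) * v powr p" using assms by (intro mult_right_mono powr_mono2) auto
  finally show ?thesis .
qed simp

text \<open>A tail of order \<open>1/s\<close> gives moments of every order \<open>p < 1\<close>, by a dyadic decomposition.\<close>

lemma integrable_powr_of_tail:
  fixes X :: "'a \<Rightarrow> real"
  assumes P: "prob_space P" and X[measurable]: "X \<in> borel_measurable P" and p: "0 < p" "p < 1" and L: "0 \<le> L"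
    and nn: "\<And>y. 0 \<le> X y"
    and tail: "\<And>s. 0 < s \<Longrightarrow> measure P {y \<in> space P. s < X y} \<le> L / s"
  shows "integrable P (\<lambda>y. X y powr p)"
proof -
  interpret prob_space P by fact
  define a where "a k = (2::real) ^ k" for k :: nat
  let ?E = "\<lambda>k. {y \<in> space P. a k < X y}"
  have "(\<integral>\<^sup>+y. ennreal (X y powr p) \<partial>P) \<le> (\<integral>\<^sup>+y. 1 + (\<Sum>k. ennreal (2 powr p * a k powr p) * indicator (?E k) y) \<partial>P)"
  proof (rule nn_integral_mono)
    fix y assume y: "y \<in> space P"
    show "ennreal (X y powr p) \<le> 1 + (\<Sum>k. ennreal (2 powr p * a k powr p) * indicator (?E k) y)"
    proof (cases "X y \<le> 1")
      case True
      have "X y powr p \<le> 1" using True p nn[of y] by (intro powr_le1) auto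
      then have "ennreal (X y powr p) \<le> 1" by simp
      then show ?thesis by (rule order_trans) simp
    next
      case False
      obtain n where "X y < a n" unfolding a_def using real_arch_pow[of 2 "X y"] by auto
      define m where "m = (LEAST n. X y \<le> a n)"
      have m: "X y \<le> a m" unfolding m_def by (rule LeastI[of _ n]) (use \<open>X y < a n\<close> in simp)
      have "m \<noteq> 0" using m False by (cases m) (auto simp: a_def)
      then obtain k where k: "m = Suc k" by (cases m) auto
      have ak: "a k < X y" using not_less_Least[of k "\<lambda>n. X y \<le> a n"] k m_def by simp
      have "X y powr p \<le> (2 * a k) powr p"
        using m k p False by (intro powr_mono2) (auto simp: a_def)
      also have "\<dots> = 2 powr p * a k powr p" by (simp add: powr_mult a_def)
      finally have "ennreal (X y powr p) \<le> ennreal (2 powr p * a k powr p) * indicator (?E k) y"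
        using ak y by (simp add: ennreal_leI)
      also have "\<dots> \<le> (\<Sum>k. ennreal (2 powr p * a k powr p) * indicator (?E k) y)"
      proof -
        have "f k \<le> suminf f" for f :: "nat \<Rightarrow> ennreal" using sum_le_suminf[of f "{k}"] by simp
        then show ?thesis .
      qed
      finally show ?thesis by (rule order_trans) simp
    qed
  qed
  also have "\<dots> = 1 + (\<Sum>k. ennreal (2 powr p * a k powr p) * emeasure P (?E k))"
    by (subst nn_integral_add) (auto simp: nn_integral_suminf nn_integral_cmult emeasure_space_1)
  also have "\<dots> \<le> 1 + (\<Sum>k. ennreal (2 powr p * L * (2 powr (p - 1)) ^ k))"
  proof (intro add_left_mono suminf_le)
    fix k
    have "emeasure P (?E k) \<le> ennreal (L / a k)"
      unfolding emeasure_eq_measure using tail[of "a k"] by (intro ennreal_leI) (auto simp: a_def)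
    then have "ennreal (2 powr p * a k powr p) * emeasure P (?E k) \<le> ennreal (2 powr p * a k powr p) * ennreal (L / a k)"
      by (rule mult_left_mono) simp
    also have "\<dots> = ennreal (2 powr p * a k powr p * (L / a k))"
      using L by (intro ennreal_mult'[symmetric]) simp
    also have "2 powr p * a k powr p * (L / a k) = 2 powr p * L * (2 powr (p - 1)) ^ k"
    proof -
      have "a k powr p / a k = (2 powr (p - 1)) ^ k"
        unfolding a_def by (simp add: powr_realpow[symmetric] powr_powr powr_diff[symmetric] algebra_simps)
      moreover have "2 powr p * a k powr p * (L / a k) = 2 powr p * L * (a k powr p / a k)" by simp
      ultimately show ?thesis by (simp only:)
    qed
    finally show "ennreal (2 powr p * a k powr p) * emeasure P (?E k) \<le> ennreal (2 powr p * L * (2 powr (p - 1)) ^ k)" .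
  qed simp_all
  also have "(\<Sum>k. ennreal (2 powr p * L * (2 powr (p - 1)) ^ k)) = ennreal (\<Sum>k. 2 powr p * L * (2 powr (p - 1)) ^ k)"
  proof (rule suminf_ennreal2)
    have "2 powr (p - 1) < (1 :: real)" using p by (simp add: powr_less_one)
    then show "summable (\<lambda>k. 2 powr p * L * (2 powr (p - 1)) ^ k)" by (intro summable_mult summable_geometric) simp
  qed (use L in simp)
  also have "1 + \<dots> < \<infinity>" by simp
  finally have "(\<integral>\<^sup>+y. ennreal (X y powr p) \<partial>P) < \<infinity>" .
  then show ?thesis by (intro integrableI_nonneg) auto
qed


lemma real_law_margin_limit:
  fixes X :: "nat \<Rightarrow> 'n::finite \<Rightarrow> real"
  assumes P: "real_law P" and inc: "\<And>i. incseq (\<lambda>n. X n i)" and j: "\<And>n. X n j = x"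
    and top: "\<And>i. i \<noteq> j \<Longrightarrow> filterlim (\<lambda>n. X n i) at_top sequentially"
  shows "(\<lambda>n. real_cdf P (X n)) \<longlonglongrightarrow> margin_cdf P j x"
proof -
  interpret real_law P by fact
  have "(\<lambda>n. measure P {y. \<forall>i. y i \<le> X n i}) \<longlonglongrightarrow> measure P (\<Union>n. {y. \<forall>i. y i \<le> X n i})"
    using P_box_sets(1) incseqD[OF inc]
    by (intro finite_Lim_measure_incseq) (auto simp: incseq_def intro: order_trans)
  moreover have "(\<Union>n. {y. \<forall>i. y i \<le> X n i}) = {y. y j \<le> x}"
  proof (intro antisym subsetI)
    fix y assume "y \<in> {y. y j \<le> x}"
    then have "\<forall>\<^sub>F n in sequentially. y i \<le> X n i" for i
      using top[of i] j by (cases "i = j") (auto simp: filterlim_at_top)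
    then have "\<forall>\<^sub>F n in sequentially. \<forall>i. y i \<le> X n i" by (simp add: eventually_all_finite)
    then show "y \<in> (\<Union>n. {y. \<forall>i. y i \<le> X n i})" unfolding eventually_sequentially by blast
  qed (use j in force)
  ultimately show ?thesis by (simp add: real_cdf_eq margin_cdf_eq)
qed

context frechet_margins
begin

text \<open>The point whose tails are \<open>u\<close>.\<close>

abbreviation xinv :: "('n \<Rightarrow> real) \<Rightarrow> 'n \<Rightarrow> real" where
  "xinv u \<equiv> \<lambda>j. etail_inv (\<gamma> j) (\<sigma> j) (u j)"

lemma real_law_P: "real_law P" ..

text \<open>The margins determine the affine norming in the definition of max-stability; in the coordinates
  \<open>u = etail x\<close>, max-stability becomes homogeneity.\<close>

lemma cdf_homogeneous:
  assumes ms: "max_stable P" and t: "0 < t" and u: "\<And>j. 0 < u j"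
  shows "real_cdf P (xinv (\<lambda>j. u j / t)) powr t = real_cdf P (xinv u)"
proof -
  obtain a b where a: "\<And>j. 0 < a j" and ab: "\<And>x. real_cdf P (\<lambda>j. a j * x j + b j) powr t = real_cdf P x"
    using ms t unfolding max_stable_def by meson
  have marg: "margin_cdf P j (a j * x + b j) powr t = margin_cdf P j x" for j x
  proof -
    define X where "X n i = (if i = j then x else real n)" for n i
    have "(\<lambda>n. real_cdf P (X n)) \<longlonglongrightarrow> margin_cdf P j x"
      by (rule real_law_margin_limit[OF real_law_P])
        (auto simp: X_def incseq_def intro: filterlim_real_sequentially)
    moreover have "(\<lambda>n. real_cdf P (\<lambda>i. a i * X n i + b i)) \<longlonglongrightarrow> margin_cdf P j (a j * x + b j)"
    proof (rule real_law_margin_limit[OF real_law_P])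
      show "incseq (\<lambda>n. a i * X n i + b i)" for i
        using a[of i] by (auto simp: X_def incseq_def)
      show "filterlim (\<lambda>n. a i * X n i + b i) at_top sequentially" if "i \<noteq> j" for i
      proof -
        have "filterlim (\<lambda>n. b i + a i * real n) at_top sequentially"
          by (intro filterlim_tendsto_add_at_top[OF tendsto_const]
              filterlim_tendsto_pos_mult_at_top[OF tendsto_const a] filterlim_real_sequentially)
        then show ?thesis using that by (simp add: X_def add.commute)
      qed
    qed (simp add: X_def)
    then have "(\<lambda>n. real_cdf P (\<lambda>i. a i * X n i + b i) powr t) \<longlonglongrightarrow> margin_cdf P j (a j * x + b j) powr t"
      using t by (intro tendsto_powr' tendsto_const) (auto simp: real_cdf_eq)
    ultimately show ?thesis unfolding ab by (rule LIMSEQ_unique[rotated])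
  qed
  have eq: "a j * xinv u j + b j = xinv (\<lambda>j. u j / t) j" for j
  proof -
    define y where "y = a j * xinv u j + b j"
    define m where "m = margin_cdf P j y"
    have mt: "m powr t = exp (- (c j * u j))"
      unfolding m_def y_def by (simp add: marg margin_inv u)
    have "m \<noteq> 0" using mt t by auto
    then have "0 < m" using margin_nonneg[of j y] by (simp add: m_def)
    then have m: "m = exp (- (c j * u j) / t)"
    proof -
      have "m = (m powr t) powr (1 / t)" using \<open>0 < m\<close> t by (simp add: powr_powr)
      then show ?thesis unfolding mt by (simp add: powr_def)
    qed
    have cu: "0 < c j * u j / t" using c_pos u t by simp
    then have "m < 1" unfolding m by simp
    then have inn: "inside (\<gamma> j) (\<sigma> j) y"
      using margin_zero[of j y] margin_one[of j y] \<open>m \<noteq> 0\<close> unfolding m_def by auto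
    then have "c j * etail (\<gamma> j) (\<sigma> j) y = c j * u j / t"
      using m unfolding m_def by (simp add: margin)
    then have "c j * etail (\<gamma> j) (\<sigma> j) y = c j * (u j / t)" by simp
    then have "etail (\<gamma> j) (\<sigma> j) y = u j / t" using c_pos[of j] by (simp only: mult_left_cancel[OF less_imp_neq[OF c_pos, symmetric]])
    then show ?thesis using etail_inv_etail[OF sigma_pos inn] by (simp add: y_def)
  qed
  show ?thesis using ab[of "xinv u"] by (simp only: eq)
qed

lemma union_bound: "1 - real_cdf P x \<le> (\<Sum>j\<in>UNIV. 1 - margin_cdf P j (x j))"
proof -
  have "1 - real_cdf P x = measure P (space P - {y. \<forall>j. y j \<le> x j})"
    using prob_compl[OF P_box_sets(1)] by (simp add: real_cdf_eq)
  also have "space P - {y. \<forall>j. y j \<le> x j} = (\<Union>j\<in>UNIV. space P - {y. y j \<le> x j})" by auto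
  also have "measure P \<dots> \<le> (\<Sum>j\<in>UNIV. measure P (space P - {y. y j \<le> x j}))"
    using sets.compl_sets[OF P_box_sets(2)] by (intro finite_measure_subadditive_finite image_subsetI) simp_all
  also have "\<dots> = (\<Sum>j\<in>UNIV. 1 - margin_cdf P j (x j))"
    using prob_compl[OF P_box_sets(2)] by (simp add: margin_cdf_eq)
  finally show ?thesis .
qed

text \<open>If the cdf vanished at one point, then by homogeneity it would vanish arbitrarily close to the upper
  endpoints, where the union bound makes it positive.\<close>

lemma cdf_xinv_pos:
  assumes ms: "max_stable P" and u: "\<And>j. 0 < u j"
  shows "0 < real_cdf P (xinv u)"
proof -
  have "(\<lambda>n. \<Sum>j\<in>UNIV. 1 - exp (- (c j * (u j * (1 / real (Suc n)))))) \<longlonglongrightarrow> (\<Sum>j\<in>UNIV. 1 - exp (- (c j * (u j * 0))))"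
    by (intro tendsto_intros LIMSEQ_inverse_real_of_nat[unfolded inverse_eq_divide])
  then have "\<forall>\<^sub>F n in sequentially. (\<Sum>j\<in>UNIV. 1 - exp (- (c j * (u j * (1 / real (Suc n)))))) < 1"
    by (rule order_tendstoD) simp
  then obtain n where n: "(\<Sum>j\<in>UNIV. 1 - exp (- (c j * (u j * (1 / real (Suc n)))))) < 1"
    unfolding eventually_sequentially by blast
  let ?t = "real (Suc n)"
  have "1 - real_cdf P (xinv (\<lambda>j. u j / ?t)) \<le> (\<Sum>j\<in>UNIV. 1 - margin_cdf P j (xinv (\<lambda>j. u j / ?t) j))"
    by (rule union_bound)
  also have "\<dots> = (\<Sum>j\<in>UNIV. 1 - exp (- (c j * (u j * (1 / ?t)))))"
    using u by (simp add: margin_inv)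
  also have "\<dots> < 1" by (rule n)
  finally have "0 < real_cdf P (xinv (\<lambda>j. u j / ?t))" by simp
  then have "0 < real_cdf P (xinv (\<lambda>j. u j / ?t)) powr ?t" by simp
  also have "real_cdf P (xinv (\<lambda>j. u j / ?t)) powr ?t = real_cdf P (xinv u)"
    by (rule cdf_homogeneous[OF ms _ u]) simp
  finally show ?thesis .
qed

text \<open>The events \<open>etail (X\<^sub>j) \<in> [1/n, n)\<close> exhaust the space.\<close>

lemma AE_inside: "AE y in P. \<forall>j. inside (\<gamma> j) (\<sigma> j) (y j)"
proof -
  have "AE y in P. inside (\<gamma> j) (\<sigma> j) (y j)" for j
  proof -
    let ?l = "\<lambda>n. etail_inv (\<gamma> j) (\<sigma> j) (real (Suc n))" and ?r = "\<lambda>n. etail_inv (\<gamma> j) (\<sigma> j) (1 / real (Suc n))"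
    define E where "E n = {y. y j \<le> ?r n} - {y. y j \<le> ?l n}" for n
    have Es: "E n \<in> sets P" for n unfolding E_def using P_box_sets(2) by (intro sets.Diff)
    then have UE: "(\<Union>n. E n) \<in> sets P" by auto
    have "exp (- (c j * (1 / real (Suc n)))) - exp (- (c j * real (Suc n))) \<le> measure P (\<Union>n. E n)" for n
    proof -
      have "?l n \<le> ?r n"
        using sigma_pos[of j]
        by (subst etail_inv_le_iff)
          (auto simp: etail_etail_inv inside_imp_above_end inside_etail_inv field_simps simp del: of_nat_Suc
            intro: order_trans[OF _ mult_mono[of 1 _ 1]])
      then have "measure P (E n) = margin_cdf P j (?r n) - margin_cdf P j (?l n)"
        unfolding E_def margin_cdf_eq using P_box_sets(2) by (intro finite_measure_Diff) auto
      then have "exp (- (c j * (1 / real (Suc n)))) - exp (- (c j * real (Suc n))) = measure P (E n)"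
        by (simp add: margin_inv del: of_nat_Suc)
      also have "\<dots> \<le> measure P (\<Union>n. E n)" using UE by (intro finite_measure_mono) auto
      finally show ?thesis .
    qed
    moreover have "(\<lambda>n. exp (- (c j * (1 / real (Suc n)))) - exp (- (c j * real (Suc n)))) \<longlonglongrightarrow> exp (- (c j * 0)) - 0"
    proof (intro tendsto_intros LIMSEQ_inverse_real_of_nat[unfolded inverse_eq_divide])
      show "(\<lambda>n. exp (- (c j * real (Suc n)))) \<longlonglongrightarrow> 0"
        using c_pos[of j]
        by (intro filterlim_compose[OF exp_at_bot] filterlim_uminus_at_bot[THEN iffD2])
          (auto intro!: filterlim_tendsto_pos_mult_at_top[OF tendsto_const]
            filterlim_compose[OF filterlim_real_sequentially filterlim_Suc] simp del: of_nat_Suc)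
    qed
    ultimately have "1 \<le> measure P (\<Union>n. E n)" by (intro LIMSEQ_le_const2[of _ 1]) auto
    then have "measure P (\<Union>n. E n) = 1" using prob_le_1[of "\<Union>n. E n"] by linarith
    then have "AE y in P. y \<in> (\<Union>n. E n)" using UE prob_eq_1 by blast
    then show ?thesis
    proof eventually_elim
      case (elim y)
      then obtain n where n: "?l n < y j" "y j \<le> ?r n" by (auto simp: E_def not_le simp del: of_nat_Suc)
      have "inside (\<gamma> j) (\<sigma> j) (?l n)" "inside (\<gamma> j) (\<sigma> j) (?r n)" using sigma_pos by (auto intro: inside_etail_inv)
      moreover have "\<gamma> j * ?l n \<le> \<gamma> j * y j \<or> \<gamma> j * ?r n \<le> \<gamma> j * y j"
        using n by (cases "0 \<le> \<gamma> j") (auto intro: mult_left_mono mult_left_mono_neg)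
      ultimately show ?case unfolding inside_def by linarith
    qed
  qed
  then show ?thesis by (simp add: AE_all_countable)
qed

lemma le_etail_inv_iff:
  assumes "inside (\<gamma> j) (\<sigma> j) x" "0 < v"
  shows "x \<le> etail_inv (\<gamma> j) (\<sigma> j) v \<longleftrightarrow> v \<le> etail (\<gamma> j) (\<sigma> j) x"
proof -
  have "x \<le> etail_inv (\<gamma> j) (\<sigma> j) v \<longleftrightarrow> etail_inv (\<gamma> j) (\<sigma> j) (etail (\<gamma> j) (\<sigma> j) x) \<le> etail_inv (\<gamma> j) (\<sigma> j) v"
    by (simp add: etail_inv_etail[OF sigma_pos assms(1)])
  also have "\<dots> \<longleftrightarrow> v \<le> etail (\<gamma> j) (\<sigma> j) x"
    using etail_inv_le_iff[of "\<sigma> j" "etail (\<gamma> j) (\<sigma> j) x" "\<gamma> j" "etail_inv (\<gamma> j) (\<sigma> j) v"]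
      etail_pos[OF sigma_pos assms(1)] inside_imp_above_end[OF inside_etail_inv[OF sigma_pos[of j] assms(2)], of "\<gamma> j"]
      etail_etail_inv[OF sigma_pos[of j] assms(2), of "\<gamma> j"] sigma_pos[of j] by simp
  finally show ?thesis .
qed

text \<open>The margins of \<open>Y = 1 / etail X\<close> are Frechet laws.\<close>

definition Y :: "('n \<Rightarrow> real) \<Rightarrow> 'n \<Rightarrow> real" where
  "Y y j = 1 / etail (\<gamma> j) (\<sigma> j) (y j)"

text \<open>The exponent function of the cdf in the coordinates \<open>u = etail x\<close>.\<close>

definition L :: "('n \<Rightarrow> real) \<Rightarrow> real" where
  "L u = - ln (real_cdf P (xinv u))"

lemma Y_nonneg: "0 \<le> Y y j" by (simp add: Y_def)

lemma AE_Y_pos: "AE y in P. \<forall>j. 0 < Y y j"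
  using AE_inside by eventually_elim (auto simp: Y_def intro: etail_pos sigma_pos)

lemma Y_measurable [measurable]: "(\<lambda>y. Y y j) \<in> borel_measurable P"
  unfolding Y_def etail_def by measurable

lemma cdf_xinv:
  assumes "max_stable P" "\<And>j. 0 < u j" shows "real_cdf P (xinv u) = exp (- L u)"
  using cdf_xinv_pos[OF assms] by (simp add: L_def)

lemma L_ge:
  assumes ms: "max_stable P" and u: "\<And>j. 0 < u j" shows "c j * u j \<le> L u"
proof -
  have "exp (- L u) \<le> exp (- (c j * u j))"
    using real_cdf_le_margin[of "xinv u" j] by (simp add: cdf_xinv[where u = u, OF ms u] margin_inv[OF u])
  then show ?thesis by simp
qed

lemma L_pos: assumes "max_stable P" "\<And>j. 0 < u j" shows "0 < L u"
  using L_ge[where u = u, OF assms, of undefined] c_pos[of undefined] assms(2)[of undefined]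
  by (meson less_le_trans mult_pos_pos)

lemma cdf_scaled:
  assumes ms: "max_stable P" and u: "\<And>j. 0 < u j" and s: "0 < s"
  shows "real_cdf P (xinv (\<lambda>j. u j / s)) = exp (- (L u / s))"
proof -
  define g where "g = real_cdf P (xinv (\<lambda>j. u j / s))"
  have "0 < g" unfolding g_def by (rule cdf_xinv_pos[OF ms]) (use u s in simp)
  moreover have "g powr s = exp (- L u)"
    unfolding g_def cdf_homogeneous[where u = u, OF ms s u] cdf_xinv[where u = u, OF ms u] ..
  moreover have "g = (g powr s) powr (1 / s)" using \<open>0 < g\<close> s by (simp add: powr_powr)
  ultimately have "g = exp (- L u) powr (1 / s)" by (simp only:)
  then show ?thesis by (simp add: g_def powr_def)
qed

text \<open>The weighted maximum \<open>max\<^sub>j (Y\<^sub>j u\<^sub>j)\<close>.\<close>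

definition YM :: "('n \<Rightarrow> real) \<Rightarrow> ('n \<Rightarrow> real) \<Rightarrow> real" where
  "YM u y = vmax (\<lambda>j. Y y j * u j)"

lemma YM_measurable [measurable]: "YM u \<in> borel_measurable P"
  unfolding YM_def by measurable

lemma YM_cdf:
  assumes ms: "max_stable P" and u: "\<And>j. 0 < u j"
  shows "measure P {y. YM u y \<le> s} = (if s \<le> 0 then 0 else exp (- (L u / s)))"
proof -
  have m: "{y. YM u y \<le> s} \<in> sets P"
  proof -
    have "{y \<in> space P. YM u y \<le> s} \<in> sets P" by measurable
    then show ?thesis by simp
  qed
  show ?thesis
  proof (cases "s \<le> 0")
    case True
    have "AE y in P. y \<notin> {y. YM u y \<le> s}"
      using AE_Y_pos
    proof eventually_elim
      case (elim y)
      have "0 < Y y undefined * u undefined" using elim u by simp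
      then have "0 < YM u y" unfolding YM_def using vmax_ge[of "\<lambda>j. Y y j * u j" undefined] by (rule less_le_trans)
      then show ?case using True by simp
    qed
    then show ?thesis using True prob_eq_0[OF m] by simp
  next
    case False
    then have s: "0 < s" by simp
    have "measure P {y. YM u y \<le> s} = measure P {y. \<forall>j. y j \<le> xinv (\<lambda>j. u j / s) j}"
    proof (rule finite_measure_eq_AE[OF _ m P_box_sets(1)])
      show "AE y in P. (y \<in> {y. YM u y \<le> s}) = (y \<in> {y. \<forall>j. y j \<le> xinv (\<lambda>j. u j / s) j})"
        using AE_inside
      proof eventually_elim
        case (elim y)
        have "Y y j * u j \<le> s \<longleftrightarrow> y j \<le> xinv (\<lambda>j. u j / s) j" for j
          using le_etail_inv_iff[of j "y j" "u j / s"] etail_pos[OF sigma_pos[of j], of "\<gamma> j" "y j"] elim u[of j] s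
          by (simp add: Y_def field_simps)
        then show ?case by (simp add: YM_def vmax_le_iff)
      qed
    qed
    then show ?thesis using cdf_scaled[where u = u, OF ms u s] False by (simp add: real_cdf_eq)
  qed
qed

abbreviation ones :: "'n \<Rightarrow> real" where "ones \<equiv> \<lambda>_. 1"

text \<open>The weighted maxima have the same law up to scaling.\<close>

lemma YM_distr:
  assumes ms: "max_stable P" and u: "\<And>j. 0 < u j"
  shows "distr P borel (YM u) = distr P borel (\<lambda>y. L u / L ones * YM ones y)"
proof (rule cdf_unique)
  have r: "0 < L u / L ones" using L_pos[where u = u, OF ms u] L_pos[where u = ones, OF ms] by simp
  have cdf: "cdf (distr P borel X) s = measure P {y. X y \<le> s}" if "X \<in> borel_measurable P" for X s
    unfolding cdf_def using that by (subst measure_distr) (auto simp: vimage_def)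
  show "cdf (distr P borel (YM u)) = cdf (distr P borel (\<lambda>y. L u / L ones * YM ones y))"
  proof
    fix s
    have "{y. L u / L ones * YM ones y \<le> s} = {y. YM ones y \<le> s / (L u / L ones)}"
      using r by (simp only: pos_le_divide_eq mult.commute)
    then have "cdf (distr P borel (\<lambda>y. L u / L ones * YM ones y)) s = measure P {y. YM ones y \<le> s / (L u / L ones)}"
      by (subst cdf) auto
    also have "\<dots> = measure P {y. YM u y \<le> s}"
      unfolding YM_cdf[where u = u, OF ms u] YM_cdf[where u = ones, OF ms zero_less_one]
      using L_pos[where u = u, OF ms u] L_pos[where u = ones, OF ms] by (auto simp: divide_le_0_iff mult_le_0_iff zero_le_mult_iff field_simps)
    finally show "cdf (distr P borel (YM u)) s = cdf (distr P borel (\<lambda>y. L u / L ones * YM ones y)) s"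
      by (subst cdf) auto
  qed
qed (auto intro!: real_distribution_distr)

lemma YM_nonneg: "(\<And>j. 0 \<le> u j) \<Longrightarrow> 0 \<le> YM u y"
  unfolding YM_def by (intro vmax_nonneg mult_nonneg_nonneg Y_nonneg)

lemma YM_powr_integrable:
  assumes ms: "max_stable P" and p: "0 < p" "p < 1" and u: "\<And>j. 0 < u j"
  shows "integrable P (\<lambda>y. YM u y powr p)"
proof (rule integrable_powr_of_tail[OF prob_space_axioms YM_measurable p, of "L u"])
  show "0 \<le> L u" using L_pos[where u = u, OF ms u] by simp
  show "0 \<le> YM u y" for y by (rule YM_nonneg) (use u in \<open>simp add: less_imp_le\<close>)
  show "measure P {y \<in> space P. s < YM u y} \<le> L u / s" if "0 < s" for s
  proof -
    have "{y \<in> space P. YM u y \<le> s} \<in> sets P" by measurable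
    then have "measure P (space P - {y. YM u y \<le> s}) = 1 - measure P {y. YM u y \<le> s}"
      by (intro prob_compl) simp
    moreover have "space P - {y. YM u y \<le> s} = {y \<in> space P. s < YM u y}" by auto
    ultimately have "measure P {y \<in> space P. s < YM u y} = 1 - exp (- (L u / s))"
      using that by (simp add: YM_cdf[where u = u, OF ms u])
    then show ?thesis using exp_ge_add_one_self[of "- (L u / s)"] by simp
  qed
qed

lemma YM_moment:
  assumes ms: "max_stable P" and p: "0 < p" "p < 1" and u: "\<And>j. 0 < u j"
  shows "(\<integral>y. YM u y powr p \<partial>P) = (L u / L ones) powr p * (\<integral>y. YM ones y powr p \<partial>P)"
proof -
  have r: "0 < L u / L ones" using L_pos[where u = u, OF ms u] L_pos[where u = ones, OF ms] by simp
  have "(\<integral>y. YM u y powr p \<partial>P) = (\<integral>x. x powr p \<partial>distr P borel (YM u))"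
    by (rule integral_distr[symmetric]) auto
  also have "\<dots> = (\<integral>y. (L u / L ones * YM ones y) powr p \<partial>P)"
    unfolding YM_distr[where u = u, OF ms u] by (rule integral_distr) auto
  also have "\<dots> = (\<integral>y. (L u / L ones) powr p * YM ones y powr p \<partial>P)"
    using r YM_nonneg[of ones] by (intro Bochner_Integration.integral_cong refl powr_mult)
  finally show ?thesis by simp
qed

lemma YM_moment_pos:
  assumes ms: "max_stable P" and p: "0 < p" "p < 1"
  shows "0 < (\<integral>y. YM ones y powr p \<partial>P)"
proof -
  have pos: "AE y in P. 0 < YM ones y powr p"
    using AE_Y_pos
  proof eventually_elim
    case (elim y)
    have "0 < Y y undefined * ones undefined" using elim by simp
    also have "\<dots> \<le> YM ones y" unfolding YM_def by (rule vmax_ge)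
    finally have "0 < YM ones y" .
    then show ?case by simp
  qed
  have int: "integrable P (\<lambda>y. YM ones y powr p)" by (rule YM_powr_integrable[OF ms p]) simp
  have "(\<integral>y. YM ones y powr p \<partial>P) \<noteq> 0"
  proof
    assume "(\<integral>y. YM ones y powr p \<partial>P) = 0"
    then have "AE y in P. YM ones y powr p = 0" using integral_nonneg_eq_0_iff_AE[OF int] by simp
    with pos have "AE y in P. False" by eventually_elim simp
    then show False by simp
  qed
  moreover have "0 \<le> (\<integral>y. YM ones y powr p \<partial>P)" by (intro Bochner_Integration.integral_nonneg) simp
  ultimately show ?thesis by (metis less_le)
qed

end

section \<open>The spectral representation of max-stable laws\<close>

context frechet_margins
begin

text \<open>The law of \<open>W = Y / max\<^sub>j Y\<^sub>j\<close> under the measure whose density is proportional to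
  \<open>(max\<^sub>j Y\<^sub>j) ^ p\<close>.\<close>

definition tilted :: "real \<Rightarrow> ('n \<Rightarrow> real) measure" where
  "tilted p = distr (density P (\<lambda>y. ennreal (YM ones y powr p / (\<integral>y. YM ones y powr p \<partial>P)))) real_space
     (\<lambda>y j. Y y j / YM ones y)"

lemma AE_YM_pos: "AE y in P. 0 < YM ones y"
  using AE_Y_pos
proof eventually_elim
  case (elim y)
  have "0 < Y y undefined * ones undefined" using elim by simp
  also have "\<dots> \<le> YM ones y" unfolding YM_def by (rule vmax_ge)
  finally show ?case .
qed

lemma W_measurable: "(\<lambda>y j. Y y j / YM ones y) \<in> density P f \<rightarrow>\<^sub>M real_space"
  by (intro measurable_PiM_single') (auto simp: space_PiM)

lemma W_vmax: "vmax (\<lambda>j. Y y j / YM ones y * u j) = YM u y / YM ones y"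
proof -
  have "vmax (\<lambda>j. Y y j / YM ones y * u j) = vmax (\<lambda>j. (1 / YM ones y) * (Y y j * u j))"
    by (simp add: mult.commute)
  also have "\<dots> = (1 / YM ones y) * YM u y"
    unfolding YM_def by (rule vmax_cmult) (use YM_nonneg[of ones] in \<open>simp add: YM_def\<close>)
  finally show ?thesis by simp
qed

lemma tilted_prob:
  assumes ms: "max_stable P" and p: "0 < p" "p < 1" shows "prob_space (tilted p)"
proof -
  let ?K = "\<integral>y. YM ones y powr p \<partial>P"
  have int: "integrable P (\<lambda>y. YM ones y powr p)" by (rule YM_powr_integrable[OF ms p]) simp
  have K: "0 < ?K" by (rule YM_moment_pos[OF ms p])
  have "prob_space (density P (\<lambda>y. ennreal (YM ones y powr p / ?K)))"
  proof
    have "emeasure (density P (\<lambda>y. ennreal (YM ones y powr p / ?K))) (space P) = (\<integral>\<^sup>+y. ennreal (YM ones y powr p / ?K) \<partial>P)"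
      by (subst emeasure_density) (auto intro!: nn_integral_cong simp del: space_P)
    also have "\<dots> = ennreal (\<integral>y. YM ones y powr p / ?K \<partial>P)"
      using int K by (intro nn_integral_eq_integral) auto
    also have "\<dots> = 1" using K by simp
    finally show "emeasure (density P (\<lambda>y. ennreal (YM ones y powr p / ?K))) (space (density P (\<lambda>y. ennreal (YM ones y powr p / ?K)))) = 1"
      by simp
  qed
  then show ?thesis unfolding tilted_def by (rule prob_space.prob_space_distr) (rule W_measurable)
qed

lemma AE_tilted:
  assumes "{w \<in> space real_space. A w} \<in> sets real_space" and "AE y in P. A (\<lambda>j. Y y j / YM ones y)"
  shows "AE w in tilted p. A w"
  unfolding tilted_def
  by (subst AE_distr_iff[OF W_measurable assms(1)], subst AE_density) (use assms(2) in auto)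

lemma tilted_cube: "AE w in tilted p. \<forall>j. 0 \<le> w j \<and> w j \<le> 1"
proof (rule AE_tilted)
  show "{w \<in> space real_space. \<forall>j. 0 \<le> w j \<and> w j \<le> 1} \<in> sets (real_space :: ('n \<Rightarrow> real) measure)" by measurable
  show "AE y in P. \<forall>j. 0 \<le> Y y j / YM ones y \<and> Y y j / YM ones y \<le> 1"
    using AE_YM_pos
  proof eventually_elim
    case (elim y)
    have "Y y j \<le> YM ones y" for j using vmax_ge[of "\<lambda>j. Y y j * ones j" j] by (simp add: YM_def)
    then show ?case using elim Y_nonneg by simp
  qed
qed

lemma tilted_moment:
  assumes ms: "max_stable P" and p: "0 < p" "p < 1" and u: "\<And>j. 0 < u j"
  shows "(\<integral>w. vmax (\<lambda>j. w j * u j) powr p \<partial>tilted p) = (L u / L ones) powr p"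
proof -
  let ?K = "\<integral>y. YM ones y powr p \<partial>P"
  have K: "0 < ?K" by (rule YM_moment_pos[OF ms p])
  have m: "(\<lambda>w. vmax (\<lambda>j. w j * u j) powr p) \<in> borel_measurable (real_space :: ('n \<Rightarrow> real) measure)" by measurable
  have "(\<integral>w. vmax (\<lambda>j. w j * u j) powr p \<partial>tilted p) =
      (\<integral>y. (YM u y / YM ones y) powr p \<partial>density P (\<lambda>y. ennreal (YM ones y powr p / ?K)))"
    unfolding tilted_def by (subst integral_distr[OF W_measurable m]) (simp only: W_vmax)
  also have "\<dots> = (\<integral>y. (YM ones y powr p / ?K) *\<^sub>R (YM u y / YM ones y) powr p \<partial>P)"
    using K by (intro integral_density) auto
  also have "\<dots> = (\<integral>y. YM u y powr p / ?K \<partial>P)"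
  proof (rule integral_cong_AE)
    show "AE y in P. (YM ones y powr p / ?K) *\<^sub>R (YM u y / YM ones y) powr p = YM u y powr p / ?K"
      using AE_YM_pos
    proof eventually_elim
      case (elim y)
      have "0 \<le> YM u y" by (rule YM_nonneg) (use u in \<open>simp add: less_imp_le\<close>)
      then have "(YM u y / YM ones y) powr p = YM u y powr p / YM ones y powr p"
        using elim by (simp add: powr_divide)
      then show ?case using elim by simp
    qed
  qed measurable
  also have "\<dots> = (\<integral>y. YM u y powr p \<partial>P) / ?K" by simp
  also have "\<dots> = (L u / L ones) powr p" using K by (simp add: YM_moment[where u = u, OF ms p u])
  finally show ?thesis .
qed

lemma tilted_bounds:
  assumes ms: "max_stable P" and p: "0 < p" "p < 1" and u: "\<And>j. 0 < u j"
  defines "r \<equiv> L u / L ones" and "b \<equiv> \<integral>w. vmax (\<lambda>j. w j * u j) \<partial>tilted p"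
  shows "(r powr p - (1 - p)) / p \<le> b" "b \<le> vmax u powr (1 - p) * r powr p"
proof -
  interpret T: prob_space "tilted p" by (rule tilted_prob[OF ms p])
  have s: "sets (tilted p) = sets real_space" by (simp add: tilted_def)
  define v where "v w = vmax (\<lambda>j. w j * u j)" for w :: "'n \<Rightarrow> real"
  have "v \<in> borel_measurable real_space" unfolding v_def by measurable
  then have vm[measurable]: "v \<in> borel_measurable (tilted p)" using s by (simp cong: measurable_cong_sets)
  define B where "B = vmax u"
  have v: "AE w in tilted p. 0 \<le> v w \<and> v w \<le> B"
    using tilted_cube
  proof eventually_elim
    case (elim w)
    have "0 \<le> v w" unfolding v_def by (intro vmax_nonneg mult_nonneg_nonneg) (use elim u in \<open>auto simp: less_imp_le\<close>)
    moreover have "w j * u j \<le> vmax u" for j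
      using elim u[of j] vmax_ge[of u j] by (intro order_trans[OF mult_left_le_one_le]) auto
    then have "v w \<le> B" unfolding v_def B_def vmax_le_iff by blast
    ultimately show ?case by blast
  qed
  have nv: "AE w in tilted p. norm (v w) \<le> B" "AE w in tilted p. norm (v w powr p) \<le> B powr p"
    using v by (eventually_elim, use p in \<open>auto intro: powr_mono2\<close>)+
  have iv: "integrable (tilted p) v" by (rule T.integrable_const_bound[OF nv(1) vm])
  have ip: "integrable (tilted p) (\<lambda>w. v w powr p)" by (rule T.integrable_const_bound[OF nv(2)]) measurable
  have mom: "(\<integral>w. v w powr p \<partial>tilted p) = r powr p"
    unfolding v_def r_def by (rule tilted_moment[OF ms p u])
  have "r powr p \<le> (\<integral>w. p * v w + (1 - p) \<partial>tilted p)"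
    unfolding mom[symmetric] using v powr_le_linear[OF p] iv ip
    by (intro integral_mono_AE) (auto elim!: eventually_mono)
  also have "\<dots> = p * b + (1 - p)" 
    unfolding b_def v_def[symmetric] using iv T.prob_space by simp
  finally show "(r powr p - (1 - p)) / p \<le> b" using p by (simp add: field_simps)
  have "b \<le> (\<integral>w. B powr (1 - p) * v w powr p \<partial>tilted p)"
    unfolding b_def v_def[symmetric]
  proof (rule integral_mono_AE[OF iv])
    show "AE w in tilted p. v w \<le> B powr (1 - p) * v w powr p"
      using v by eventually_elim (use le_powr_bound[OF p] in blast)
  qed (use ip in simp)
  then show "b \<le> vmax u powr (1 - p) * r powr p" by (simp add: mom B_def)
qed

text \<open>The generator is a weak limit of the tilted laws as \<open>p\<close> tends to 1. Its maximum is at most 1 with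
  mean 1, and its margins do not vanish because \<open>L(u) \<ge> c\<^sub>j u\<^sub>j\<close>.\<close>

lemma spectral_representation:
  assumes ms: "max_stable P"
  obtains M :: "('n \<Rightarrow> real) measure" where "generator M" "AE z in M. vmax z = 1"
    "\<And>u. (\<And>j. 0 < u j) \<Longrightarrow> L u = L ones * D_norm M u"
proof -
  \<comment> \<open>any sequence in the open unit interval with limit 1 would do\<close>
  define p where "p n = 1 - 1 / real (Suc (Suc n))" for n
  have p: "0 < p n" "p n < 1" for n by (auto simp: p_def)
  have p1: "p \<longlonglongrightarrow> 1"
  proof -
    have "(\<lambda>n. 1 - 1 / real (Suc (Suc n))) \<longlonglongrightarrow> 1 - 0"
      by (intro tendsto_intros filterlim_compose[OF LIMSEQ_inverse_real_of_nat[unfolded inverse_eq_divide] filterlim_Suc])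
    then show ?thesis by (simp add: p_def[abs_def])
  qed
  have sets_t: "sets (tilted (p n)) = sets real_space" for n by (simp add: tilted_def)
  have "\<exists>r M. strict_mono r \<and> prob_space M \<and> sets M = sets real_space \<and> (AE w in M. \<forall>j. 0 \<le> w j \<and> w j \<le> 1) \<and>
    (\<forall>u. (\<lambda>n. \<integral>w. vmax (\<lambda>j. w j * u j) \<partial>tilted (p (r n))) \<longlonglongrightarrow> (\<integral>w. vmax (\<lambda>j. w j * u j) \<partial>M))"
    by (rule unit_cube_compactness[where Q = "\<lambda>n. tilted (p n)", OF tilted_prob[OF ms p] sets_t tilted_cube])
      (intro exI conjI allI)
  then obtain r :: "nat \<Rightarrow> nat" and M :: "('n \<Rightarrow> real) measure"
    where r: "strict_mono r" and M: "prob_space M" "sets M = sets real_space"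
    and cube: "AE w in M. \<forall>j. 0 \<le> w j \<and> w j \<le> 1"
    and lim: "\<forall>u. (\<lambda>n. \<integral>w. vmax (\<lambda>j. w j * u j) \<partial>tilted (p (r n))) \<longlonglongrightarrow> (\<integral>w. vmax (\<lambda>j. w j * u j) \<partial>M)"
    by (elim exE conjE) (rule that)
  interpret M: prob_space M by (rule M)
  have D: "D_norm M u = L u / L ones" if u: "\<And>j. 0 < u j" for u
  proof -
    have L: "0 < L u" "0 < L ones" using L_pos[where u = u, OF ms u] L_pos[where u = ones, OF ms] by auto
    let ?q = "L u / L ones"
    define B where "B = vmax u"
    have B: "0 < B" unfolding B_def using u[of undefined] vmax_ge[of u undefined] by (rule less_le_trans)
    have lo: "(\<lambda>n. (?q powr p n - (1 - p n)) / p n) \<longlonglongrightarrow> (?q powr 1 - (1 - 1)) / 1"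
      using L by (intro tendsto_intros p1) auto
    have up: "(\<lambda>n. B powr (1 - p n) * ?q powr p n) \<longlonglongrightarrow> B powr (1 - 1) * ?q powr 1"
      using L B by (intro tendsto_intros p1) auto
    note bounds = tilted_bounds[where u = u, OF ms p u, folded B_def]
    have "(\<lambda>n. \<integral>w. vmax (\<lambda>j. w j * u j) \<partial>tilted (p n)) \<longlonglongrightarrow> ?q"
    proof (rule tendsto_sandwich)
      show "(\<lambda>n. (?q powr p n - (1 - p n)) / p n) \<longlonglongrightarrow> ?q" using lo L by simp
      show "(\<lambda>n. B powr (1 - p n) * ?q powr p n) \<longlonglongrightarrow> ?q" using up L B by simp
    qed (auto intro!: always_eventually bounds)
    from LIMSEQ_unique[OF lim[THEN spec, of u] LIMSEQ_subseq_LIMSEQ[OF this r, unfolded comp_def]] show ?thesis by (simp add: D_norm_def)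
  qed
  have m[measurable]: "(\<lambda>w. w j) \<in> borel_measurable M" for j using M(2) by (simp cong: measurable_cong_sets)
  have int: "integrable M (\<lambda>w. w j)" for j
    by (rule M.integrable_const_bound[of _ 1]) (use cube in \<open>auto elim!: eventually_mono\<close>)
  have intv: "integrable M (\<lambda>w. vmax (\<lambda>j. w j * u j))" for u
    by (rule M.integrable_const_bound[of _ "vmax (\<lambda>j. \<bar>u j\<bar>)"])
      (use cube in \<open>auto elim!: eventually_mono intro!: vmax_abs_le simp del: Max_ge_iff Max_le_iff\<close>)
  have "(\<integral>w. w j \<partial>M) > 0" for j
  proof -
    define q where "q = c j / L ones"
    \<comment> \<open>a positive weight for the other coordinates, smaller than the lower bound for \<open>D(u)\<close>\<close>
    define \<epsilon> where "\<epsilon> = min 1 (q / 2)"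
    have L1: "0 < L ones" using L_pos[where u = ones, OF ms] by simp
    have "0 < q" unfolding q_def using c_pos[of j] L1 by (rule divide_pos_pos)
    then have e: "0 < \<epsilon>" "\<epsilon> \<le> 1" "\<epsilon> < c j / L ones"
      unfolding q_def[symmetric] by (auto simp: \<epsilon>_def min_less_iff_disj)
    let ?u = "\<lambda>i. if i = j then 1 else \<epsilon>"
    have "c j * ?u j \<le> L ?u" by (rule L_ge[OF ms]) (use e in auto)
    then have "c j / L ones \<le> D_norm M ?u" using L1 e by (subst D) (auto intro: divide_right_mono)
    also have "\<dots> \<le> (\<integral>w. w j + \<epsilon> \<partial>M)"
      unfolding D_norm_def
    proof (rule integral_mono_AE[OF intv])
      show "AE w in M. vmax (\<lambda>i. w i * ?u i) \<le> w j + \<epsilon>"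
        using cube
      proof eventually_elim
        case (elim w)
        have "w i * ?u i \<le> w j + \<epsilon>" for i
        proof (cases "i = j")
          case False
          have "w i * \<epsilon> \<le> 1 * \<epsilon>" using elim e by (intro mult_right_mono) auto
          moreover have "0 \<le> w j" using elim by blast
          ultimately show ?thesis using False by simp
        qed (use e in simp)
        then show ?case unfolding vmax_le_iff by blast
      qed
    qed (use int in simp)
    also have "\<dots> = (\<integral>w. w j \<partial>M) + \<epsilon>" using int M.prob_space by simp
    finally show ?thesis using e by simp
  qed
  then have gen: "generator M"
    unfolding generator_def using M int cube by (auto elim: eventually_mono)
  have one: "AE z in M. vmax z = 1"
  proof -
    have le: "AE z in M. 0 \<le> 1 - vmax z"
      using cube
    proof eventually_elim
      case (elim z)
      then have "vmax z \<le> 1" unfolding vmax_le_iff by blast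
      then show ?case by (simp only: diff_ge_0_iff_ge)
    qed
    have iv: "integrable M vmax" using intv[of ones] by simp
    have "(\<integral>z. 1 - vmax z \<partial>M) = 1 - D_norm M ones" using iv M.prob_space by (simp add: D_norm_def)
    also have "\<dots> = 0" using D[of ones] L_pos[where u = ones, OF ms] by simp
    finally have "AE z in M. 1 - vmax z = 0"
      using integral_nonneg_eq_0_iff_AE[of M "\<lambda>z. 1 - vmax z"] le iv by simp
    then show ?thesis by eventually_elim linarith
  qed
  show thesis
    by (rule that[OF gen one]) (use D L_pos[where u = ones, OF ms] in simp)
qed

text \<open>Between the endpoints the cdf is known from the spectral representation. At or above an upper
  endpoint the tail value \<open>0\<close> is approximated by \<open>1/n\<close>.\<close>

lemma gp_of_in_gp_laws1:
  assumes ms: "max_stable P" shows "gp_of P \<in> gp_laws1 \<sigma> \<gamma>"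
proof -
  obtain M where M: "generator M" "AE z in M. vmax z = 1"
    and LD: "\<And>u. (\<And>j. 0 < u j) \<Longrightarrow> L u = L ones * D_norm M u"
    using spectral_representation[OF ms] by blast
  interpret G: gen M \<sigma> \<gamma> by (intro gen.intro M sigma_pos)
  have L1: "0 < L ones" using L_pos[where u = ones, OF ms] by simp
  have "real_cdf P x = exp (- (L ones * D_norm M (\<lambda>j. etail (\<gamma> j) (\<sigma> j) (x j))))"
    if x: "\<And>j. above_end (\<gamma> j) (\<sigma> j) (x j)" for x
  proof -
    define e where "e j = etail (\<gamma> j) (\<sigma> j) (x j)" for j
    define v where "v n j = max (e j) (1 / real (Suc n))" for n j
    have v: "0 < v n j" for n j by (simp add: v_def less_max_iff_disj)
    have e0: "0 \<le> e j" for j by (simp add: e_def)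
    have dec: "v n j \<le> v m j" if "m \<le> n" for m n j
      unfolding v_def using that by (intro max.mono order_refl divide_left_mono) auto
    have "(\<lambda>n. measure P {y. \<forall>j. y j \<le> xinv (v n) j}) \<longlonglongrightarrow> measure P (\<Union>n. {y. \<forall>j. y j \<le> xinv (v n) j})"
    proof (rule finite_Lim_measure_incseq)
      show "incseq (\<lambda>n. {y. \<forall>j. y j \<le> xinv (v n) j})"
      proof (rule incseq_SucI, safe)
        fix n y j assume "\<forall>j. y j \<le> xinv (v n) j"
        moreover have "xinv (v n) j \<le> xinv (v (Suc n)) j"
          using dec[of n "Suc n" j] v sigma_pos
          by (subst etail_inv_le_iff) (auto simp: etail_etail_inv inside_imp_above_end inside_etail_inv)
        ultimately show "y j \<le> xinv (v (Suc n)) j" by (meson order_trans)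
      qed
    qed (use P_box_sets(1) in auto)
    also have "measure P (\<Union>n. {y. \<forall>j. y j \<le> xinv (v n) j}) = measure P {y. \<forall>j. y j \<le> x j}"
    proof (rule finite_measure_eq_AE)
      show "AE y in P. (y \<in> (\<Union>n. {y. \<forall>j. y j \<le> xinv (v n) j})) = (y \<in> {y. \<forall>j. y j \<le> x j})"
        using AE_inside
      proof eventually_elim
        case (elim y)
        have pos: "0 < etail (\<gamma> j) (\<sigma> j) (y j)" for j using elim sigma_pos by (intro etail_pos) auto
        have le1: "y j \<le> xinv (v n) j \<longleftrightarrow> v n j \<le> etail (\<gamma> j) (\<sigma> j) (y j)" for n j
          using elim v by (intro le_etail_inv_iff) auto
        have le2: "y j \<le> x j \<longleftrightarrow> e j \<le> etail (\<gamma> j) (\<sigma> j) (y j)" for j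
          using etail_inv_le_iff[OF sigma_pos[of j] pos[of j], of "\<gamma> j" "x j"] x[of j] elim
          by (simp add: etail_inv_etail sigma_pos e_def)
        have "\<exists>n. 1 / real (Suc n) < etail (\<gamma> j) (\<sigma> j) (y j)" for j using nat_approx_posE[OF pos[of j]] by metis
        then obtain N where N: "\<And>j. 1 / real (Suc (N j)) < etail (\<gamma> j) (\<sigma> j) (y j)" by metis
        have "1 / real (Suc (Max (range N))) \<le> etail (\<gamma> j) (\<sigma> j) (y j)" for j
        proof -
          have "N j \<le> Max (range N)" by (rule Max_ge) auto
          then have "1 / real (Suc (Max (range N))) \<le> 1 / real (Suc (N j))" by (intro divide_left_mono) auto
          then show ?thesis using N[of j] by linarith
        qed
        then have "(\<forall>j. e j \<le> etail (\<gamma> j) (\<sigma> j) (y j)) \<longleftrightarrow> (\<exists>n. \<forall>j. v n j \<le> etail (\<gamma> j) (\<sigma> j) (y j))"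
          unfolding v_def max.bounded_iff by blast
        then show ?case by (simp add: le1 le2)
      qed
    qed (use P_box_sets(1) in auto)
    finally have lim: "(\<lambda>n. exp (- (L ones * D_norm M (v n)))) \<longlonglongrightarrow> real_cdf P x"
      by (simp add: real_cdf_eq[symmetric] cdf_xinv[OF ms v] LD[OF v])
    have up: "D_norm M (v n) \<le> D_norm M e + 1 / real (Suc n) * D_norm M ones" for n
    proof -
      have "D_norm M (v n) \<le> (\<integral>z. vmax (\<lambda>j. z j * e j) + 1 / real (Suc n) * vmax z \<partial>M)"
        unfolding D_norm_def
      proof (rule integral_mono_AE)
        show "AE z in M. vmax (\<lambda>j. z j * v n j) \<le> vmax (\<lambda>j. z j * e j) + 1 / real (Suc n) * vmax z"
          using G.nonneg
        proof eventually_elim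
          case (elim z)
          have "z j * v n j \<le> vmax (\<lambda>j. z j * e j) + 1 / real (Suc n) * vmax z" for j
          proof -
            have "z j * v n j \<le> z j * (e j + 1 / real (Suc n))"
              using elim e0[of j] by (intro mult_left_mono) (auto simp: v_def)
            also have "\<dots> = z j * e j + 1 / real (Suc n) * z j" by (simp add: distrib_left)
            also have "\<dots> \<le> vmax (\<lambda>j. z j * e j) + 1 / real (Suc n) * vmax z"
              by (intro add_mono mult_left_mono vmax_ge[of "\<lambda>j. z j * e j"] vmax_ge) simp
            finally show ?thesis .
          qed
          then show ?case unfolding vmax_le_iff by blast
        qed
        show "integrable M (\<lambda>z. vmax (\<lambda>j. z j * v n j))" by (rule G.integrable_vmax) (simp add: v less_imp_le)
        show "integrable M (\<lambda>z. vmax (\<lambda>j. z j * e j) + 1 / real (Suc n) * vmax z)"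
          by (intro Bochner_Integration.integrable_add integrable_mult_right G.integrable_vmax G.integrable_vmax1 e0)
      qed
      also have "\<dots> = D_norm M e + 1 / real (Suc n) * D_norm M ones"
        unfolding D_norm_def using G.integrable_vmax[of e, OF e0] G.integrable_vmax1
        by (subst Bochner_Integration.integral_add) auto
      finally show ?thesis .
    qed
    have lo: "D_norm M e \<le> D_norm M (v n)" for n by (rule G.D_norm_mono) (auto simp: e0 v_def)
    have "(\<lambda>n. D_norm M e + 1 / real (Suc n) * D_norm M ones) \<longlonglongrightarrow> D_norm M e + 0 * D_norm M ones"
      by (intro tendsto_intros LIMSEQ_inverse_real_of_nat[unfolded inverse_eq_divide])
    then have u: "(\<lambda>n. D_norm M e + 1 / real (Suc n) * D_norm M ones) \<longlonglongrightarrow> D_norm M e" by simp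
    have "(\<lambda>n. D_norm M (v n)) \<longlonglongrightarrow> D_norm M e"
      by (rule tendsto_sandwich[OF _ _ tendsto_const u]) (intro always_eventually allI lo up)+
    then have "(\<lambda>n. exp (- (L ones * D_norm M (v n)))) \<longlonglongrightarrow> exp (- (L ones * D_norm M e))"
      by (intro tendsto_intros)
    from LIMSEQ_unique[OF lim this] show ?thesis by (simp add: e_def[abs_def])
  qed
  from gp_of_eq[OF M(1) L1 this] show ?thesis using M by (auto simp: gp_laws1_def)
qed

end

lemma GP_class_subset_gp_laws1:
  assumes sigma: "\<And>j. 0 < \<sigma> j" shows "GP_class \<sigma> \<gamma> \<subseteq> gp_laws1 \<sigma> \<gamma>"
proof
  fix \<mu> assume "\<mu> \<in> GP_class \<sigma> \<gamma>"
  then obtain P m \<alpha> where \<mu>: "\<mu> = gp_of P" and gev: "is_gev P" and gm: "gev_margins P \<gamma> m \<alpha>"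
    and \<sigma>: "\<And>j. \<sigma> j = \<alpha> j - \<gamma> j * m j"
    unfolding GP_class_def by blast
  define c where "c j = (if \<gamma> j = 0 then exp (m j / \<sigma> j) else (\<alpha> j / \<sigma> j) powr (1 / \<gamma> j))" for j
  have \<alpha>: "0 < \<alpha> j" for j using gm by (simp add: gev_margins_def)
  interpret real_law P
    using gev by (intro real_law.intro real_law_axioms.intro) (auto simp: is_gev_def)
  interpret frechet_margins P \<sigma> \<gamma> c
  proof
    show "0 < \<sigma> j" for j by (rule sigma)
    show "0 < c j" for j using sigma[of j] \<alpha>[of j] by (simp add: c_def)
    show "margin_cdf P j x = exp (- (c j * etail (\<gamma> j) (\<sigma> j) x))" if x: "inside (\<gamma> j) (\<sigma> j) x" for j x
    proof -
      have "0 < \<alpha> j + \<gamma> j * (x - m j)" using x \<sigma>[of j] by (simp add: inside_def right_diff_distrib)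
      then have "margin_cdf P j x = exp (- gp_tail (\<gamma> j) ((x - m j) / \<alpha> j))"
        using gm by (simp add: gev_margins_def)
      then show ?thesis using gp_tail_scale[OF sigma \<alpha> \<sigma> x] by (simp add: c_def)
    qed
  qed
  show "\<mu> \<in> gp_laws1 \<sigma> \<gamma>"
    unfolding \<mu> using gev by (intro gp_of_in_gp_laws1) (simp add: is_gev_def)
qed

section \<open>Equality of the classes\<close>

theorem theorem4:
  fixes \<sigma> \<gamma> :: "'n::finite \<Rightarrow> real"
  assumes "\<forall>j. 0 < \<sigma> j"
  shows "GP_R_class \<sigma> \<gamma> = GP_class \<sigma> \<gamma> \<and>
         GP_U_class \<sigma> \<gamma> = GP_class \<sigma> \<gamma> \<and>
         GP_S_class \<sigma> \<gamma> = GP_class \<sigma> \<gamma> \<and>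
         (\<forall>\<mu> \<in> GP_R_class \<sigma> \<gamma> \<union> GP_U_class \<sigma> \<gamma> \<union> GP_S_class \<sigma> \<gamma>. \<forall>j.
            0 < \<P>(y in \<mu>. 0 < y j) \<and>
            (\<forall>x. 0 \<le> x \<and> 0 < \<sigma> j + \<gamma> j * x \<longrightarrow>
               \<P>(y in \<mu>. y j \<le> ereal x \<bar> 0 < y j) = 1 - gp_tail (\<gamma> j) (x / \<sigma> j)))"
proof -
  have sigma: "0 < \<sigma> j" for j using assms by blast
  have sub: "gp_laws1 \<sigma> \<gamma> \<subseteq> gp_laws \<sigma> \<gamma>" by (auto simp: gp_laws_def gp_laws1_def)
  have "gp_laws \<sigma> \<gamma> \<subseteq> GP_class \<sigma> \<gamma>"
    using gen.gp_law_in_GP_class[OF gen.intro[OF _ sigma]] by (auto simp: gp_laws_def)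
  with GP_class_subset_gp_laws1[where \<sigma> = \<sigma> and \<gamma> = \<gamma>, OF sigma] sub
  have eq: "gp_laws \<sigma> \<gamma> = GP_class \<sigma> \<gamma>" "gp_laws1 \<sigma> \<gamma> = GP_class \<sigma> \<gamma>" by auto
  have classes: "GP_R_class \<sigma> \<gamma> = gp_laws \<sigma> \<gamma>" "GP_U_class \<sigma> \<gamma> = gp_laws \<sigma> \<gamma>" "GP_S_class \<sigma> \<gamma> = gp_laws1 \<sigma> \<gamma>"
    by (rule R_class_eq U_class_eq S_class_eq, rule sigma)+
  have "0 < \<P>(y in \<mu>. 0 < y j) \<and>
      (\<forall>x. 0 \<le> x \<and> 0 < \<sigma> j + \<gamma> j * x \<longrightarrow> \<P>(y in \<mu>. y j \<le> ereal x \<bar> 0 < y j) = 1 - gp_tail (\<gamma> j) (x / \<sigma> j))"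
    if mu: "\<mu> \<in> gp_laws \<sigma> \<gamma>" for \<mu> j
  proof -
    obtain M where M: "generator M" and \<mu>: "\<mu> = gp_law \<sigma> \<gamma> M" using mu unfolding gp_laws_def by blast
    interpret gen M \<sigma> \<gamma> by (intro gen.intro M sigma)
    show ?thesis unfolding \<mu> using gp_law_margin by blast
  qed
  then show ?thesis unfolding classes eq by blast
qed

end
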